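(* Let $C \subset \mathbb{C}^2$ be a reduced plane curve in general position at infinity such that $\pi_1(\mathbb{C}^2 \setminus C)$ is isomorphic to the Artin group of one of the following spherical types: $A_n$ with $n \geq 4$; $B_n$ with $n \geq 5$; $D_n$ with $n \geq 5$; $E_n$ with $n \in \{6,7,8\}$; $H_n$ with $n \in \{3,4\}$. Then $\delta_k(C) = 0$ for all $k \geq 0$.
   Context: The Artin group of a given Coxeter type (with Coxeter matrix $(m_{ij})$) is generated by $\sigma_1, \dots, \sigma_N$ with relations $\sigma_i\sigma_j\sigma_i\cdots = \sigma_j\sigma_i\sigma_j\cdots$ ($m_{ij}$ factors on each side) for $i \neq j$; it is of spherical type if the associated Coxeter group is finite. Higher-order degrees. Let $C \subset \mathbb{C}^2$ be a reduced affine plane curve in general position at infinity (its projective completion is transverse to the line at infinity), with complement $\mathcal{U} = \mathbb{C}^2 \setminus C$ and $G = \pi_1(\mathcal{U})$. The rational derived series of $G$ is defined by $G_r^{(0)} = G$ and, for $k \ge 1$, $G_r^{(k)} = \{ g \in G_r^{(k-1)} \mid g^m \in [G_r^{(k-1)}, G_r^{(k-1)}] \text{ for some } m \in \mathbb{Z}\setminus\{0\} \}$. Set $\Gamma_k = G/G_r^{(k+1)}$; this group is poly-torsion-free-abelian. Let $\psi : G \to \mathbb{Z}$ be the total linking number homomorphism $\alpha \mapsto \mathrm{lk}(\alpha, C)$, which sends the positively oriented meridian of every irreducible component of $C$ to $1$. It factors through an epimorphism $\bar\psi : \Gamma_k \to \mathbb{Z}$, whose kernel is denoted $\bar\Gamma_k$.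 The ring $\mathbb{Z}\bar\Gamma_k$ is an Ore domain; let $S_k = \mathbb{Z}\bar\Gamma_k \setminus \{0\}$, let $\mathbb{K}_k = (\mathbb{Z}\bar\Gamma_k) S_k^{-1}$ be its skew field of right quotients, and let $R_k = (\mathbb{Z}\Gamma_k) S_k^{-1}$, which is a (noncommutative) principal ideal domain containing $\mathbb{K}_k$ (it is isomorphic to a skew Laurent polynomial ring $\mathbb{K}_k[t^{\pm 1}]$). The $k$-th order localized Alexander module of $C$ is $\mathcal{A}_k(C) = H_1(\mathcal{U}; R_k)$, the homology with coefficients twisted by $\pi_1(\mathcal{U}) \to \Gamma_k \subset R_k$, viewed as a right $R_k$-module. The $k$-th order degree of $C$ is $\delta_k(C) = \mathrm{rk}_{\mathbb{K}_k} \mathcal{A}_k(C)$ (possibly $\infty$ a priori). *)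

theory Defs
  imports
    "HOL-Complex_Analysis.Complex_Analysis"
    "HOL-Homology.Homology"
    "HOL-Algebra.Generated_Groups"
    "HOL-Computational_Algebra.Computational_Algebra"
    "HOL-Library.Extended_Nat"
begin

section \<open>Artin groups\<close>

text \<open>
  A letter \<open>(i, True)\<close> stands for the generator with index \<open>i\<close>, and \<open>(i, False)\<close> for its inverse.
  Generators are indexed by \<open>{1..N}\<close>. An entry \<open>0\<close> of the Coxeter matrix encodes infinity:
  the corresponding relation is the trivial one.
\<close>

type_synonym word = "(nat \<times> bool) list"

definition words :: "nat \<Rightarrow> word set" where
  "words N = lists ({1..N} \<times> UNIV)"

fun alternating_word :: "nat \<Rightarrow> nat \<Rightarrow> nat \<Rightarrow> word" where
  "alternating_word i j 0 = []"
| "alternating_word i j (Suc m) = (i, True) # alternating_word j i m"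

inductive artin_eq :: "nat \<Rightarrow> (nat \<Rightarrow> nat \<Rightarrow> nat) \<Rightarrow> word \<Rightarrow> word \<Rightarrow> bool"
  for N :: nat and M :: "nat \<Rightarrow> nat \<Rightarrow> nat" where
  refl: "artin_eq N M u u"
| sym: "artin_eq N M u v \<Longrightarrow> artin_eq N M v u"
| trans: "artin_eq N M u v \<Longrightarrow> artin_eq N M v w \<Longrightarrow> artin_eq N M u w"
| append: "artin_eq N M u v \<Longrightarrow> artin_eq N M u' v' \<Longrightarrow> artin_eq N M (u @ u') (v @ v')"
| cancel: "i \<in> {1..N} \<Longrightarrow> artin_eq N M [(i, b), (i, \<not> b)] []"
| braid: "i \<in> {1..N} \<Longrightarrow> j \<in> {1..N} \<Longrightarrow> i \<noteq> j \<Longrightarrow>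
    artin_eq N M (alternating_word i j (M i j)) (alternating_word j i (M i j))"

definition artin_class :: "nat \<Rightarrow> (nat \<Rightarrow> nat \<Rightarrow> nat) \<Rightarrow> word \<Rightarrow> word set" where
  "artin_class N M u = {v \<in> words N. artin_eq N M u v}"

definition artin_group :: "nat \<Rightarrow> (nat \<Rightarrow> nat \<Rightarrow> nat) \<Rightarrow> word set monoid" where
  "artin_group N M =
    \<lparr>carrier = artin_class N M ` words N,
     monoid.mult = (\<lambda>X Y. \<Union>u\<in>X. \<Union>v\<in>Y. artin_class N M (u @ v)),
     one = artin_class N M []\<rparr>"

datatype coxeter_type = TypeA nat | TypeB nat | TypeD nat | TypeE nat | TypeH nat

fun coxeter_rank :: "coxeter_type \<Rightarrow> nat" where
  "coxeter_rank (TypeA n) = n"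
| "coxeter_rank (TypeB n) = n"
| "coxeter_rank (TypeD n) = n"
| "coxeter_rank (TypeE n) = n"
| "coxeter_rank (TypeH n) = n"

text \<open>
  \<open>coxeter_edge T i j\<close>, used for \<open>i < j\<close>, is the label of the Coxeter diagram between the
  vertices \<open>i\<close> and \<open>j\<close>, where \<open>2\<close> means that there is no edge.
  In types D and E the vertices \<open>1, \<dots>, n - 1\<close> form a chain, and the vertex \<open>n\<close> is attached to
  \<open>n - 2\<close> (type D) or to \<open>3\<close> (type E).
\<close>

fun coxeter_edge :: "coxeter_type \<Rightarrow> nat \<Rightarrow> nat \<Rightarrow> nat" where
  "coxeter_edge (TypeA n) i j = (if j = i + 1 then 3 else 2)"
| "coxeter_edge (TypeB n) i j = (if j = i + 1 then (if j = n then 4 else 3) else 2)"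
| "coxeter_edge (TypeD n) i j =
    (if j < n \<and> j = i + 1 \<or> j = n \<and> i + 2 = n then 3 else 2)"
| "coxeter_edge (TypeE n) i j =
    (if j < n \<and> j = i + 1 \<or> j = n \<and> i = 3 then 3 else 2)"
| "coxeter_edge (TypeH n) i j = (if j = i + 1 then (if i = 1 then 5 else 3) else 2)"

definition coxeter_matrix :: "coxeter_type \<Rightarrow> nat \<Rightarrow> nat \<Rightarrow> nat" where
  "coxeter_matrix T i j = (if i = j then 1 else coxeter_edge T (min i j) (max i j))"


section \<open>The fundamental group\<close>

definition loops :: "'a::real_normed_vector set \<Rightarrow> 'a \<Rightarrow> (real \<Rightarrow> 'a) set" where
  "loops U x = {p. path p \<and> path_image p \<subseteq> U \<and> pathstart p = x \<and> pathfinish p = x}"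

definition path_class :: "'a::real_normed_vector set \<Rightarrow> (real \<Rightarrow> 'a) \<Rightarrow> (real \<Rightarrow> 'a) set" where
  "path_class U p = {q. homotopic_paths U p q}"

definition fundamental_group ::
    "'a::real_normed_vector set \<Rightarrow> 'a \<Rightarrow> (real \<Rightarrow> 'a) set monoid" where
  "fundamental_group U x =
    \<lparr>carrier = path_class U ` loops U x,
     monoid.mult = (\<lambda>X Y. \<Union>p\<in>X. \<Union>q\<in>Y. path_class U (p +++ q)),
     one = path_class U (\<lambda>_. x)\<rparr>"


section \<open>Plane curves\<close>

text \<open>
  A polynomial in two variables \<open>x, y\<close> is a polynomial in \<open>y\<close> whose coefficients are polynomials
  in \<open>x\<close>, so the coefficient of \<open>x\<^sup>jy\<^sup>i\<close> in \<open>f\<close> is \<open>poly.coeff (poly.coeff f i) j\<close>.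
\<close>

definition eval2 :: "complex poly poly \<Rightarrow> complex \<times> complex \<Rightarrow> complex" where
  "eval2 f = (\<lambda>(x, y). poly (poly f [:y:]) x)"

definition total_degree :: "complex poly poly \<Rightarrow> nat" where
  "total_degree f = Max (insert 0 {i + j | i j. poly.coeff (poly.coeff f i) j \<noteq> 0})"

definition homogenization ::
    "complex poly poly \<Rightarrow> complex \<Rightarrow> complex \<Rightarrow> complex \<Rightarrow> complex" where
  "homogenization f x y z =
    (\<Sum>(i, j) | poly.coeff (poly.coeff f i) j \<noteq> 0.
       poly.coeff (poly.coeff f i) j * x ^ j * y ^ i * z ^ (total_degree f - (i + j)))"

text \<open>
  A reduced curve is given by its equation without multiple factors, which the curve
  determines up to a nonzero constant.
\<close>

definition reduced_plane_curve :: "complex poly poly \<Rightarrow> bool" where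
  "reduced_plane_curve f \<longleftrightarrow> squarefree f \<and> 0 < total_degree f"

definition curve_complement :: "complex poly poly \<Rightarrow> (complex \<times> complex) set" where
  "curve_complement f = - {q. eval2 f q = 0}"

text \<open>
  At a point \<open>[x : y : 0]\<close> of the projective completion \<open>F = 0\<close>, transversality to the
  line \<open>z = 0\<close> means that the differentials of \<open>F\<close> and of \<open>z\<close> are linearly independent,
  that is, the derivatives of \<open>F\<close> in the \<open>x\<close>- and \<open>y\<close>-directions do not both vanish.
\<close>

definition general_position_at_infinity :: "complex poly poly \<Rightarrow> bool" where
  "general_position_at_infinity f \<longleftrightarrow>
    (\<forall>x y. (x, y) \<noteq> (0, 0) \<and> homogenization f x y 0 = 0 \<longrightarrow>
       deriv (\<lambda>u. homogenization f u y 0) x \<noteq> 0 \<or>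
       deriv (\<lambda>u. homogenization f x u 0) y \<noteq> 0)"

text \<open>
  The total linking number of a loop with the curve \<open>f = 0\<close>: its intersection number with the
  curve of a disc bounded by the loop, counted by the winding number of the image under \<open>f\<close>
  of the loop. Since \<open>f\<close> is reduced, every positively oriented meridian has linking number \<open>1\<close>,
  see \<open>linking_number_meridian\<close> below.
\<close>

definition linking_number ::
    "complex poly poly \<Rightarrow> (real \<Rightarrow> complex \<times> complex) \<Rightarrow> int" where
  "linking_number f p = (THE n. winding_number (eval2 f \<circ> p) 0 = of_int n)"

definition total_linking :: "complex poly poly \<Rightarrow> (real \<Rightarrow> complex \<times> complex) set \<Rightarrow> int" where
  "total_linking f X = the_elem (linking_number f ` X)"

definition meridian ::
    "complex poly poly \<Rightarrow> complex \<times> complex \<Rightarrow> (real \<Rightarrow> complex \<times> complex) \<Rightarrow> bool" where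
  "meridian f x0 m \<longleftrightarrow>
    (\<exists>a b u v r p. 0 < r \<and> eval2 f (a, b) = 0 \<and>
       deriv (\<lambda>s. eval2 f (a + s * u, b + s * v)) 0 \<noteq> 0 \<and>
       (\<forall>s. s \<noteq> 0 \<and> norm s \<le> r \<longrightarrow> (a + s * u, b + s * v) \<in> curve_complement f) \<and>
       path p \<and> path_image p \<subseteq> curve_complement f \<and>
       pathstart p = x0 \<and> pathfinish p = (a + of_real r * u, b + of_real r * v) \<and>
       m = p +++ ((\<lambda>s. (a + s * u, b + s * v)) \<circ> circlepath 0 r) +++ reversepath p)"

lemma eval2_has_derivative_along_line:
  "\<exists>D. ((\<lambda>s. eval2 f (a + s * u, b + s * v)) has_field_derivative D) (at s)"
proof (induction f)
  case 0
  then show ?case by (auto simp: eval2_def intro!: exI derivative_eq_intros)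
next
  case (pCons c f)
  obtain D where D: "((\<lambda>s. poly (poly f [:b + s * v:]) (a + s * u)) has_field_derivative D) (at s)"
    using pCons.IH by (auto simp: eval2_def)
  have "((\<lambda>s. poly c (a + s * u) + (b + s * v) * poly (poly f [:b + s * v:]) (a + s * u))
      has_field_derivative (poly (pderiv c) (a + s * u) * u +
        (v * poly (poly f [:b + s * v:]) (a + s * u) + D * (b + s * v)))) (at s)"
    by (rule D derivative_eq_intros DERIV_chain2[OF poly_DERIV] refl | simp)+
  then show ?case by (auto simp: eval2_def)
qed

lemma continuous_on_eval2: "continuous_on S (eval2 f)"
proof (induction f)
  case 0
  then show ?case by (simp add: eval2_def case_prod_unfold)
next
  case (pCons c f)
  then have "continuous_on S (\<lambda>q. poly c (fst q) + snd q * eval2 f q)"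
    by (intro continuous_intros)
  then show ?case by (simp add: eval2_def case_prod_unfold)
qed

lemma winding_number_simple_zero:
  fixes g :: "complex \<Rightarrow> complex"
  assumes hol: "g holomorphic_on UNIV" and "0 < r" "g 0 = 0" "deriv g 0 \<noteq> 0"
    and nz: "\<And>s. s \<noteq> 0 \<Longrightarrow> norm s \<le> r \<Longrightarrow> g s \<noteq> 0"
  shows "winding_number (g \<circ> circlepath 0 r) 0 = 1"
proof -
  define h where "h = (\<lambda>s. if s = 0 then deriv g 0 else g s / s)"
  have h: "continuous_on UNIV h"
    using pole_theorem_0[OF hol, of 0 h] \<open>g 0 = 0\<close>
    by (auto simp: h_def intro!: holomorphic_on_imp_continuous_on)
  have h_nz: "h s \<noteq> 0" if "norm s \<le> r" for s
    using nz that \<open>deriv g 0 \<noteq> 0\<close> by (auto simp: h_def)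
  have g: "g s = s * h s" for s
    using \<open>g 0 = 0\<close> by (auto simp: h_def)
  let ?c = "circlepath 0 r"
  let ?l = "(\<lambda>w. h 0 * w) \<circ> ?c"
  have norm_c: "norm (?c t) = r" for t
    using \<open>0 < r\<close> by (simp add: circlepath norm_mult)
  have "homotopic_loops (- {0}) ?l (g \<circ> ?c)"
    unfolding homotopic_loops
  proof (intro exI conjI ballI)
    let ?H = "\<lambda>(\<tau>, t). ?c t * h (of_real \<tau> * ?c t)"
    have c: "continuous_on S (\<lambda>x. ?c (snd x))" for S :: "(real \<times> real) set"
      by (simp add: circlepath) (intro continuous_intros)
    have "continuous_on ({0..1} \<times> {0..1}) (\<lambda>x. h (of_real (fst x) * ?c (snd x)))"
      by (rule continuous_on_compose2[OF h]) (auto intro!: continuous_intros c)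
    then show "continuous_on ({0..1} \<times> {0..1}) ?H"
      unfolding case_prod_unfold by (intro continuous_intros c)
    show "?H \<in> {0..1} \<times> {0..1} \<rightarrow> - {0}"
    proof (clarsimp simp del: mult_eq_0_iff, goal_cases)
      case (1 \<tau> t)
      then have "norm (of_real \<tau> * ?c t) \<le> r"
        using norm_c[of t] \<open>0 < r\<close> by (simp add: norm_mult mult_le_cancel_right1)
      moreover have "?c t \<noteq> 0"
        using norm_c[of t] \<open>0 < r\<close> by auto
      ultimately show False
        using h_nz 1 by (metis mult_eq_0_iff)
    qed
    show "?H (0, t) = ?l t" for t by simp
    show "?H (1, t) = (g \<circ> ?c) t" for t by (simp add: g)
    show "pathfinish (?H \<circ> Pair \<tau>) = pathstart (?H \<circ> Pair \<tau>)" for \<tau>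
      by (simp add: pathfinish_def pathstart_def circlepath)
  qed
  then have "winding_number (g \<circ> ?c) 0 = winding_number ?l 0"
    using winding_number_homotopic_loops by fastforce
  also have "?l = exp \<circ> (\<lambda>t. Ln (h 0 * of_real r) + 2 * of_real pi * \<i> * of_real t)"
    using h_nz[of 0] \<open>0 < r\<close> by (auto simp: fun_eq_iff circlepath exp_add)
  also have "winding_number \<dots> 0 = 1"
    by (subst winding_number_compose_exp)
      (auto simp: path_def pathfinish_def pathstart_def intro!: continuous_intros)
  finally show ?thesis .
qed

lemma linking_number_meridian:
  assumes "meridian f x0 m"
  shows "linking_number f m = 1"
proof -
  obtain a b u v r p where r: "0 < r" and ab: "eval2 f (a, b) = 0"
    and d: "deriv (\<lambda>s. eval2 f (a + s * u, b + s * v)) 0 \<noteq> 0"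
    and nz: "\<And>s. s \<noteq> 0 \<Longrightarrow> norm s \<le> r \<Longrightarrow> (a + s * u, b + s * v) \<in> curve_complement f"
    and p: "path p" "path_image p \<subseteq> curve_complement f"
      "pathfinish p = (a + of_real r * u, b + of_real r * v)"
    and m: "m = p +++ ((\<lambda>s. (a + s * u, b + s * v)) \<circ> circlepath 0 r) +++ reversepath p"
    using assms unfolding meridian_def by blast
  define g where "g = (\<lambda>s. eval2 f (a + s * u, b + s * v))"
  have hol: "g holomorphic_on UNIV"
    unfolding g_def holomorphic_on_def field_differentiable_def
    using eval2_has_derivative_along_line by simp
  let ?q = "eval2 f \<circ> p" and ?c = "g \<circ> circlepath 0 r"
  have q: "path ?q" "0 \<notin> path_image ?q"
    using p by (auto intro!: path_continuous_image continuous_on_eval2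
        simp: path_image_compose curve_complement_def)
  have cc: "path ?c"
    using holomorphic_on_imp_continuous_on[OF hol]
    by (auto intro!: path_continuous_image intro: continuous_on_subset)
  have c0: "0 \<notin> path_image ?c"
    using r nz by (fastforce simp: path_image_compose g_def curve_complement_def)
  have ends: "pathfinish ?q = pathstart ?c" "pathfinish ?c = pathfinish ?q"
    using p(3) by (simp_all add: pathfinish_compose pathstart_compose g_def)
  have "eval2 f \<circ> m = ?q +++ ?c +++ reversepath ?q"
  proof -
    have "?c = eval2 f \<circ> ((\<lambda>s. (a + s * u, b + s * v)) \<circ> circlepath 0 r)"
      by (simp add: g_def fun_eq_iff)
    then show ?thesis
      by (simp only: m path_compose_join path_compose_reversepath)
  qed
  moreover have "winding_number (?q +++ ?c +++ reversepath ?q) 0 = winding_number ?c 0"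
    using q cc c0 ends
    by (simp add: winding_number_join winding_number_reversepath path_image_join)
  moreover have "winding_number ?c 0 = 1"
    using r ab d nz by (intro winding_number_simple_zero hol) (auto simp: g_def curve_complement_def)
  ultimately show ?thesis
    by (auto simp: linking_number_def)
qed


section \<open>The rational derived series and the groups \<open>\<Gamma>\<^sub>k\<close>\<close>

primrec rational_derived :: "('a, 'b) monoid_scheme \<Rightarrow> nat \<Rightarrow> 'a set" where
  "rational_derived G 0 = carrier G"
| "rational_derived G (Suc k) =
    {g \<in> rational_derived G k.
       \<exists>m::int. m \<noteq> 0 \<and> g [^]\<^bsub>G\<^esub> m \<in> derived G (rational_derived G k)}"

definition Gamma :: "('a, 'b) monoid_scheme \<Rightarrow> nat \<Rightarrow> 'a set monoid" where
  "Gamma G k = G Mod rational_derived G (Suc k)"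

definition Gamma_bar :: "('a, 'b) monoid_scheme \<Rightarrow> ('a \<Rightarrow> int) \<Rightarrow> nat \<Rightarrow> 'a set set" where
  "Gamma_bar G \<psi> k = kernel (Gamma G k) integer_group (\<lambda>X. the_elem (\<psi> ` X))"


section \<open>Group rings and rings of right fractions\<close>

definition group_ring :: "('g, 'm) monoid_scheme \<Rightarrow> ('g \<Rightarrow> int) ring" where
  "group_ring G =
    \<lparr>carrier = {a. finite {g. a g \<noteq> 0} \<and> {g. a g \<noteq> 0} \<subseteq> carrier G},
     monoid.mult = (\<lambda>a b g. \<Sum>(h, h') | a h \<noteq> 0 \<and> b h' \<noteq> 0 \<and> h \<otimes>\<^bsub>G\<^esub> h' = g. a h * b h'),
     one = (\<lambda>g. of_bool (g = \<one>\<^bsub>G\<^esub>)),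
     zero = (\<lambda>g. 0),
     add = (\<lambda>a b g. a g + b g)\<rparr>"

text \<open>
  \<open>right_fraction R S r s\<close> is the fraction \<open>r s\<^sup>-\<^sup>1\<close>, as an equivalence class of pairs, for a
  right Ore set \<open>S\<close> in \<open>R\<close>. Sums are computed on common right denominators; products by
  \<open>(r s\<^sup>-\<^sup>1)(r' s'\<^sup>-\<^sup>1) = (r u)(s' v)\<^sup>-\<^sup>1\<close> where \<open>s u = r' v\<close> with \<open>v \<in> S\<close>.
\<close>

definition right_fraction ::
    "('r, 'm) ring_scheme \<Rightarrow> 'r set \<Rightarrow> 'r \<Rightarrow> 'r \<Rightarrow> ('r \<times> 'r) set" where
  "right_fraction R S r s =
    {(r', s'). r' \<in> carrier R \<and> s' \<in> S \<and>
       (\<exists>u\<in>carrier R. \<exists>u'\<in>carrier R.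
          s \<otimes>\<^bsub>R\<^esub> u \<in> S \<and> s \<otimes>\<^bsub>R\<^esub> u = s' \<otimes>\<^bsub>R\<^esub> u' \<and> r \<otimes>\<^bsub>R\<^esub> u = r' \<otimes>\<^bsub>R\<^esub> u')}"

definition right_fractions ::
    "('r, 'm) ring_scheme \<Rightarrow> 'r set \<Rightarrow> ('r \<times> 'r) set ring" where
  "right_fractions R S =
    \<lparr>carrier = {right_fraction R S r s | r s. r \<in> carrier R \<and> s \<in> S},
     monoid.mult = (\<lambda>X Y. \<Union>(r, s)\<in>X. \<Union>(r', s')\<in>Y.
        \<Union>{right_fraction R S (r \<otimes>\<^bsub>R\<^esub> u) (s' \<otimes>\<^bsub>R\<^esub> v) | u v.
             u \<in> carrier R \<and> v \<in> S \<and> s \<otimes>\<^bsub>R\<^esub> u = r' \<otimes>\<^bsub>R\<^esub> v}),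
     one = right_fraction R S \<one>\<^bsub>R\<^esub> \<one>\<^bsub>R\<^esub>,
     zero = right_fraction R S \<zero>\<^bsub>R\<^esub> \<one>\<^bsub>R\<^esub>,
     add = (\<lambda>X Y. \<Union>(r, s)\<in>X. \<Union>(r', s')\<in>Y.
        \<Union>{right_fraction R S (r \<otimes>\<^bsub>R\<^esub> u \<oplus>\<^bsub>R\<^esub> r' \<otimes>\<^bsub>R\<^esub> u') (s \<otimes>\<^bsub>R\<^esub> u) | u u'.
             u \<in> carrier R \<and> u' \<in> carrier R \<and> s \<otimes>\<^bsub>R\<^esub> u \<in> S \<and> s \<otimes>\<^bsub>R\<^esub> u = s' \<otimes>\<^bsub>R\<^esub> u'})\<rparr>"


section \<open>Homology with twisted coefficients\<close>

text \<open>
  \<open>C\<^sub>*(U; R)\<close> is the complex of finite sums \<open>\<Sum>\<sigma> \<otimes> c\<^sub>\<sigma>\<close> of singular simplices of the universal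
  cover tensored with \<open>R\<close> over the group ring of the fundamental group, written in the basis
  consisting of one lift of every singular simplex \<open>\<sigma>\<close> of \<open>U\<close>: the point over \<open>\<sigma>(v\<^sub>0)\<close> in this
  lift is the class of the path \<open>base_path U x\<^sub>0 (\<sigma>(v\<^sub>0))\<close>. All faces of the lift except the
  0-th are then again chosen lifts; the 0-th face is the chosen lift translated by the class
  \<open>g\<close> of the loop along the base path to \<open>\<sigma>(v\<^sub>0)\<close>, the edge \<open>v\<^sub>0v\<^sub>1\<close> and the reversed base path to
  \<open>\<sigma>(v\<^sub>1)\<close>. With the left translation \<open>g x\<close> on the cover turned into a right action \<open>x g\<^sup>-\<^sup>1\<close>, the
  0-th face contributes the coefficient \<open>\<rho>(g\<^sup>-\<^sup>1) c\<^sub>\<sigma>\<close>, where \<open>\<rho>\<close> maps the fundamental group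
  to \<open>R\<close>.
\<close>

definition base_path :: "'a::real_normed_vector set \<Rightarrow> 'a \<Rightarrow> 'a \<Rightarrow> real \<Rightarrow> 'a" where
  "base_path U x0 x =
    (SOME p. path p \<and> path_image p \<subseteq> U \<and> pathstart p = x0 \<and> pathfinish p = x)"

definition first_edge :: "((nat \<Rightarrow> real) \<Rightarrow> 'a) \<Rightarrow> real \<Rightarrow> 'a" where
  "first_edge \<sigma> t = \<sigma> (\<lambda>i. if i = 0 then 1 - t else if i = 1 then t else 0)"

definition twist ::
    "'a::real_normed_vector set \<Rightarrow> 'a \<Rightarrow> ((real \<Rightarrow> 'a) set \<Rightarrow> 'r) \<Rightarrow> ((nat \<Rightarrow> real) \<Rightarrow> 'a) \<Rightarrow> 'r" where
  "twist U x0 \<rho> \<sigma> =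
    \<rho> (path_class U (base_path U x0 (pathfinish (first_edge \<sigma>)) +++
        reversepath (first_edge \<sigma>) +++
        reversepath (base_path U x0 (pathstart (first_edge \<sigma>)))))"

definition twisted_chains ::
    "'a::real_normed_vector set \<Rightarrow> ('r, 'm) ring_scheme \<Rightarrow> nat \<Rightarrow>
     (((nat \<Rightarrow> real) \<Rightarrow> 'a) \<Rightarrow> 'r) monoid" where
  "twisted_chains U R p =
    \<lparr>carrier = {c. (\<forall>\<sigma>. c \<sigma> \<in> carrier R) \<and> finite {\<sigma>. c \<sigma> \<noteq> \<zero>\<^bsub>R\<^esub>} \<and>
        (\<forall>\<sigma>. c \<sigma> \<noteq> \<zero>\<^bsub>R\<^esub> \<longrightarrow> singular_simplex p (top_of_set U) \<sigma>)},
     monoid.mult = (\<lambda>c d \<sigma>. c \<sigma> \<oplus>\<^bsub>R\<^esub> d \<sigma>),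
     one = (\<lambda>\<sigma>. \<zero>\<^bsub>R\<^esub>)\<rparr>"

definition twisted_boundary ::
    "'a::real_normed_vector set \<Rightarrow> 'a \<Rightarrow> ('r, 'm) ring_scheme \<Rightarrow> ((real \<Rightarrow> 'a) set \<Rightarrow> 'r) \<Rightarrow> nat \<Rightarrow>
     (((nat \<Rightarrow> real) \<Rightarrow> 'a) \<Rightarrow> 'r) \<Rightarrow> (((nat \<Rightarrow> real) \<Rightarrow> 'a) \<Rightarrow> 'r)" where
  "twisted_boundary U x0 R \<rho> p c =
    (if p = 0 then (\<lambda>\<tau>. \<zero>\<^bsub>R\<^esub>)
     else (\<lambda>\<tau>. finsum R
        (\<lambda>(\<sigma>, i). let a = (if i = 0 then twist U x0 \<rho> \<sigma> \<otimes>\<^bsub>R\<^esub> c \<sigma> else c \<sigma>)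
                   in if even i then a else \<ominus>\<^bsub>R\<^esub> a)
        {(\<sigma>, i). c \<sigma> \<noteq> \<zero>\<^bsub>R\<^esub> \<and> i \<le> p \<and> singular_face p i \<sigma> = \<tau>}))"

definition twisted_cycles where
  "twisted_cycles U x0 R \<rho> p =
    kernel (twisted_chains U R p) (twisted_chains U R (p - 1)) (twisted_boundary U x0 R \<rho> p)"

definition twisted_boundaries where
  "twisted_boundaries U x0 R \<rho> p =
    twisted_boundary U x0 R \<rho> (Suc p) ` carrier (twisted_chains U R (Suc p))"

definition twisted_homology ::
    "'a::real_normed_vector set \<Rightarrow> 'a \<Rightarrow> ('r, 'm) ring_scheme \<Rightarrow> ((real \<Rightarrow> 'a) set \<Rightarrow> 'r) \<Rightarrow> nat \<Rightarrow>
     (((nat \<Rightarrow> real) \<Rightarrow> 'a) \<Rightarrow> 'r) set monoid" where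
  "twisted_homology U x0 R \<rho> p =
    (twisted_chains U R p)\<lparr>carrier := twisted_cycles U x0 R \<rho> p\<rparr> Mod twisted_boundaries U x0 R \<rho> p"

definition twisted_scale ::
    "'a::real_normed_vector set \<Rightarrow> 'a \<Rightarrow> ('r, 'm) ring_scheme \<Rightarrow> ((real \<Rightarrow> 'a) set \<Rightarrow> 'r) \<Rightarrow> nat \<Rightarrow>
     (((nat \<Rightarrow> real) \<Rightarrow> 'a) \<Rightarrow> 'r) set \<Rightarrow> 'r \<Rightarrow> (((nat \<Rightarrow> real) \<Rightarrow> 'a) \<Rightarrow> 'r) set" where
  "twisted_scale U x0 R \<rho> p X a =
    (\<Union>c\<in>X. twisted_boundaries U x0 R \<rho> p #>\<^bsub>twisted_chains U R p\<^esub> (\<lambda>\<sigma>. c \<sigma> \<otimes>\<^bsub>R\<^esub> a))"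

text \<open>
  The rank of a right module over \<open>K\<close>, given by an abelian group \<open>A\<close> in multiplicative notation
  and the right scalar action \<open>act x a = x a\<close>.
\<close>

definition right_independent ::
    "('k, 'm) ring_scheme \<Rightarrow> ('v, 'n) monoid_scheme \<Rightarrow> ('v \<Rightarrow> 'k \<Rightarrow> 'v) \<Rightarrow> 'v set \<Rightarrow> bool" where
  "right_independent K A act X \<longleftrightarrow>
    (\<forall>a \<in> X \<rightarrow> carrier K.
       finprod A (\<lambda>x. act x (a x)) X = \<one>\<^bsub>A\<^esub> \<longrightarrow> (\<forall>x\<in>X. a x = \<zero>\<^bsub>K\<^esub>))"

definition right_rank ::
    "('k, 'm) ring_scheme \<Rightarrow> ('v, 'n) monoid_scheme \<Rightarrow> ('v \<Rightarrow> 'k \<Rightarrow> 'v) \<Rightarrow> enat" where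
  "right_rank K A act =
    (SUP X \<in> {X. finite X \<and> X \<subseteq> carrier A \<and> right_independent K A act X}. enat (card X))"


section \<open>Higher-order degrees\<close>

text \<open>\<open>\<int>\<Gamma>\<^sub>k\<close>-bar is realized inside \<open>\<int>\<Gamma>\<^sub>k\<close>, and \<open>\<K>\<^sub>k\<close> inside \<open>R\<^sub>k\<close>.\<close>

definition group_ring_bar ::
    "('a, 'b) monoid_scheme \<Rightarrow> ('a \<Rightarrow> int) \<Rightarrow> nat \<Rightarrow> ('a set \<Rightarrow> int) set" where
  "group_ring_bar G \<psi> k =
    {a \<in> carrier (group_ring (Gamma G k)). {g. a g \<noteq> 0} \<subseteq> Gamma_bar G \<psi> k}"

definition S_set :: "('a, 'b) monoid_scheme \<Rightarrow> ('a \<Rightarrow> int) \<Rightarrow> nat \<Rightarrow> ('a set \<Rightarrow> int) set" where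
  "S_set G \<psi> k = group_ring_bar G \<psi> k - {\<zero>\<^bsub>group_ring (Gamma G k)\<^esub>}"

definition R_ring ::
    "('a, 'b) monoid_scheme \<Rightarrow> ('a \<Rightarrow> int) \<Rightarrow> nat \<Rightarrow> (('a set \<Rightarrow> int) \<times> ('a set \<Rightarrow> int)) set ring" where
  "R_ring G \<psi> k = right_fractions (group_ring (Gamma G k)) (S_set G \<psi> k)"

definition K_field ::
    "('a, 'b) monoid_scheme \<Rightarrow> ('a \<Rightarrow> int) \<Rightarrow> nat \<Rightarrow> (('a set \<Rightarrow> int) \<times> ('a set \<Rightarrow> int)) set ring" where
  "K_field G \<psi> k = (R_ring G \<psi> k)
    \<lparr>carrier := {right_fraction (group_ring (Gamma G k)) (S_set G \<psi> k) r s | r s.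
       r \<in> group_ring_bar G \<psi> k \<and> s \<in> S_set G \<psi> k}\<rparr>"

definition coefficient_map ::
    "('a, 'b) monoid_scheme \<Rightarrow> ('a \<Rightarrow> int) \<Rightarrow> nat \<Rightarrow> 'a \<Rightarrow>
     (('a set \<Rightarrow> int) \<times> ('a set \<Rightarrow> int)) set" where
  "coefficient_map G \<psi> k g =
    right_fraction (group_ring (Gamma G k)) (S_set G \<psi> k)
      (\<lambda>X. of_bool (X = rational_derived G (Suc k) #>\<^bsub>G\<^esub> g)) \<one>\<^bsub>group_ring (Gamma G k)\<^esub>"

definition higher_order_degree :: "complex poly poly \<Rightarrow> complex \<times> complex \<Rightarrow> nat \<Rightarrow> enat" where
  "higher_order_degree f x0 k =
    (let U = curve_complement f;
         G = fundamental_group U x0;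
         \<psi> = total_linking f;
         R = R_ring G \<psi> k;
         \<rho> = coefficient_map G \<psi> k
     in right_rank (K_field G \<psi> k) (twisted_homology U x0 R \<rho> 1) (twisted_scale U x0 R \<rho> 1))"

end

theory Submission
  imports Defs
begin

text \<open>
  Let \<open>G\<close> be the fundamental group of the complement \<open>U\<close> of the curve. The reason for the vanishing of
  all degrees is that the commutator subgroup \<open>G'\<close> of these Artin groups is perfect
  (\<open>derived_perfect\<close>). As \<open>G / G'\<close> is \<open>\<int>\<close> or, in type B, \<open>\<int>\<^sup>2\<close>, and so torsion-free, all
  terms of the rational derived series beyond the first are equal to \<open>G'\<close> (\<open>rational_derived_Suc\<close>).
  Thus \<open>\<Gamma>\<^sub>k = G / G'\<close> for every \<open>k\<close>, and the homology in question is a localization of the first homology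
  group \<open>G' / G'' = 0\<close> of the maximal abelian cover of \<open>U\<close>.

  That \<open>G'\<close> is perfect is shown in the metabelian quotient \<open>G / G''\<close>. If a generator \<open>s\<^sub>k\<close> commutes
  with two adjacent generators \<open>s\<^sub>i\<close> and \<open>s\<^sub>j\<close>, all three being conjugate, then \<open>s\<^sub>i s\<^sub>k\<^sup>-\<^sup>1\<close> and
  \<open>s\<^sub>j s\<^sub>k\<^sup>-\<^sup>1\<close> lie in the abelian commutator subgroup, so they commute; hence \<open>s\<^sub>i\<close> and \<open>s\<^sub>j\<close>
  commute, and the braid relation makes them equal (\<open>commute_if_common_centralizer\<close>). The diagrams are large
  enough for this to make the quotient abelian, except \<open>H\<^sub>3\<close>, which needs a computation
  (\<open>H3_collapse\<close>).

  Covering spaces and the Hurewicz theorem are replaced by a direct argument. Modulo boundaries, a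
  path with a coefficient defines a class \<open>E p r\<close> that is invariant under homotopy and satisfies the
  product rule of a crossed homomorphism (\<open>E_homotopic\<close>, \<open>E_join\<close>). On loops in \<open>G'\<close> it is a homomorphism
  from a perfect group to an abelian one and vanishes (\<open>EG_N\<close>), so it comes from a crossed
  homomorphism on the abelian group \<open>\<Gamma>\<^sub>k\<close>. For such a map the class of \<open>(1 - t)\<close> times a cycle is zero
  for every \<open>t\<close> in \<open>\<Gamma>\<^sub>k\<close> (\<open>cycle_killed_by_difference\<close>), and the class of the cycle itself is zero if \<open>\<Gamma>\<^sub>k\<close> is
  infinite cyclic (\<open>cycle_is_boundary\<close>). One of the two cases always applies: either the kernel of the linking
  number on \<open>\<Gamma>\<^sub>k\<close> contains some \<open>t \<noteq> 1\<close>, and \<open>1 - t\<close> is a nonzero element of \<open>\<K>\<^sub>k\<close>, or \<open>\<Gamma>\<^sub>k\<close> embeds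
  in \<open>\<int>\<close>.

  Since \<open>\<Gamma>\<^sub>k\<close> is abelian, the coefficient ring is commutative. It is an integral domain because \<open>\<Gamma>\<^sub>k\<close>
  embeds in a linearly ordered group, and its elements are identified with elements of a field
  of fractions (\<open>domain_R\<close>).
\<close>

section \<open>Metabelian quotients of Artin groups\<close>

fun alt_prod :: "('a, 'b) monoid_scheme \<Rightarrow> 'a \<Rightarrow> 'a \<Rightarrow> nat \<Rightarrow> 'a" where
  "alt_prod G x y 0 = \<one>\<^bsub>G\<^esub>"
| "alt_prod G x y (Suc m) = x \<otimes>\<^bsub>G\<^esub> alt_prod G y x m"

lemma (in group) commuting_braid3_eq:
  assumes [simp]: "a \<in> carrier G" "b \<in> carrier G"
    and ab: "a \<otimes> b = b \<otimes> a" and br: "alt_prod G a b 3 = alt_prod G b a 3"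
  shows "a = b"
proof -
  have "a \<otimes> (b \<otimes> a) = b \<otimes> (a \<otimes> b)" using br by (simp add: eval_nat_numeral)
  also have "\<dots> = a \<otimes> (b \<otimes> b)" by (metis ab m_assoc assms(1,2))
  finally show ?thesis by simp
qed

lemma (in group) commuting_braid5_eq:
  assumes [simp]: "a \<in> carrier G" "b \<in> carrier G"
    and ab: "a \<otimes> b = b \<otimes> a" and br: "alt_prod G a b 5 = alt_prod G b a 5"
  shows "a = b"
proof -
  have "a \<otimes> (b \<otimes> (a \<otimes> (b \<otimes> a))) = b \<otimes> (a \<otimes> (b \<otimes> (a \<otimes> b)))"
    using br by (simp add: eval_nat_numeral)
  also have "\<dots> = (b \<otimes> a) \<otimes> ((b \<otimes> a) \<otimes> b)" by (simp add: m_assoc)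
  also have "\<dots> = a \<otimes> (b \<otimes> (a \<otimes> (b \<otimes> b)))" by (simp add: m_assoc flip: ab)
  finally show ?thesis by simp
qed

text \<open>
  The example that matters is the quotient of a group by its second derived subgroup. The
  commutator subgroup of a group is perfect as soon as this quotient is abelian, so the aim of
  this section is that a metabelian quotient of one of the Artin groups is abelian.
\<close>

locale metabelian = group G for G (structure) +
  assumes derived_commute:
    "\<lbrakk>x \<in> derived G (carrier G); y \<in> derived G (carrier G)\<rbrakk> \<Longrightarrow> x \<otimes> y = y \<otimes> x"
begin

abbreviation "D \<equiv> derived G (carrier G)"

lemma D_subgroup: "subgroup D G"
  by (simp add: derived_is_subgroup)

lemma conj_diff_D:
  assumes [simp]: "x \<in> carrier G" "y \<in> carrier G" "g \<in> carrier G" and "x \<otimes> g = g \<otimes> y"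
  shows "x \<otimes> inv y \<in> D"
proof -
  have "x = g \<otimes> y \<otimes> inv g" using assms by (metis inv_solve_right m_closed)
  then have "x \<otimes> inv y = g \<otimes> y \<otimes> inv g \<otimes> inv y" by simp
  then have "x \<otimes> inv y \<in> derived_set G (carrier G)" by (intro UN_I[of g] UN_I[of y]) simp_all
  then show ?thesis unfolding derived_def by (rule generate.incl)
qed

lemma D_trans:
  assumes [simp]: "x \<in> carrier G" "y \<in> carrier G" "z \<in> carrier G" and "x \<otimes> inv y \<in> D" "y \<otimes> inv z \<in> D"
  shows "x \<otimes> inv z \<in> D"
proof -
  have "x \<otimes> inv z = (x \<otimes> inv y) \<otimes> (y \<otimes> inv z)"
    by (simp add: m_assoc) (simp add: m_assoc[symmetric])
  then show ?thesis using assms D_subgroup by (simp add: subgroup.m_closed)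
qed

lemma D_sym:
  assumes [simp]: "x \<in> carrier G" "y \<in> carrier G" and "x \<otimes> inv y \<in> D"
  shows "y \<otimes> inv x \<in> D"
  using subgroup.m_inv_closed[OF D_subgroup assms(3)] by (simp add: inv_mult_group)

lemma braid3_D:
  assumes [simp]: "a \<in> carrier G" "b \<in> carrier G" and br: "alt_prod G a b 3 = alt_prod G b a 3"
  shows "a \<otimes> inv b \<in> D"
  by (rule conj_diff_D[of _ _ "b \<otimes> a"]) (use br in \<open>simp_all add: eval_nat_numeral m_assoc\<close>)

lemma braid5_D:
  assumes [simp]: "a \<in> carrier G" "b \<in> carrier G" and br: "alt_prod G a b 5 = alt_prod G b a 5"
  shows "a \<otimes> inv b \<in> D"
  by (rule conj_diff_D[of _ _ "b \<otimes> (a \<otimes> (b \<otimes> a))"]) (use br in \<open>simp_all add: eval_nat_numeral m_assoc\<close>)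

text \<open>
  The engine of the whole section. As \<open>c\<close> commutes with \<open>a\<close> and \<open>b\<close>, the product of \<open>a c\<^sup>-\<^sup>1\<close> and
  \<open>b c\<^sup>-\<^sup>1\<close> is \<open>a b c\<^sup>-\<^sup>2\<close> in one order and \<open>b a c\<^sup>-\<^sup>2\<close> in the other. Generators joined by relations
  of odd length are conjugate, so their quotients lie in the commutator subgroup, and a third
  generator that commutes with two adjacent ones forces these to commute, hence to be equal.
\<close>

lemma commute_if_common_centralizer:
  assumes [simp]: "a \<in> carrier G" "b \<in> carrier G" "c \<in> carrier G"
    and ac: "a \<otimes> c = c \<otimes> a" and bc: "b \<otimes> c = c \<otimes> b"
    and D: "a \<otimes> inv c \<in> D" "b \<otimes> inv c \<in> D"
  shows "a \<otimes> b = b \<otimes> a"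
proof -
  have ac': "inv c \<otimes> a = a \<otimes> inv c" and bc': "inv c \<otimes> b = b \<otimes> inv c"
    using ac bc by (metis assms(1-3) inv_closed inv_solve_left inv_solve_right m_assoc m_closed)+
  have "(a \<otimes> b) \<otimes> (inv c \<otimes> inv c) = (a \<otimes> inv c) \<otimes> (b \<otimes> inv c)"
    by (simp add: m_assoc) (simp add: m_assoc[symmetric] bc')
  also have "\<dots> = (b \<otimes> inv c) \<otimes> (a \<otimes> inv c)" using D by (rule derived_commute)
  also have "\<dots> = (b \<otimes> a) \<otimes> (inv c \<otimes> inv c)"
    by (simp add: m_assoc) (simp add: m_assoc[symmetric] ac')
  finally show ?thesis by simp
qed

text \<open>
  On a chain of at least four vertices, vertex \<open>1\<close> commutes with both ends of every edge from
  \<open>3\<close> on, and vertex \<open>4\<close> with both ends of the first edge. No vertex is left for the second edge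
  if \<open>m = 4\<close>, but once \<open>s 1 = s 2\<close> is known, \<open>s 2\<close> commutes with \<open>s 3\<close> like \<open>s 1\<close>. The label of the
  first edge is left open so that the chain of type H is covered.
\<close>

lemma chain_collapse:
  assumes s: "\<And>i. i \<in> {1..m} \<Longrightarrow> s i \<in> carrier G" and m: "4 \<le> m"
    and comm: "\<And>i j. i \<in> {1..m} \<Longrightarrow> j \<in> {1..m} \<Longrightarrow> i + 2 \<le> j \<Longrightarrow> s i \<otimes> s j = s j \<otimes> s i"
    and braid: "\<And>i. i \<in> {2..<m} \<Longrightarrow> alt_prod G (s i) (s (Suc i)) 3 = alt_prod G (s (Suc i)) (s i) 3"
    and D12: "s 1 \<otimes> inv s 2 \<in> D" and eq12: "s 1 \<otimes> s 2 = s 2 \<otimes> s 1 \<Longrightarrow> s 1 = s 2"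
  shows "i \<in> {1..m} \<Longrightarrow> s i = s 1" and "i \<in> {1..m} \<Longrightarrow> s i \<otimes> inv s 1 \<in> D"
proof -
  have D: "s i \<otimes> inv s 1 \<in> D" if "i \<in> {1..m}" for i
    using that
  proof (induction i)
    case (Suc i)
    consider "i = 0" | "i = 1" | "2 \<le> i" by linarith
    then show ?case
    proof cases
      case 1 then show ?thesis using s Suc.prems subgroup.one_closed[OF D_subgroup] by simp
    next
      case 2 then show ?thesis using D_sym[OF s s D12] m by (simp add: numeral_2_eq_2)
    next
      case 3
      then have "s (Suc i) \<otimes> inv s i \<in> D" using Suc.prems by (intro braid3_D s) (auto simp: braid)
      moreover have "s i \<otimes> inv s 1 \<in> D" using 3 Suc by simp
      ultimately show ?thesis using D_trans[of "s (Suc i)" "s i" "s 1"] s Suc.prems 3 by simp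
    qed
  qed simp
  have s12: "s 1 = s 2"
  proof (rule eq12, rule commute_if_common_centralizer[of _ _ "s 4"])
    have "s 4 \<otimes> inv s 1 \<in> D" "s 2 \<otimes> inv s 1 \<in> D" using D m by auto
    then show "s 1 \<otimes> inv s 4 \<in> D" "s 2 \<otimes> inv s 4 \<in> D"
      using D_sym[of "s 4" "s 1"] D_trans[of "s 2" "s 1" "s 4"] s m by auto
  qed (use s comm[of 1 4] comm[of 2 4] m in auto)
  have up: "s (Suc i) = s i" if i: "i \<in> {3..<m}" for i
  proof (rule commuting_braid3_eq[symmetric])
    show "s i \<otimes> s (Suc i) = s (Suc i) \<otimes> s i"
    proof (rule commute_if_common_centralizer[of _ _ "s 1"])
      show "s i \<otimes> s 1 = s 1 \<otimes> s i" "s (Suc i) \<otimes> s 1 = s 1 \<otimes> s (Suc i)"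
        using i comm[of 1] by auto
    qed (use i s D in auto)
  qed (use i s braid in auto)
  have s23: "s 2 = s 3"
  proof (rule commuting_braid3_eq)
    show "s 2 \<otimes> s 3 = s 3 \<otimes> s 2" using comm[of 1 3] s12 m by auto
  qed (use s m braid[of 2] in \<open>auto simp: eval_nat_numeral\<close>)
  have "s i = s 1" if "i \<in> {1..m}" for i
    using that
  proof (induction i)
    case (Suc i)
    consider "i = 0" | "i = 1" | "i = 2" | "3 \<le> i" by linarith
    then show ?case
    proof cases
      case 4 then show ?thesis using Suc up by simp
    qed (use s12 s23 in \<open>auto simp: eval_nat_numeral\<close>)
  qed simp
  then show "i \<in> {1..m} \<Longrightarrow> s i = s 1" .
  show "i \<in> {1..m} \<Longrightarrow> s i \<otimes> inv s 1 \<in> D" by (rule D)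
qed

text \<open>
  The diagram \<open>H\<^sub>3\<close> is too short for a commuting third vertex. Write the abelian commutator
  subgroup additively, as a module over \<open>\<int>[t]\<close> where \<open>t\<close> acts as conjugation by \<open>c\<close>. With
  \<open>x = a c\<^sup>-\<^sup>1\<close> and \<open>y = b c\<^sup>-\<^sup>1\<close> the relations become \<open>t x = x\<close>, \<open>(1 - t + t\<^sup>2) y = 0\<close> and
  \<open>(1 - t + t\<^sup>2 - t\<^sup>3 + t\<^sup>4) (x - y) = 0\<close>, and these imply \<open>x = y = 0\<close>.
\<close>

lemma H3_collapse:
  assumes abc[simp]: "a \<in> carrier G" "b \<in> carrier G" "c \<in> carrier G"
    and ab: "alt_prod G a b 5 = alt_prod G b a 5" and bc: "alt_prod G b c 3 = alt_prod G c b 3"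
    and ac: "a \<otimes> c = c \<otimes> a"
  shows "b = c" "a = c"
proof -
  define x where "x = a \<otimes> inv c"
  define y where "y = b \<otimes> inv c"
  have yD: "y \<in> D" unfolding y_def by (rule braid3_D) (simp_all add: bc)
  have xD: "x \<in> D"
    unfolding x_def by (rule D_trans[of _ b]) (use braid5_D[OF _ _ ab] yD in \<open>simp_all add: y_def\<close>)
  have [simp]: "x \<in> carrier G" "y \<in> carrier G" by (simp_all add: x_def y_def)
  define t where "t = (\<lambda>g. c \<otimes> g \<otimes> inv c)"
  have tD: "t g \<in> D" if "g \<in> D" for g
    unfolding t_def using normal.inv_op_closed2[OF derived_self_is_normal _ that] by simp
  have tc[simp]: "t g \<in> carrier G" if "g \<in> carrier G" for g using that by (simp add: t_def)
  have t_mult: "t (g \<otimes> h) = t g \<otimes> t h" if "g \<in> carrier G" "h \<in> carrier G" for g h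
    using that by (simp add: t_def m_assoc) (simp add: m_assoc[symmetric])
  have ct: "c \<otimes> g = t g \<otimes> c" if "g \<in> carrier G" for g using that by (simp add: t_def m_assoc)
  have tx: "t x = x" unfolding t_def x_def using ac by (metis abc inv_closed m_assoc m_closed inv_solve_right)
  have ax: "a = x \<otimes> c" and bY: "b = y \<otimes> c" by (simp_all add: x_def y_def m_assoc)
  define y1 where "y1 = t y"
  define y2 where "y2 = t y1"
  define y3 where "y3 = t y2"
  define y4 where "y4 = t y3"
  have yi: "y1 \<in> D" "y2 \<in> D" "y3 \<in> D" "y4 \<in> D" by (simp_all add: y1_def y2_def y3_def y4_def tD yD)
  have [simp]: "y1 \<in> carrier G" "y2 \<in> carrier G" "y3 \<in> carrier G" "y4 \<in> carrier G"
    by (simp_all add: y1_def y2_def y3_def y4_def)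
  \<comment> \<open>Moving every \<open>c\<close> to the right turns a word in \<open>a, b, c\<close> into an element of \<open>D\<close> times a power of \<open>c\<close>.\<close>
  have push: "c \<otimes> (x \<otimes> g) = x \<otimes> (c \<otimes> g)" "c \<otimes> (y \<otimes> g) = y1 \<otimes> (c \<otimes> g)"
      "c \<otimes> (y1 \<otimes> g) = y2 \<otimes> (c \<otimes> g)" "c \<otimes> (y2 \<otimes> g) = y3 \<otimes> (c \<otimes> g)" "c \<otimes> (y3 \<otimes> g) = y4 \<otimes> (c \<otimes> g)"
    if "g \<in> carrier G" for g
    using that ct[of x] ct[of y] ct[of y1] ct[of y2] ct[of y3] tx
    by (simp_all add: y1_def y2_def y3_def y4_def m_assoc flip: m_assoc)
  have r3: "y \<otimes> y2 = y1"
  proof -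
    have "b \<otimes> (c \<otimes> b) = c \<otimes> (b \<otimes> c)" using bc by (simp add: eval_nat_numeral)
    then have "(y \<otimes> y2) \<otimes> (c \<otimes> (c \<otimes> c)) = y1 \<otimes> (c \<otimes> (c \<otimes> c))"
      by (simp add: bY m_assoc push)
    then show ?thesis by simp
  qed
  have r5: "x \<otimes> (y1 \<otimes> (x \<otimes> (y3 \<otimes> x))) = y \<otimes> (x \<otimes> (y2 \<otimes> (x \<otimes> y4)))"
  proof -
    have "a \<otimes> (b \<otimes> (a \<otimes> (b \<otimes> a))) = b \<otimes> (a \<otimes> (b \<otimes> (a \<otimes> b)))"
      using ab by (simp add: eval_nat_numeral)
    then have "(x \<otimes> (y1 \<otimes> (x \<otimes> (y3 \<otimes> x)))) \<otimes> (c \<otimes> (c \<otimes> (c \<otimes> (c \<otimes> c)))) =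
      (y \<otimes> (x \<otimes> (y2 \<otimes> (x \<otimes> y4)))) \<otimes> (c \<otimes> (c \<otimes> (c \<otimes> (c \<otimes> c))))"
      by (simp add: ax bY m_assoc push)
    then show ?thesis by simp
  qed
  have cm: "g \<otimes> h = h \<otimes> g" "g \<otimes> (h \<otimes> k) = h \<otimes> (g \<otimes> k)"
    if "g \<in> D" "h \<in> D" "k \<in> carrier G" for g h k
    using derived_commute[of g h] that subgroup.mem_carrier[OF D_subgroup]
    by (simp_all flip: m_assoc)
  have y4: "y2 \<otimes> y4 = y3"
    using arg_cong[OF arg_cong[OF r3, of t], of t]
    by (simp add: t_mult y1_def y2_def y3_def y4_def)
  have "x \<otimes> (x \<otimes> (y1 \<otimes> (x \<otimes> y3))) = x \<otimes> (y1 \<otimes> (x \<otimes> (y3 \<otimes> x)))"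
    using xD yi by (simp add: cm(1)[of y3 x \<one>] cm(2)[of y1 x])
  also have "\<dots> = x \<otimes> (x \<otimes> (y \<otimes> (y2 \<otimes> y4)))"
    unfolding r5 using xD yD yi by (simp add: cm(2)[of y x] cm(2)[of y2 x])
  also have "\<dots> = x \<otimes> (x \<otimes> (y1 \<otimes> y4))"
    by (simp flip: r3 add: m_assoc)
  finally have "x \<otimes> y3 = y4" by simp
  then have "x \<otimes> (y2 \<otimes> y3) = y3"
    using y4 xD yi cm(2)[of y2 x y3] by simp
  then have xy2: "x \<otimes> y2 = \<one>"
    by (simp flip: m_assoc)
  have t1: "t \<one> = \<one>" by (simp add: t_def)
  have "x \<otimes> y3 = t (x \<otimes> y2)" by (simp add: t_mult tx y3_def)
  then have "x \<otimes> y3 = \<one>" by (simp add: xy2 t1)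
  with \<open>x \<otimes> y3 = y4\<close> have "y4 = \<one>" by simp
  moreover have "g = \<one>" if "t g = \<one>" "g \<in> carrier G" for g
    using ct[OF that(2)] that by simp
  ultimately have "y = \<one>" "y2 = \<one>"
    unfolding y4_def y3_def y2_def y1_def by auto
  with xy2 have "x = \<one>" by simp
  with \<open>y = \<one>\<close> show "b = c" "a = c"
    using ax bY by simp_all
qed

end

lemma (in group) comm_group_if_generators_commute:
  assumes X: "X \<subseteq> carrier G" and gen: "generate G X = carrier G"
    and comm: "\<And>x y. x \<in> X \<Longrightarrow> y \<in> X \<Longrightarrow> x \<otimes> y = y \<otimes> x"
  shows "comm_group G"
proof (rule group_comm_groupI)
  have inv_comm: "inv a \<otimes> b = b \<otimes> inv a" if "a \<otimes> b = b \<otimes> a" "a \<in> carrier G" "b \<in> carrier G" for a b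
    using that by (metis inv_closed inv_solve_left inv_solve_right m_assoc m_closed)
  have gx: "g \<otimes> x = x \<otimes> g" if "g \<in> generate G X" "\<And>y. y \<in> X \<Longrightarrow> y \<otimes> x = x \<otimes> y" "x \<in> carrier G" for g x
    using that(1)
  proof (induction rule: generate.induct)
    case (inv h) then show ?case using inv_comm that X by auto
  next
    case (eng h1 h2)
    then have [simp]: "h1 \<in> carrier G" "h2 \<in> carrier G" using gen by auto
    show ?case using eng that(3) by (metis m_assoc \<open>h1 \<in> carrier G\<close> \<open>h2 \<in> carrier G\<close>)
  qed (use that in auto)
  fix x y assume "x \<in> carrier G" "y \<in> carrier G"
  moreover have "z \<otimes> y = y \<otimes> z" if "z \<in> X" for z
    using gx[of y z] \<open>y \<in> carrier G\<close> gen X comm that by auto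
  ultimately show "x \<otimes> y = y \<otimes> x"
    using gx[of x y] gen by auto
qed

text \<open>
  Generators that satisfy the relations of the Artin group, so that the locale passes to
  quotient groups.
\<close>

locale artin_generated = group G for G (structure) +
  fixes N :: nat and M :: "nat \<Rightarrow> nat \<Rightarrow> nat" and s
  assumes s_closed: "i \<in> {1..N} \<Longrightarrow> s i \<in> carrier G"
    and s_generate: "generate G (s ` {1..N}) = carrier G"
    and s_braid: "\<lbrakk>i \<in> {1..N}; j \<in> {1..N}; i \<noteq> j\<rbrakk> \<Longrightarrow>
      alt_prod G (s i) (s j) (M i j) = alt_prod G (s j) (s i) (M i j)"

definition perfect_types :: "coxeter_type set" where
  "perfect_types =
    TypeA ` {4..} \<union> TypeB ` {5..} \<union> TypeD ` {5..} \<union> TypeE ` {6, 7, 8} \<union> TypeH ` {3, 4}"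

text \<open>The generators of index at most \<open>main_rank T\<close> are conjugate to each other.\<close>
fun main_rank :: "coxeter_type \<Rightarrow> nat" where
  "main_rank (TypeB n) = n - 1"
| "main_rank T = coxeter_rank T"

locale metabelian_artin = metabelian G + artin_generated G "coxeter_rank T" "coxeter_matrix T" s
  for G (structure) and T s
begin

lemma braid: "\<lbrakk>i \<in> {1..coxeter_rank T}; j \<in> {1..coxeter_rank T}; i < j; coxeter_edge T i j = m\<rbrakk>
    \<Longrightarrow> alt_prod G (s i) (s j) m = alt_prod G (s j) (s i) m"
  using s_braid[of i j] by (simp add: coxeter_matrix_def)

lemma commute: "\<lbrakk>i \<in> {1..coxeter_rank T}; j \<in> {1..coxeter_rank T}; i < j; coxeter_edge T i j = 2\<rbrakk>
    \<Longrightarrow> s i \<otimes> s j = s j \<otimes> s i"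
  using braid[of i j] s_closed[of i] s_closed[of j] by (simp add: eval_nat_numeral)

lemma chain_generators_equal:
  assumes "4 \<le> m" "m \<le> coxeter_rank T"
    and "\<And>i j. i \<in> {1..m} \<Longrightarrow> j \<in> {1..m} \<Longrightarrow> i + 2 \<le> j \<Longrightarrow> coxeter_edge T i j = 2"
    and "\<And>i. i \<in> {2..<m} \<Longrightarrow> coxeter_edge T i (Suc i) = 3"
    and e12: "coxeter_edge T 1 2 = 3 \<or> coxeter_edge T 1 2 = 5"
  shows "i \<in> {1..m} \<Longrightarrow> s i = s 1" and "i \<in> {1..m} \<Longrightarrow> s i \<otimes> inv s 1 \<in> D"
proof -
  have c: "s i \<in> carrier G" if "i \<in> {1..m}" for i using that s_closed assms by auto
  have 1: "s i \<otimes> s j = s j \<otimes> s i" if "i \<in> {1..m}" "j \<in> {1..m}" "i + 2 \<le> j" for i j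
    using that assms by (intro commute) auto
  have 2: "alt_prod G (s i) (s (Suc i)) 3 = alt_prod G (s (Suc i)) (s i) 3" if "i \<in> {2..<m}" for i
    using that assms by (intro braid) auto
  have b: "alt_prod G (s 1) (s 2) 3 = alt_prod G (s 2) (s 1) 3 \<or>
      alt_prod G (s 1) (s 2) 5 = alt_prod G (s 2) (s 1) 5"
    using braid[of 1 2] e12 assms(1,2) by force
  have 3: "s 1 \<otimes> inv s 2 \<in> D"
    using b braid3_D[of "s 1" "s 2"] braid5_D[of "s 1" "s 2"] c[of 1] c[of 2] assms(1) by auto
  have 4: "s 1 = s 2" if "s 1 \<otimes> s 2 = s 2 \<otimes> s 1"
    using b that commuting_braid3_eq[of "s 1" "s 2"] commuting_braid5_eq[of "s 1" "s 2"]
      c[of 1] c[of 2] assms(1) by auto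
  show "i \<in> {1..m} \<Longrightarrow> s i = s 1" "i \<in> {1..m} \<Longrightarrow> s i \<otimes> inv s 1 \<in> D"
    using chain_collapse[OF c assms(1) 1 2 3 4] by blast+
qed

text \<open>
  In types D and E the vertex \<open>n\<close> outside of the chain and its neighbour \<open>i\<close> both commute with
  vertex \<open>1\<close>.
\<close>

lemma branch_vertex_equal:
  assumes m: "i \<in> {3..<n}" "n \<le> coxeter_rank T"
    and e: "coxeter_edge T i n = 3" "coxeter_edge T 1 n = 2" "coxeter_edge T 1 i = 2"
    and D: "s i \<otimes> inv s 1 \<in> D"
  shows "s n = s i"
proof (rule commuting_braid3_eq[symmetric])
  show "s i \<otimes> s n = s n \<otimes> s i"
  proof (rule commute_if_common_centralizer[of _ _ "s 1"])
    show "s n \<otimes> inv s 1 \<in> D"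
      by (rule D_trans[of _ "s i"], use s_closed m D in auto)
        (rule D_sym, use s_closed m e in \<open>auto intro!: braid3_D braid\<close>)
  qed (use m e D s_closed commute[of 1] in auto)
qed (use m e s_closed braid[of i n 3] in auto)

lemma main_generators_equal:
  assumes T: "T \<in> perfect_types" and i: "i \<in> {1..main_rank T}"
  shows "s i = s 1"
proof -
  \<comment> \<open>In types A, B and \<open>H\<^sub>4\<close> the generators in question form a chain; in types D and E one vertex is
    attached to a chain.\<close>
  consider (chain) "4 \<le> main_rank T"
        "\<And>i j. i \<in> {1..main_rank T} \<Longrightarrow> j \<in> {1..main_rank T} \<Longrightarrow> i + 2 \<le> j \<Longrightarrow> coxeter_edge T i j = 2"
        "\<And>i. i \<in> {2..<main_rank T} \<Longrightarrow> coxeter_edge T i (Suc i) = 3"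
        "coxeter_edge T 1 2 = 3 \<or> coxeter_edge T 1 2 = 5"
    | (branch) l where "5 \<le> coxeter_rank T" "main_rank T = coxeter_rank T" "l \<in> {3..<coxeter_rank T}"
        "\<And>i j. i \<in> {1..<coxeter_rank T} \<Longrightarrow> j \<in> {1..<coxeter_rank T} \<Longrightarrow> i + 2 \<le> j \<Longrightarrow> coxeter_edge T i j = 2"
        "\<And>i. i \<in> {1..<coxeter_rank T - 1} \<Longrightarrow> coxeter_edge T i (Suc i) = 3"
        "coxeter_edge T l (coxeter_rank T) = 3" "coxeter_edge T 1 (coxeter_rank T) = 2"
    | (H3) "T = TypeH 3"
  proof -
    have "thesis" if "T = TypeA n" "4 \<le> n" for n using that chain by force
    moreover have "thesis" if "T = TypeB n" "5 \<le> n" for n using that chain by force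
    moreover have "thesis" if "T = TypeD n" "5 \<le> n" for n
      using that by (intro branch[of "n - 2"]) auto
    moreover have "thesis" if "T = TypeE n" "n \<in> {6,7,8}" for n
      using that by (intro branch[of 3]) auto
    moreover have "thesis" if "T = TypeH 4" using that chain by force
    ultimately show thesis using T H3 unfolding perfect_types_def by blast
  qed
  then show ?thesis
  proof cases
    case chain
    then show ?thesis using chain_generators_equal(1)[of "main_rank T" i] i by (cases T) auto
  next
    case branch
    let ?n = "coxeter_rank T"
    have *: "s i = s 1" "s i \<otimes> inv s 1 \<in> D" if "i \<in> {1..?n - 1}" for i
      using chain_generators_equal[of "?n - 1" i] branch that by (auto simp: numeral_2_eq_2)
    have "coxeter_edge T 1 l = 2" using branch(4)[of 1 l] branch(1,3) by auto
    then have sn: "s ?n = s l"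
      using branch *(2)[of l] by (intro branch_vertex_equal) auto
    show ?thesis
    proof (cases "i = ?n")
      case True
      then show ?thesis using sn *(1)[of l] branch(3) by auto
    next
      case False
      then show ?thesis using *(1)[of i] i branch(2) by auto
    qed
  next
    case H3
    have c: "s 1 \<in> carrier G" "s 2 \<in> carrier G" "s 3 \<in> carrier G"
      using H3 by (auto intro!: s_closed)
    have "alt_prod G (s 1) (s 2) 5 = alt_prod G (s 2) (s 1) 5"
      "alt_prod G (s 2) (s 3) 3 = alt_prod G (s 3) (s 2) 3" "s 1 \<otimes> s 3 = s 3 \<otimes> s 1"
      using H3 by (auto intro!: braid commute)
    from H3_collapse[OF c this] have "s 2 = s 3 \<and> s 1 = s 3" by blast
    moreover have "i = 1 \<or> i = 2 \<or> i = 3" using i H3 by auto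
    ultimately show ?thesis by metis
  qed
qed

text \<open>
  In type B the last generator, which is joined to the chain by an edge with an even label,
  commutes with \<open>s 1\<close> and therefore with all the others.
\<close>

lemma commutative:
  assumes T: "T \<in> perfect_types"
  shows "comm_group G"
proof (rule comm_group_if_generators_commute[OF _ s_generate])
  let ?n = "coxeter_rank T"
  have "s i \<otimes> s j = s j \<otimes> s i" if "i \<in> {1..?n}" "j \<in> {1..?n}" for i j
  proof (cases "main_rank T = ?n")
    case True
    then show ?thesis using main_generators_equal[OF T] that by metis
  next
    case False
    then have "T = TypeB ?n" by (cases T) auto
    then obtain n where n: "T = TypeB n" "5 \<le> n" using T by (auto simp: perfect_types_def)
    have "s 1 \<otimes> s n = s n \<otimes> s 1" using n by (intro commute) auto
    moreover have "s i = s 1 \<or> i = n" "s j = s 1 \<or> j = n"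
      using that n main_generators_equal[OF T, of i] main_generators_equal[OF T, of j] by force+
    ultimately show ?thesis by auto
  qed
  then show "\<And>x y. x \<in> s ` {1..?n} \<Longrightarrow> y \<in> s ` {1..?n} \<Longrightarrow> x \<otimes> y = y \<otimes> x" by auto
qed (use s_closed in auto)

end

section \<open>Perfect commutator subgroups and the rational derived series\<close>

lemma (in group_hom) hom_alt_prod:
  "x \<in> carrier G \<Longrightarrow> y \<in> carrier G \<Longrightarrow> h (alt_prod G x y m) = alt_prod H (h x) (h y) m"
proof -
  have "alt_prod G x y m \<in> carrier G \<and> h (alt_prod G x y m) = alt_prod H (h x) (h y) m"
    if "x \<in> carrier G" "y \<in> carrier G" for x y
    using that by (induction m arbitrary: x y) auto
  then show "x \<in> carrier G \<Longrightarrow> y \<in> carrier G \<Longrightarrow> h (alt_prod G x y m) = alt_prod H (h x) (h y) m"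
    by blast
qed

lemma (in artin_generated) quotient_artin_generated:
  assumes "K \<lhd> G"
  shows "artin_generated (G Mod K) N M (\<lambda>i. K #> s i)"
proof -
  interpret K: normal K G by fact
  interpret h: group_hom G "G Mod K" "\<lambda>g. K #> g"
    by (simp add: group_hom_def group_hom_axioms_def K.factorgroup_is_group K.r_coset_hom_Mod is_group)
  have im: "(\<lambda>g. K #> g) ` (s ` {1..N}) = (\<lambda>i. K #> s i) ` {1..N}" by auto
  show ?thesis
  proof unfold_locales
    show "generate (G Mod K) ((\<lambda>i. K #> s i) ` {1..N}) = carrier (G Mod K)"
    proof -
      have "s ` {1..N} \<subseteq> carrier G" using s_closed by blast
      from h.generate_img[OF this] show ?thesis
        unfolding im s_generate carrier_FactGroup .
    qed
    show "alt_prod (G Mod K) (K #> s i) (K #> s j) (M i j) = alt_prod (G Mod K) (K #> s j) (K #> s i) (M i j)"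
      if "i \<in> {1..N}" "j \<in> {1..N}" "i \<noteq> j" for i j
      using h.hom_alt_prod[of "s i" "s j"] h.hom_alt_prod[of "s j" "s i"] s_closed s_braid that by metis
  qed (use s_closed in \<open>auto simp: carrier_FactGroup\<close>)
qed

lemma (in group) derived_quotient:
  assumes "K \<lhd> G"
  shows "derived (G Mod K) (carrier (G Mod K)) = (\<lambda>g. K #> g) ` derived G (carrier G)"
proof -
  interpret K: normal K G by fact
  interpret h: group_hom G "G Mod K" "\<lambda>g. K #> g"
    by (simp add: group_hom_def group_hom_axioms_def K.factorgroup_is_group K.r_coset_hom_Mod is_group)
  show ?thesis using h.derived_img[of "carrier G"] by (simp add: carrier_FactGroup)
qed

lemma (in group) commutator_mem_derived:
  "x \<in> S \<Longrightarrow> y \<in> S \<Longrightarrow> x \<otimes> y \<otimes> inv x \<otimes> inv y \<in> derived G S"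
  unfolding derived_def by (intro generate.incl UN_I[of x] UN_I[of y]) simp_all

text \<open>
  The bridge between abelian quotients and subgroups that contain commutators.
\<close>

lemma (in normal) coset_commute_iff:
  assumes [simp]: "x \<in> carrier G" "y \<in> carrier G"
  shows "(H #> x) \<otimes>\<^bsub>G Mod H\<^esub> (H #> y) = (H #> y) \<otimes>\<^bsub>G Mod H\<^esub> (H #> x) \<longleftrightarrow>
    x \<otimes> y \<otimes> inv x \<otimes> inv y \<in> H"
proof -
  have "H #> (x \<otimes> y) = H #> (y \<otimes> x) \<longleftrightarrow> (x \<otimes> y) \<otimes> inv (y \<otimes> x) \<in> H"
    using rcos_module[OF is_group, of "y \<otimes> x" "x \<otimes> y"] rcos_self[of "x \<otimes> y"]
      repr_independence[of "x \<otimes> y" H "y \<otimes> x"] is_subgroup by auto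
  then show ?thesis by (simp add: rcos_sum inv_mult_group m_assoc)
qed

theorem derived_perfect:
  fixes G (structure)
  assumes "artin_generated G (coxeter_rank T) (coxeter_matrix T) s" and T: "T \<in> perfect_types"
  shows "derived G (derived G (carrier G)) = derived G (carrier G)"
proof
  interpret artin_generated G "coxeter_rank T" "coxeter_matrix T" s by fact
  let ?D = "derived G (carrier G)" let ?K = "derived G ?D"
  show "?K \<subseteq> ?D" by (simp add: mono_derived derived_in_carrier)
  have K: "?K \<lhd> G" by (intro derived_is_normal derived_self_is_normal)
  interpret K: normal ?K G by fact
  interpret Q: metabelian_artin "G Mod ?K" T "\<lambda>i. ?K #> s i"
  proof (intro metabelian_artin.intro metabelian.intro metabelian_axioms.intro)
    fix X Y assume "X \<in> derived (G Mod ?K) (carrier (G Mod ?K))"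
      "Y \<in> derived (G Mod ?K) (carrier (G Mod ?K))"
    then obtain x y where "x \<in> ?D" "X = ?K #> x" "y \<in> ?D" "Y = ?K #> y"
      unfolding derived_quotient[OF K] by auto
    moreover from this have "x \<otimes> y \<otimes> inv x \<otimes> inv y \<in> ?K" by (intro commutator_mem_derived)
    ultimately show "X \<otimes>\<^bsub>G Mod ?K\<^esub> Y = Y \<otimes>\<^bsub>G Mod ?K\<^esub> X"
      using derived_in_carrier[OF subset_refl] K.coset_commute_iff[of x y] by blast
  qed (use K K.factorgroup_is_group quotient_artin_generated in auto)
  interpret Q: comm_group "G Mod ?K" using Q.commutative[OF T] .
  have "derived_set G (carrier G) \<subseteq> ?K"
  proof clarsimp
    fix x y assume "x \<in> carrier G" "y \<in> carrier G"
    then show "x \<otimes> y \<otimes> inv x \<otimes> inv y \<in> ?K"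
      using K.coset_commute_iff[of x y] Q.m_comm[of "?K #> x" "?K #> y"] by (auto simp: carrier_FactGroup)
  qed
  then have "generate G (derived_set G (carrier G)) \<subseteq> ?K"
    by (rule generate_subgroup_incl[OF _ K.subgroup_axioms])
  then show "?D \<subseteq> ?K" unfolding derived_def[of G "carrier G", symmetric] .
qed

lemma artin_class_mult:
  assumes "u \<in> words N" "v \<in> words N"
  shows "artin_class N M u \<otimes>\<^bsub>artin_group N M\<^esub> artin_class N M v = artin_class N M (u @ v)"
proof -
  have *: "artin_class N M (u' @ v') = artin_class N M (u @ v)"
    if "u' \<in> artin_class N M u" "v' \<in> artin_class N M v" for u' v'
    using that unfolding artin_class_def
    by (auto intro: artin_eq.trans artin_eq.sym artin_eq.append)
  have "u \<in> artin_class N M u" "v \<in> artin_class N M v"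
    using assms by (auto simp: artin_class_def intro: artin_eq.refl)
  then have "(\<Union>u'\<in>artin_class N M u. \<Union>v'\<in>artin_class N M v. artin_class N M (u @ v)) = artin_class N M (u @ v)"
    by blast
  moreover have "artin_class N M u \<otimes>\<^bsub>artin_group N M\<^esub> artin_class N M v =
      (\<Union>u'\<in>artin_class N M u. \<Union>v'\<in>artin_class N M v. artin_class N M (u @ v))"
    unfolding artin_group_def monoid.simps by (intro SUP_cong *) auto
  ultimately show ?thesis by simp
qed

lemma artin_class_eq_iff:
  assumes "u \<in> words N" "v \<in> words N"
  shows "artin_class N M u = artin_class N M v \<longleftrightarrow> artin_eq N M u v"
  using assms unfolding artin_class_def
  by (auto intro: artin_eq.refl artin_eq.trans artin_eq.sym)

lemma words_append[simp]: "u @ v \<in> words N \<longleftrightarrow> u \<in> words N \<and> v \<in> words N"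
  by (auto simp: words_def)

lemma words_Nil[simp]: "[] \<in> words N" by (simp add: words_def)

lemma words_Cons[simp]: "(i, b) # w \<in> words N \<longleftrightarrow> i \<in> {1..N} \<and> w \<in> words N"
  by (auto simp: words_def)

text \<open>
  An isomorphism with the Artin group is used only through the resulting evaluation \<open>W\<close> of words.
  This makes it unnecessary to work in the group of classes of words.
\<close>

locale artin_presented = group G for G (structure) +
  fixes N :: nat and M :: "nat \<Rightarrow> nat \<Rightarrow> nat" and W
  assumes W_image: "W ` words N = carrier G"
    and W_append: "\<lbrakk>u \<in> words N; v \<in> words N\<rbrakk> \<Longrightarrow> W (u @ v) = W u \<otimes> W v"
    and W_eq_iff: "\<lbrakk>u \<in> words N; v \<in> words N\<rbrakk> \<Longrightarrow> W u = W v \<longleftrightarrow> artin_eq N M u v"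

lemma (in group) iso_artin_group_presented:
  assumes "G \<cong> artin_group N M"
  obtains W where "artin_presented G N M W"
proof -
  obtain h where h: "h \<in> hom G (artin_group N M)" and b: "bij_betw h (carrier G) (carrier (artin_group N M))"
    using assms by (auto simp: is_iso_def iso_def)
  define W where "W = (\<lambda>u. inv_into (carrier G) h (artin_class N M u))"
  have c: "artin_class N M u \<in> h ` carrier G" if "u \<in> words N" for u
    using b that by (auto simp: bij_betw_def artin_group_def)
  have W: "W u \<in> carrier G" "h (W u) = artin_class N M u" if "u \<in> words N" for u
    using c[OF that] by (auto simp: W_def inv_into_into f_inv_into_f)
  have inj: "inj_on h (carrier G)" using b by (simp add: bij_betw_def)
  have "artin_presented G N M W"
  proof unfold_locales
    show "W ` words N = carrier G"
    proof
      show "carrier G \<subseteq> W ` words N"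
      proof
        fix g assume g: "g \<in> carrier G"
        then have "h g \<in> artin_class N M ` words N"
          using b by (auto simp: bij_betw_def artin_group_def)
        then obtain u where "u \<in> words N" "h g = artin_class N M u" by blast
        then show "g \<in> W ` words N" using inj_onD[OF inj _ g, of "W u"] W by (metis imageI)
      qed
    qed (use W in auto)
    show "W (u @ v) = W u \<otimes> W v" if "u \<in> words N" "v \<in> words N" for u v
      using that W artin_class_mult[OF that] by (intro inj_onD[OF inj]) (auto simp: hom_mult[OF h])
    show "W u = W v \<longleftrightarrow> artin_eq N M u v" if "u \<in> words N" "v \<in> words N" for u v
      using that W artin_class_eq_iff[OF that] inj_onD[OF inj, of "W u" "W v"] by metis
  qed
  then show thesis by (rule that)
qed

context artin_presented
begin

abbreviation "gen i \<equiv> W [(i, True)]"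

lemma W_closed[simp]: "u \<in> words N \<Longrightarrow> W u \<in> carrier G"
  using W_image by auto

lemma W_Nil: "W [] = \<one>"
  using W_append[of "[]" "[]"] by (simp add: W_closed)

lemma W_inv: "i \<in> {1..N} \<Longrightarrow> W [(i, False)] = inv (gen i)"
proof -
  assume i: "i \<in> {1..N}"
  have "W [(i, False), (i, \<not> False)] = \<one>"
    using W_eq_iff[of "[(i, False), (i, \<not> False)]" "[]"] artin_eq.cancel[OF i, of M False] i by (simp add: W_Nil)
  then show ?thesis using W_append[of "[(i, False)]" "[(i, True)]"] i
    by (intro inv_equality[symmetric]) simp_all
qed

lemma W_Cons: "i \<in> {1..N} \<Longrightarrow> w \<in> words N \<Longrightarrow>
    W ((i, b) # w) = (if b then gen i else inv (gen i)) \<otimes> W w"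
  using W_append[of "[(i, b)]" w] W_inv by (cases b) auto

lemma alternating_words[simp]:
  "i \<in> {1..N} \<Longrightarrow> j \<in> {1..N} \<Longrightarrow> alternating_word i j m \<in> words N"
  by (induction m arbitrary: i j) auto

lemma W_alternating:
  "i \<in> {1..N} \<Longrightarrow> j \<in> {1..N} \<Longrightarrow> W (alternating_word i j m) = alt_prod G (gen i) (gen j) m"
proof (induction m arbitrary: i j)
  case (Suc m)
  then show ?case using W_Cons[of i "alternating_word j i m" True] by simp
qed (simp add: W_Nil)

lemma artin_generated: "artin_generated G N M gen"
proof unfold_locales
  show "generate G (gen ` {1..N}) = carrier G"
  proof
    have "W w \<in> generate G (gen ` {1..N})" if "w \<in> words N" for w
      using that
    proof (induction w)
      case Nil then show ?case by (simp add: W_Nil generate.one)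
    next
      case (Cons a w)
      obtain i b where a: "a = (i, b)" by force
      then have i: "i \<in> {1..N}" and w: "w \<in> words N" using Cons.prems by auto
      then have "gen i \<in> generate G (gen ` {1..N})" "inv (gen i) \<in> generate G (gen ` {1..N})"
        by (auto intro: generate.incl generate.inv)
      then show ?case
        unfolding a W_Cons[OF i w] using Cons.IH[OF w] by (auto intro: generate.eng)
    qed
    then show "carrier G \<subseteq> generate G (gen ` {1..N})" unfolding W_image[symmetric] by blast
  qed (rule generate_incl, auto)
qed (use W_eq_iff artin_eq.braid in \<open>auto simp flip: W_alternating\<close>)

end

text \<open>
  Homomorphisms to the additive group of a ring: the exponent sum and the total linking number.
\<close>

locale additive_map = group G for G (structure) +
  fixes f :: "'a \<Rightarrow> 'c::ring_1"
  assumes f_mult: "\<lbrakk>x \<in> carrier G; y \<in> carrier G\<rbrakk> \<Longrightarrow> f (x \<otimes> y) = f x + f y"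
begin

lemma f_one: "f \<one> = 0" using f_mult[of \<one> \<one>] by simp

lemma f_inv: "x \<in> carrier G \<Longrightarrow> f (inv x) = - f x"
  using f_mult[of x "inv x"] by (simp add: f_one eq_neg_iff_add_eq_0 add.commute)

lemma f_derived:
  assumes "g \<in> derived G (carrier G)"
  shows "f g = 0"
  using assms unfolding derived_def
proof (induction rule: generate.induct)
  case (eng h1 h2)
  then show ?case
    using derived_in_carrier[of "carrier G"] unfolding derived_def by (subst f_mult) auto
qed (auto simp: f_one f_mult f_inv)

lemma f_int_pow: "x \<in> carrier G \<Longrightarrow> f (x [^] (m::int)) = of_int m * f x"
proof -
  assume x: "x \<in> carrier G"
  have nat: "f (x [^] (k::nat)) = of_nat k * f x" for k
    using x by (induction k) (auto simp: f_one f_mult algebra_simps)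
  show ?thesis
  proof (cases "0 \<le> m")
    case True
    then obtain k where "m = int k" by (metis nat_eq_iff)
    then show ?thesis by (simp only: int_pow_int nat of_int_of_nat_eq)
  next
    case False
    then obtain k where "m = - int k" by (metis add.inverse_inverse int_cases2 of_nat_0_le_iff)
    then show ?thesis
      using x by (simp only: int_pow_neg_int nat of_int_minus of_int_of_nat_eq f_inv nat_pow_closed mult_minus_left)
  qed
qed

lemma the_elem_coset:
  assumes g: "g \<in> carrier G"
  shows "the_elem (f ` (derived G (carrier G) #> g)) = f g"
proof -
  have "f h = f g" if h: "h \<in> derived G (carrier G) #> g" for h
  proof -
    obtain n where "n \<in> derived G (carrier G)" "h = n \<otimes> g" using h by (auto simp: r_coset_def)
    moreover from this have "n \<in> carrier G" using derived_in_carrier[OF subset_refl] by blast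
    ultimately show ?thesis using g by (simp add: f_mult f_derived)
  qed
  moreover have "g \<in> derived G (carrier G) #> g"
    by (rule rcos_self[OF g derived_is_subgroup[OF subset_refl]])
  ultimately have "f ` (derived G (carrier G) #> g) = {f g}" unfolding image_def by blast
  then show ?thesis by simp
qed

end

text \<open>
  The abelianization is \<open>\<int>\<close>, or \<open>\<int>\<^sup>2\<close> in type B. Both are realized inside the additive group of
  \<open>\<int>[X]\<close>, with values \<open>a + b X\<close>, because this group is linearly ordered.
\<close>

definition weight :: "coxeter_type \<Rightarrow> nat \<Rightarrow> int poly" where
  "weight T i = (if i \<le> main_rank T then 1 else [:0, 1:])"

definition exponent :: "coxeter_type \<Rightarrow> word \<Rightarrow> int poly" where
  "exponent T w = (\<Sum>(i, b)\<leftarrow>w. if b then weight T i else - weight T i)"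

lemma exponent_simps[simp]:
  "exponent T [] = 0"
  "exponent T ((i, b) # w) = (if b then weight T i else - weight T i) + exponent T w"
  "exponent T (u @ v) = exponent T u + exponent T v"
  by (simp_all add: exponent_def)

lemma exponent_alternating:
  "even m \<or> weight T i = weight T j \<Longrightarrow>
    exponent T (alternating_word i j m) = exponent T (alternating_word j i m)"
proof -
  have "exponent T (alternating_word i j (2 * k)) = of_nat k * (weight T i + weight T j)" for i j k
    by (induction k arbitrary: i j) (auto simp: algebra_simps)
  moreover have "exponent T (alternating_word i j m) = of_nat m * weight T i"
    if "weight T i = weight T j" for i j
    using that by (induction m arbitrary: i j) (auto simp: algebra_simps)
  ultimately show "even m \<or> weight T i = weight T j \<Longrightarrow>
      exponent T (alternating_word i j m) = exponent T (alternating_word j i m)"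
    by (auto elim!: evenE simp: algebra_simps)
qed

lemma even_or_equal_weight:
  assumes "i \<in> {1..coxeter_rank T}" "j \<in> {1..coxeter_rank T}" "i \<noteq> j"
  shows "even (coxeter_matrix T i j) \<or> weight T i = weight T j"
  using assms by (cases T) (auto simp: coxeter_matrix_def weight_def min_def max_def)

lemma exponent_artin_eq:
  "artin_eq (coxeter_rank T) (coxeter_matrix T) u v \<Longrightarrow> exponent T u = exponent T v"
proof (induction rule: artin_eq.induct)
  case (braid i j)
  then show ?case by (intro exponent_alternating even_or_equal_weight)
qed auto

locale perfect_artin = artin_presented G "coxeter_rank T" "coxeter_matrix T" W
  for G (structure) and T W +
  assumes T: "T \<in> perfect_types"
begin

definition \<phi> :: "'a \<Rightarrow> int poly" where
  "\<phi> g = exponent T (SOME w. w \<in> words (coxeter_rank T) \<and> W w = g)"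

lemma \<phi>_W: "w \<in> words (coxeter_rank T) \<Longrightarrow> \<phi> (W w) = exponent T w"
proof -
  assume w: "w \<in> words (coxeter_rank T)"
  define v where "v = (SOME v. v \<in> words (coxeter_rank T) \<and> W v = W w)"
  have "v \<in> words (coxeter_rank T) \<and> W v = W w" unfolding v_def by (rule someI[of _ w]) (simp add: w)
  then show ?thesis unfolding \<phi>_def v_def[symmetric] using exponent_artin_eq W_eq_iff w by blast
qed

lemma \<phi>_mult: "x \<in> carrier G \<Longrightarrow> y \<in> carrier G \<Longrightarrow> \<phi> (x \<otimes> y) = \<phi> x + \<phi> y"
  by (auto simp flip: W_image W_append simp: \<phi>_W)

lemma \<phi>_gen1: "gen 1 \<in> carrier G" "\<phi> (gen 1) = 1"
proof -
  have "1 \<le> main_rank T" "main_rank T \<le> coxeter_rank T" using T by (auto simp: perfect_types_def)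
  then show "gen 1 \<in> carrier G" "\<phi> (gen 1) = 1" by (auto simp: \<phi>_W weight_def)
qed

sublocale artin_generated G "coxeter_rank T" "coxeter_matrix T" gen
  by (rule artin_generated)

lemma perfect: "derived G (derived G (carrier G)) = derived G (carrier G)"
  by (rule derived_perfect[OF artin_generated T])

text \<open>
  In an abelian quotient in which the first \<open>main_rank T\<close> generators agree, the image of a word is
  determined by its two exponent sums.
\<close>

lemma exponent_zero_imp_hom_trivial:
  assumes "comm_group Q" and q: "q \<in> hom G Q"
    and main: "\<And>i. i \<in> {1..coxeter_rank T} \<Longrightarrow> i \<le> main_rank T \<Longrightarrow> q (gen i) = q (gen 1)"
    and g: "g \<in> carrier G" "\<phi> g = 0"
  shows "q g = \<one>\<^bsub>Q\<^esub>"
proof -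
  interpret Q: comm_group Q by fact
  interpret h: group_hom G Q q
    by (simp add: group_hom_def group_hom_axioms_def q is_group Q.is_group)
  let ?n = "coxeter_rank T"
  let ?x = "q (gen 1)" and ?y = "q (gen ?n)"
  have n: "1 \<le> main_rank T" "main_rank T \<le> ?n" using T by (auto simp: perfect_types_def)
  have xy[simp]: "?x \<in> carrier Q" "?y \<in> carrier Q" using n by auto
  have last: "i = ?n" if "i \<in> {1..?n}" "\<not> i \<le> main_rank T" for i
    using that by (cases T) auto
  have w: "q (W w) = ?x [^]\<^bsub>Q\<^esub> (poly.coeff (exponent T w) 0) \<otimes>\<^bsub>Q\<^esub> ?y [^]\<^bsub>Q\<^esub> (poly.coeff (exponent T w) 1)"
    if "w \<in> words ?n" for w
    using that
  proof (induction w)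
    case (Cons a w)
    obtain i b where a: "a = (i, b)" by force
    define e :: int where "e = (if b then 1 else -1)"
    have i: "i \<in> {1..?n}" and w: "w \<in> words ?n" using Cons.prems a by auto
    have gi[simp]: "gen i \<in> carrier G" using i by auto
    have "q (W (a # w)) = q (gen i) [^]\<^bsub>Q\<^esub> e \<otimes>\<^bsub>Q\<^esub> q (W w)"
      unfolding a W_Cons[OF i w] e_def using w by (cases b) (simp_all add: Q.int_pow_neg)
    also have "q (W w) = ?x [^]\<^bsub>Q\<^esub> (poly.coeff (exponent T w) 0) \<otimes>\<^bsub>Q\<^esub> ?y [^]\<^bsub>Q\<^esub> (poly.coeff (exponent T w) 1)"
      using Cons w by blast
    also have "q (gen i) [^]\<^bsub>Q\<^esub> e \<otimes>\<^bsub>Q\<^esub> \<dots> =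
      ?x [^]\<^bsub>Q\<^esub> (poly.coeff (exponent T (a # w)) 0) \<otimes>\<^bsub>Q\<^esub> ?y [^]\<^bsub>Q\<^esub> (poly.coeff (exponent T (a # w)) 1)"
    proof (cases "i \<le> main_rank T")
      case True
      have "poly.coeff (exponent T (a # w)) 0 = e + poly.coeff (exponent T w) 0"
        "poly.coeff (exponent T (a # w)) 1 = poly.coeff (exponent T w) 1"
        using True by (auto simp: a weight_def e_def)
      then show ?thesis
        unfolding main[OF i True] by (simp add: Q.int_pow_mult Q.m_assoc del: One_nat_def)
    next
      case False
      have "poly.coeff (exponent T (a # w)) 0 = poly.coeff (exponent T w) 0"
        "poly.coeff (exponent T (a # w)) 1 = e + poly.coeff (exponent T w) 1"
        using False by (auto simp: a weight_def e_def)
      then show ?thesis using last[OF i False]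
        by (simp add: Q.int_pow_mult Q.m_lcomm del: One_nat_def)
    qed
    finally show ?case .
  qed (simp add: W_Nil)
  obtain w' where "w' \<in> words ?n" "g = W w'" using g(1) unfolding W_image[symmetric] by blast
  then show ?thesis using w[of w'] g(2) by (simp add: \<phi>_W)
qed

lemma \<phi>_zero_imp_derived:
  assumes "g \<in> carrier G" "\<phi> g = 0"
  shows "g \<in> derived G (carrier G)"
proof -
  let ?D = "derived G (carrier G)" let ?n = "coxeter_rank T"
  interpret D: normal ?D G by (rule derived_self_is_normal)
  have comm: "X \<otimes>\<^bsub>G Mod ?D\<^esub> Y = Y \<otimes>\<^bsub>G Mod ?D\<^esub> X"
    if "X \<in> carrier (G Mod ?D)" "Y \<in> carrier (G Mod ?D)" for X Y
    using that D.coset_commute_iff commutator_mem_derived by (auto simp: carrier_FactGroup)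
  interpret Q: comm_group "G Mod ?D"
    by (rule group.group_comm_groupI[OF D.factorgroup_is_group comm])
  interpret Q: metabelian_artin "G Mod ?D" T "\<lambda>i. ?D #> gen i"
    by (intro metabelian_artin.intro metabelian.intro metabelian_axioms.intro
        quotient_artin_generated D.normal_axioms D.factorgroup_is_group Q.m_comm)
      (auto intro: subsetD[OF Q.derived_in_carrier])
  have n: "1 \<le> main_rank T" "main_rank T \<le> coxeter_rank T" using T by (auto simp: perfect_types_def)
  have "?D #> g = \<one>\<^bsub>G Mod ?D\<^esub>"
  proof (rule exponent_zero_imp_hom_trivial[of "G Mod ?D" "\<lambda>g. ?D #> g", OF Q.comm_group_axioms])
    show "(\<lambda>g. ?D #> g) \<in> hom G (G Mod ?D)" by (rule D.r_coset_hom_Mod)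
    show "?D #> gen i = ?D #> gen 1" if "i \<in> {1..coxeter_rank T}" "i \<le> main_rank T" for i
      using Q.main_generators_equal[OF T, of i] that by simp
  qed (use assms n in auto)
  then show ?thesis
    using assms rcos_self[OF assms(1) D.subgroup_axioms] by simp
qed

sublocale \<phi>: additive_map G \<phi>
  by unfold_locales (rule \<phi>_mult)

lemma \<phi>_eq_zero_iff: "g \<in> carrier G \<Longrightarrow> \<phi> g = 0 \<longleftrightarrow> g \<in> derived G (carrier G)"
  using \<phi>_zero_imp_derived \<phi>.f_derived by blast

text \<open>
  The first step of the rational derived series is the commutator subgroup because the
  abelianization embeds in the torsion-free group \<open>\<int>[X]\<close>; after that the series is constant
  because the commutator subgroup is perfect.
\<close>

lemma rational_derived_Suc: "rational_derived G (Suc k) = derived G (carrier G)"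
proof (induction k)
  case 0
  have "g \<in> derived G (carrier G)"
    if "g \<in> carrier G" "m \<noteq> 0" "g [^] (m::int) \<in> derived G (carrier G)" for g m
  proof -
    have "of_int m * \<phi> g = 0" using \<phi>.f_derived[OF that(3)] unfolding \<phi>.f_int_pow[OF that(1)] .
    then show ?thesis using that(1,2) \<phi>_zero_imp_derived by simp
  qed
  moreover have "\<exists>m::int. m \<noteq> 0 \<and> g [^] m \<in> derived G (carrier G)"
    "g \<in> carrier G" if "g \<in> derived G (carrier G)" for g
  proof -
    show g: "g \<in> carrier G" using that derived_in_carrier[OF subset_refl] by blast
    show "\<exists>m::int. m \<noteq> 0 \<and> g [^] m \<in> derived G (carrier G)"
      by (rule exI[of _ 1]) (simp only: int_pow_1[OF g] that, simp)
  qed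
  ultimately have "{g \<in> carrier G. \<exists>m::int. m \<noteq> 0 \<and> g [^] m \<in> derived G (carrier G)} = derived G (carrier G)"
    by (intro equalityI subsetI) (auto simp del: int_pow_1)
  then show ?case by (simp only: rational_derived.simps)
next
  case (Suc k)
  have "\<exists>m::int. m \<noteq> 0 \<and> g [^] m \<in> derived G (carrier G)" if "g \<in> derived G (carrier G)" for g
  proof (intro exI[of _ "1::int"] conjI)
    have "g \<in> carrier G" using that derived_in_carrier[OF subset_refl] by blast
    then show "g [^] (1::int) \<in> derived G (carrier G)" using that by (simp only: int_pow_1)
  qed simp
  then show ?case
    unfolding rational_derived.simps(2)[of G "Suc k"] Suc perfect by blast
qed

end

section \<open>Fundamental groups of complements of curves\<close>

definition path_from_to :: "'a::real_normed_vector set \<Rightarrow> 'a \<Rightarrow> 'a \<Rightarrow> (real \<Rightarrow> 'a) \<Rightarrow> bool" where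
  "path_from_to U x y p \<longleftrightarrow> path p \<and> path_image p \<subseteq> U \<and> pathstart p = x \<and> pathfinish p = y"

lemma path_from_to_join:
  "path_from_to U x y p \<Longrightarrow> path_from_to U y z q \<Longrightarrow> path_from_to U x z (p +++ q)"
  by (auto simp: path_from_to_def intro: subset_path_image_join[THEN subsetD])

lemma path_from_to_reverse: "path_from_to U x y p \<Longrightarrow> path_from_to U y x (reversepath p)"
  by (auto simp: path_from_to_def)

lemma path_from_to_const: "x \<in> U \<Longrightarrow> path_from_to U x x (\<lambda>_. x)"
  by (auto simp: path_from_to_def path_def path_image_def pathstart_def pathfinish_def)

lemma path_from_to_homotopic:
  "path_from_to U x y p \<Longrightarrow> homotopic_paths U p q \<Longrightarrow> path_from_to U x y q"
  unfolding path_from_to_def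
  using homotopic_paths_imp_path homotopic_paths_imp_subset
    homotopic_paths_imp_pathstart homotopic_paths_imp_pathfinish by metis

lemma path_from_to_ends: "path_from_to U x y p \<Longrightarrow> x \<in> U \<and> y \<in> U"
  unfolding path_from_to_def by (metis pathfinish_in_path_image pathstart_in_path_image subsetD)

lemma loops_iff: "p \<in> loops U x \<longleftrightarrow> path_from_to U x x p"
  by (simp add: loops_def path_from_to_def)

lemma path_class_eqI: "homotopic_paths U p q \<Longrightarrow> path_class U p = path_class U q"
  unfolding path_class_def using homotopic_paths_trans homotopic_paths_sym by blast

lemma path_class_eqD: "path_from_to U x y q \<Longrightarrow> path_class U p = path_class U q \<Longrightarrow> homotopic_paths U p q"
  unfolding path_class_def path_from_to_def using homotopic_paths_refl by blast

text \<open>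
  The product of the fundamental group makes sense for classes of composable paths, so that it
  also serves as the composition of the fundamental groupoid.
\<close>

lemma path_class_mult:
  assumes "path_from_to U x y p" "path_from_to U y z q"
  shows "path_class U p \<otimes>\<^bsub>fundamental_group U x0\<^esub> path_class U q = path_class U (p +++ q)"
proof -
  have *: "path_class U (p' +++ q') = path_class U (p +++ q)"
    if "p' \<in> path_class U p" "q' \<in> path_class U q" for p' q'
    using that assms
    by (intro path_class_eqI homotopic_paths_sym[OF homotopic_paths_join])
      (auto simp: path_class_def path_from_to_def)
  have "p \<in> path_class U p" "q \<in> path_class U q"
    using assms by (auto simp: path_class_def path_from_to_def)
  then have "(\<Union>p'\<in>path_class U p. \<Union>q'\<in>path_class U q. path_class U (p +++ q)) = path_class U (p +++ q)"
    by blast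
  moreover have "path_class U p \<otimes>\<^bsub>fundamental_group U x0\<^esub> path_class U q =
      (\<Union>p'\<in>path_class U p. \<Union>q'\<in>path_class U q. path_class U (p +++ q))"
    unfolding fundamental_group_def monoid.simps by (intro SUP_cong *) auto
  ultimately show ?thesis by simp
qed

lemma path_class_assoc:
  assumes "path_from_to U x y p" "path_from_to U y z q" "path_from_to U z w r"
  shows "path_class U ((p +++ q) +++ r) = path_class U (p +++ (q +++ r))"
  using assms by (intro path_class_eqI homotopic_paths_sym[OF homotopic_paths_assoc])
    (auto simp: path_from_to_def)

lemma const_eq_linepath: "(\<lambda>_. x) = linepath x (x :: 'a::real_normed_vector)"
  by (auto simp: linepath_def fun_eq_iff algebra_simps)

lemma path_class_lid:
  assumes "path_from_to U x y p" shows "path_class U ((\<lambda>_. x) +++ p) = path_class U p"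
  using assms unfolding const_eq_linepath
  by (intro path_class_eqI homotopic_paths_lid') (auto simp: path_from_to_def)

lemma path_class_rinv:
  assumes "path_from_to U x y p" shows "path_class U (p +++ reversepath p) = path_class U (\<lambda>_. x)"
  using assms homotopic_paths_rinv[of p U] unfolding const_eq_linepath
  by (intro path_class_eqI) (auto simp: path_from_to_def)

lemma path_class_linv:
  assumes "path_from_to U x y p" shows "path_class U (reversepath p +++ p) = path_class U (\<lambda>_. y)"
  using path_class_rinv[OF path_from_to_reverse[OF assms]] by simp

lemma path_class_join_cong:
  assumes "path_from_to U x y p" "path_from_to U y z q"
    "path_class U p = path_class U p'" "path_class U q = path_class U q'"
    "path_from_to U x y p'" "path_from_to U y z q'"
  shows "path_class U (p +++ q) = path_class U (p' +++ q')"
  using path_class_mult[OF assms(1,2), of undefined] path_class_mult[OF assms(5,6), of undefined] assms(3,4) by simp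

lemma carrier_fundamental_group: "carrier (fundamental_group U x) = path_class U ` {p. path_from_to U x x p}"
  by (auto simp: fundamental_group_def loops_iff)

lemma one_fundamental_group: "\<one>\<^bsub>fundamental_group U x\<^esub> = path_class U (\<lambda>_. x)"
  by (simp add: fundamental_group_def)

lemma group_fundamental_group:
  assumes "x \<in> U"
  shows "group (fundamental_group U x)"
proof (rule groupI)
  let ?G = "fundamental_group U x"
  fix X assume "X \<in> carrier ?G"
  then obtain p where p: "path_from_to U x x p" "X = path_class U p" by (auto simp: carrier_fundamental_group)
  show "\<one>\<^bsub>?G\<^esub> \<otimes>\<^bsub>?G\<^esub> X = X"
    using p assms by (simp add: one_fundamental_group path_class_mult[OF path_from_to_const p(1)] path_class_lid)
  show "\<exists>Y\<in>carrier ?G. Y \<otimes>\<^bsub>?G\<^esub> X = \<one>\<^bsub>?G\<^esub>"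
    using p path_from_to_reverse[OF p(1)]
    by (intro bexI[of _ "path_class U (reversepath p)"])
      (auto simp: one_fundamental_group path_class_mult path_class_linv carrier_fundamental_group)
  fix Y assume "Y \<in> carrier ?G"
  then obtain q where q: "path_from_to U x x q" "Y = path_class U q" by (auto simp: carrier_fundamental_group)
  show "X \<otimes>\<^bsub>?G\<^esub> Y \<in> carrier ?G"
    using p q path_from_to_join[OF p(1) q(1)] by (auto simp: path_class_mult carrier_fundamental_group)
  fix Z assume "Z \<in> carrier ?G"
  then obtain r where r: "path_from_to U x x r" "Z = path_class U r" by (auto simp: carrier_fundamental_group)
  show "X \<otimes>\<^bsub>?G\<^esub> Y \<otimes>\<^bsub>?G\<^esub> Z = X \<otimes>\<^bsub>?G\<^esub> (Y \<otimes>\<^bsub>?G\<^esub> Z)"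
    using p q r
    by (simp add: path_class_mult[OF p(1) q(1)] path_class_mult[OF q(1) r(1)]
        path_class_mult[OF path_from_to_join[OF p(1) q(1)] r(1)]
        path_class_mult[OF p(1) path_from_to_join[OF q(1) r(1)]] path_class_assoc)
qed (use assms path_from_to_const in \<open>auto simp: one_fundamental_group carrier_fundamental_group\<close>)

lemma inv_path_class:
  assumes "path_from_to U x x p"
  shows "inv\<^bsub>fundamental_group U x\<^esub> path_class U p = path_class U (reversepath p)"
proof -
  interpret group "fundamental_group U x"
    using path_from_to_ends[OF assms] by (intro group_fundamental_group) auto
  show ?thesis
    using assms path_from_to_reverse[OF assms]
    by (intro inv_equality) (auto simp: path_class_mult path_class_linv one_fundamental_group carrier_fundamental_group)
qed

lemma eval2_on_line: "\<exists>q. \<forall>s. eval2 f (a + s * u, b + s * v) = poly q s"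
proof (induction f)
  case 0 then show ?case by (auto simp: eval2_def intro: exI[of _ 0])
next
  case (pCons c f)
  then obtain q where q: "\<And>s. eval2 f (a + s * u, b + s * v) = poly q s" by blast
  have "eval2 (pCons c f) (a + s * u, b + s * v) = poly (pcompose c [:a, u:] + [:b, v:] * q) s" for s
    using q[of s] by (simp add: eval2_def poly_pcompose algebra_simps)
  then show ?case by blast
qed

text \<open>
  The complex line through two points of the complement meets the curve in the zeros of a
  nonzero polynomial, and the complement of a finite set in \<open>\<complex>\<close> is path connected.
\<close>

lemma path_connected_curve_complement: "path_connected (curve_complement f)"
  unfolding path_connected_component
proof (intro ballI)
  fix P Q assume P: "P \<in> curve_complement f" and Q: "Q \<in> curve_complement f"
  define h where "h = (\<lambda>s. (fst P + s * (fst Q - fst P), snd P + s * (snd Q - snd P)))"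
  obtain q where q: "\<And>s. eval2 f (h s) = poly q s" unfolding h_def using eval2_on_line by blast
  have h01: "h 0 = P" "h 1 = Q" by (simp_all add: h_def)
  have "q \<noteq> 0" using q[of 0] P h01 by (auto simp: curve_complement_def)
  then have "path_connected (- {s. poly q s = 0})"
    by (intro path_connected_complement_countable countable_finite poly_roots_finite) auto
  moreover have "continuous_on (- {s. poly q s = 0}) h"
    unfolding h_def by (intro continuous_intros)
  ultimately have pc: "path_connected (h ` (- {s. poly q s = 0}))"
    by (rule path_connected_continuous_image[rotated])
  have sub: "h ` (- {s. poly q s = 0}) \<subseteq> curve_complement f"
    using q by (auto simp: curve_complement_def)
  have "0 \<in> - {s. poly q s = 0}" "1 \<in> - {s. poly q s = 0}"
    using P Q h01 q[of 0] q[of 1] by (auto simp: curve_complement_def)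
  then have "path_component (h ` (- {s. poly q s = 0})) P Q"
    using pc h01 unfolding path_connected_component by (metis imageI)
  then show "path_component (curve_complement f) P Q" using sub path_component_of_subset by blast
qed

lemma linking_number_eqI: "winding_number (eval2 f \<circ> p) 0 = of_int n \<Longrightarrow> linking_number f p = n"
  by (auto simp: linking_number_def)

lemma linking_number_loop:
  assumes "path_from_to (curve_complement f) x x p"
  shows "winding_number (eval2 f \<circ> p) 0 = of_int (linking_number f p)"
proof -
  have "path (eval2 f \<circ> p)" "0 \<notin> path_image (eval2 f \<circ> p)"
    "pathfinish (eval2 f \<circ> p) = pathstart (eval2 f \<circ> p)"
    using assms by (auto simp: path_from_to_def path_image_compose curve_complement_def
        pathfinish_compose pathstart_compose intro!: path_continuous_image continuous_on_eval2)
  then obtain n where "winding_number (eval2 f \<circ> p) 0 = of_int n"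
    using integer_winding_number Ints_cases by metis
  then show ?thesis using linking_number_eqI by metis
qed

lemma linking_number_homotopic:
  assumes "homotopic_paths (curve_complement f) p q"
  shows "linking_number f p = linking_number f q"
proof -
  have "homotopic_paths (- {0}) (eval2 f \<circ> p) (eval2 f \<circ> q)"
    using assms by (rule homotopic_paths_continuous_image)
      (auto simp: curve_complement_def intro!: continuous_on_eval2)
  from winding_number_homotopic_paths[OF this] show ?thesis by (simp only: linking_number_def)
qed

lemma linking_number_join:
  assumes p: "path_from_to (curve_complement f) x x p" and q: "path_from_to (curve_complement f) x x q"
  shows "linking_number f (p +++ q) = linking_number f p + linking_number f q"
proof (rule linking_number_eqI)
  have "winding_number (eval2 f \<circ> (p +++ q)) 0 = winding_number (eval2 f \<circ> p) 0 + winding_number (eval2 f \<circ> q) 0"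
    unfolding path_compose_join using assms
    by (intro winding_number_join) (auto simp: path_from_to_def path_image_compose curve_complement_def
        pathfinish_compose pathstart_compose intro!: path_continuous_image continuous_on_eval2)
  then show "winding_number (eval2 f \<circ> (p +++ q)) 0 = of_int (linking_number f p + linking_number f q)"
    by (simp add: linking_number_loop[OF p] linking_number_loop[OF q])
qed

lemma total_linking_path_class:
  assumes "path_from_to (curve_complement f) x x p"
  shows "total_linking f (path_class (curve_complement f) p) = linking_number f p"
proof -
  have "linking_number f q = linking_number f p" if "q \<in> path_class (curve_complement f) p" for q
    using that linking_number_homotopic by (auto simp: path_class_def)
  moreover have "p \<in> path_class (curve_complement f) p"
    using assms by (auto simp: path_class_def path_from_to_def)
  ultimately have "linking_number f ` path_class (curve_complement f) p = {linking_number f p}"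
    unfolding image_def by blast
  then show ?thesis by (simp add: total_linking_def)
qed

lemma total_linking_mult:
  assumes "X \<in> carrier (fundamental_group (curve_complement f) x)"
    "Y \<in> carrier (fundamental_group (curve_complement f) x)"
  shows "total_linking f (X \<otimes>\<^bsub>fundamental_group (curve_complement f) x\<^esub> Y) = total_linking f X + total_linking f Y"
proof -
  obtain p q where "path_from_to (curve_complement f) x x p" "X = path_class (curve_complement f) p"
    "path_from_to (curve_complement f) x x q" "Y = path_class (curve_complement f) q"
    using assms by (auto simp: carrier_fundamental_group)
  then show ?thesis
    by (simp add: path_class_mult total_linking_path_class[OF path_from_to_join] total_linking_path_class
       linking_number_join)
qed

section \<open>Rings of fractions and group rings of ordered abelian groups\<close>

text \<open>
  The set \<open>D\<close> with its operations is embedded by \<open>j\<close> in a field. A fraction \<open>r s\<^sup>-\<^sup>1\<close> is then determined by its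
  value \<open>j r / j s\<close>, and the ring of fractions is isomorphic to the subring \<open>V\<close> of the field that
  consists of these values.
\<close>

locale commutative_fractions =
  fixes D :: "('r, 'm) ring_scheme" (structure) and S :: "'r set" and j :: "'r \<Rightarrow> 'f::field"
  assumes add_closed: "\<lbrakk>a \<in> carrier D; b \<in> carrier D\<rbrakk> \<Longrightarrow> a \<oplus> b \<in> carrier D"
    and mult_closed: "\<lbrakk>a \<in> carrier D; b \<in> carrier D\<rbrakk> \<Longrightarrow> a \<otimes> b \<in> carrier D"
    and zero_closed: "\<zero> \<in> carrier D"
    and j_add: "\<lbrakk>a \<in> carrier D; b \<in> carrier D\<rbrakk> \<Longrightarrow> j (a \<oplus> b) = j a + j b"
    and j_mult: "\<lbrakk>a \<in> carrier D; b \<in> carrier D\<rbrakk> \<Longrightarrow> j (a \<otimes> b) = j a * j b"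
    and j_zero: "j \<zero> = 0" and j_one: "j \<one> = 1"
    and j_minus: "a \<in> carrier D \<Longrightarrow> \<exists>b\<in>carrier D. j b = - j a"
    and j_inj: "inj_on j (carrier D)"
    and S_subset: "S \<subseteq> carrier D" and S_one: "\<one> \<in> S"
    and S_mult: "\<lbrakk>s \<in> S; t \<in> S\<rbrakk> \<Longrightarrow> s \<otimes> t \<in> S"
    and S_nonzero: "s \<in> S \<Longrightarrow> j s \<noteq> 0"
begin

definition fractions_of_value :: "'f \<Rightarrow> ('r \<times> 'r) set" where
  "fractions_of_value v = {(r, s). r \<in> carrier D \<and> s \<in> S \<and> j r / j s = v}"

definition V :: "'f set" where
  "V = {j r / j s | r s. r \<in> carrier D \<and> s \<in> S}"

abbreviation "cl \<equiv> fractions_of_value"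
abbreviation "R \<equiv> right_fractions D S"

lemma S_carrier: "s \<in> S \<Longrightarrow> s \<in> carrier D" using S_subset by auto

lemma eq_if_j: "\<lbrakk>a \<in> carrier D; b \<in> carrier D; j a = j b\<rbrakk> \<Longrightarrow> a = b"
  using j_inj by (auto dest: inj_onD)

lemma right_fraction_eq:
  assumes r: "r \<in> carrier D" and s: "s \<in> S"
  shows "right_fraction D S r s = cl (j r / j s)"
proof (intro equalityI subrelI)
  fix r' s'
  {
    assume "(r', s') \<in> right_fraction D S r s"
    then obtain u u' where *: "r' \<in> carrier D" "s' \<in> S" "u \<in> carrier D" "u' \<in> carrier D"
      "s \<otimes> u \<in> S" "s \<otimes> u = s' \<otimes> u'" "r \<otimes> u = r' \<otimes> u'"
      unfolding right_fraction_def by blast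
    have 1: "j s * j u = j s' * j u'" "j r * j u = j r' * j u'"
      using * r s by (metis j_mult S_carrier)+
    have 2: "j s \<noteq> 0" "j s' \<noteq> 0" "j s * j u \<noteq> 0"
      using S_nonzero * s S_nonzero[OF *(5)] j_mult[of s u] S_carrier by auto
    have "j r' / j s' = (j r' * j u') / (j s' * j u')" using 1 2 by auto
    also have "\<dots> = j r / j s" using 1(1)[symmetric] 1(2)[symmetric] 2 by auto
    finally show "(r', s') \<in> cl (j r / j s)" using * by (simp add: fractions_of_value_def)
  }
  {
    assume "(r', s') \<in> cl (j r / j s)"
    then have *: "r' \<in> carrier D" "s' \<in> S" "j r' / j s' = j r / j s"
      by (auto simp: fractions_of_value_def)
    have 1: "j r' * j s = j r * j s'" using * S_nonzero s by (simp add: field_simps)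
    have "s \<otimes> s' = s' \<otimes> s" "r \<otimes> s' = r' \<otimes> s"
      by (rule eq_if_j, use * r s 1 in \<open>simp_all add: j_mult S_carrier mult_closed\<close>)+
    then show "(r', s') \<in> right_fraction D S r s"
      unfolding right_fraction_def using * r s S_mult[of s s'] S_carrier by blast
  }
qed

lemma cl_nonempty: "v \<in> V \<Longrightarrow> \<exists>r s. (r, s) \<in> cl v"
  by (auto simp: V_def fractions_of_value_def)

lemma cl_inj: "v \<in> V \<Longrightarrow> cl v = cl w \<Longrightarrow> v = w"
  using cl_nonempty[of v] by (auto simp: fractions_of_value_def set_eq_iff)

lemma carrier_R: "carrier R = cl ` V"
proof -
  have "carrier R = {right_fraction D S r s | r s. r \<in> carrier D \<and> s \<in> S}"
    by (simp add: right_fractions_def)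
  also have "\<dots> = {cl (j r / j s) | r s. r \<in> carrier D \<and> s \<in> S}"
    by (intro Collect_cong) (metis right_fraction_eq)
  finally show ?thesis by (auto simp: V_def)
qed

lemma V_I: "r \<in> carrier D \<Longrightarrow> s \<in> S \<Longrightarrow> j r / j s \<in> V" by (auto simp: V_def)

lemma one_carrier: "\<one> \<in> carrier D" using S_one S_carrier by auto

lemma zero_V: "0 \<in> V" and one_V: "1 \<in> V" and j_V: "r \<in> carrier D \<Longrightarrow> j r \<in> V"
  using V_I[OF zero_closed S_one] V_I[OF one_carrier S_one] V_I[OF _ S_one, of r]
  by (simp_all add: j_zero j_one)

lemma mult_V: assumes "v \<in> V" "w \<in> V" shows "v * w \<in> V"
proof -
  obtain r s r' s' where *: "v = j r / j s" "r \<in> carrier D" "s \<in> S"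
    "w = j r' / j s'" "r' \<in> carrier D" "s' \<in> S" using assms by (auto simp: V_def)
  have "v * w = j (r \<otimes> r') / j (s \<otimes> s')" using * by (simp add: j_mult S_carrier)
  then show ?thesis using * V_I mult_closed S_mult by simp
qed

lemma add_V: assumes "v \<in> V" "w \<in> V" shows "v + w \<in> V"
proof -
  obtain r s r' s' where *: "v = j r / j s" "r \<in> carrier D" "s \<in> S"
    "w = j r' / j s'" "r' \<in> carrier D" "s' \<in> S" using assms by (auto simp: V_def)
  have "v + w = j (r \<otimes> s' \<oplus> r' \<otimes> s) / j (s \<otimes> s')"
    using * S_nonzero by (simp add: j_mult j_add S_carrier mult_closed add_frac_eq)
  then show ?thesis using * V_I mult_closed add_closed S_mult S_carrier by simp
qed

lemma minus_V: assumes "v \<in> V" shows "- v \<in> V"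
proof -
  obtain r s where *: "v = j r / j s" "r \<in> carrier D" "s \<in> S" using assms by (auto simp: V_def)
  obtain r' where "r' \<in> carrier D" "j r' = - j r" using j_minus[OF *(2)] by auto
  then show ?thesis using V_I[of r' s] * by simp
qed

text \<open>
  Sums and products of fractions are defined as unions over all representatives and all
  choices of common denominators; it suffices that every choice gives the same class.
\<close>

lemma UN_const_pairs:
  assumes "\<And>r s r' s'. (r, s) \<in> X \<Longrightarrow> (r', s') \<in> Y \<Longrightarrow> F r s r' s' \<noteq> {} \<and> (\<forall>Z\<in>F r s r' s'. Z = C)"
    and "\<exists>r s. (r, s) \<in> X" "\<exists>r s. (r, s) \<in> Y"
  shows "(\<Union>(r, s)\<in>X. \<Union>(r', s')\<in>Y. \<Union>(F r s r' s')) = C"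
proof -
  have F: "\<Union>(F (fst p) (snd p) (fst q) (snd q)) = C" if "p \<in> X" "q \<in> Y" for p q
  proof -
    have "F (fst p) (snd p) (fst q) (snd q) = {C}"
      using assms(1)[of "fst p" "snd p" "fst q" "snd q"] that by auto
    then show ?thesis by simp
  qed
  have "(\<Union>p\<in>X. \<Union>q\<in>Y. \<Union>(F (fst p) (snd p) (fst q) (snd q))) = (\<Union>p\<in>X. \<Union>q\<in>Y. C)"
    by (simp add: F)
  also have "\<dots> = C" using assms(2,3) by auto
  finally show ?thesis by (simp only: split_def)
qed

lemma mult_R: assumes "v \<in> V" "w \<in> V" shows "cl v \<otimes>\<^bsub>R\<^esub> cl w = cl (v * w)"
  unfolding right_fractions_def monoid.simps
proof (rule UN_const_pairs)
  fix r s r' s' assume 1: "(r, s) \<in> cl v" and 2: "(r', s') \<in> cl w"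
  then have *: "r \<in> carrier D" "s \<in> S" "r' \<in> carrier D" "s' \<in> S" and v: "v = j r / j s" "w = j r' / j s'"
    by (auto simp: fractions_of_value_def)
  have "s \<otimes> r' = r' \<otimes> s" using * by (intro eq_if_j mult_closed) (auto simp: j_mult S_carrier)
  moreover have "right_fraction D S (r \<otimes> u) (s' \<otimes> t) = cl (v * w)"
    if "u \<in> carrier D" "t \<in> S" "s \<otimes> u = r' \<otimes> t" for u t
  proof -
    have "j s * j u = j r' * j t" using that * by (metis j_mult S_carrier)
    then have "j u = j r' * j t / j s" using * S_nonzero by (simp add: field_simps)
    then have "j (r \<otimes> u) / j (s' \<otimes> t) = v * w"
      using * that S_nonzero v by (simp add: j_mult S_carrier)
    then show ?thesis using right_fraction_eq[of "r \<otimes> u" "s' \<otimes> t"] * that mult_closed S_mult by simp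
  qed
  ultimately show "{right_fraction D S (r \<otimes> u) (s' \<otimes> v) |u v. u \<in> carrier D \<and> v \<in> S \<and> s \<otimes> u = r' \<otimes> v} \<noteq> {} \<and>
       (\<forall>Z\<in>{right_fraction D S (r \<otimes> u) (s' \<otimes> v) |u v. u \<in> carrier D \<and> v \<in> S \<and> s \<otimes> u = r' \<otimes> v}. Z = cl (v * w))"
    using * by blast
qed (use assms cl_nonempty in auto)

lemma add_R: assumes "v \<in> V" "w \<in> V" shows "cl v \<oplus>\<^bsub>R\<^esub> cl w = cl (v + w)"
  unfolding right_fractions_def ring.simps
proof (rule UN_const_pairs)
  fix r s r' s' assume 1: "(r, s) \<in> cl v" and 2: "(r', s') \<in> cl w"
  then have *: "r \<in> carrier D" "s \<in> S" "r' \<in> carrier D" "s' \<in> S" and v: "v = j r / j s" "w = j r' / j s'"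
    by (auto simp: fractions_of_value_def)
  have "s \<otimes> s' = s' \<otimes> s" using * by (intro eq_if_j mult_closed) (auto simp: j_mult S_carrier)
  moreover have "right_fraction D S (r \<otimes> u \<oplus> r' \<otimes> u') (s \<otimes> u) = cl (v + w)"
    if "u \<in> carrier D" "u' \<in> carrier D" "s \<otimes> u \<in> S" "s \<otimes> u = s' \<otimes> u'" for u u'
  proof -
    have e: "j s * j u = j s' * j u'" using that * by (metis j_mult S_carrier)
    have "j s * j u \<noteq> 0" using S_nonzero[OF that(3)] that * j_mult[of s u] S_carrier by auto
    then have "j (r \<otimes> u \<oplus> r' \<otimes> u') / j (s \<otimes> u) = (j r * j u) / (j s * j u) + (j r' * j u') / (j s' * j u')"
      using * that j_mult[of r u] j_mult[of r' u'] j_mult[of s u] mult_closed S_carrier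
      by (simp add: j_add add_divide_distrib flip: e)
    also have "\<dots> = j r / j s + j r' / j s'"
      using \<open>j s * j u \<noteq> 0\<close> \<open>j s * j u \<noteq> 0\<close>[unfolded e] by simp
    also have "\<dots> = v + w" using v by simp
    finally show ?thesis
      using right_fraction_eq[of "r \<otimes> u \<oplus> r' \<otimes> u'" "s \<otimes> u"] * that mult_closed add_closed by simp
  qed
  moreover have "s \<otimes> s' \<in> S" "s \<in> carrier D" "s' \<in> carrier D" using * S_mult S_carrier by auto
  ultimately show "{right_fraction D S (r \<otimes> u \<oplus> r' \<otimes> u') (s \<otimes> u) |u u'. u \<in> carrier D \<and> u' \<in> carrier D \<and> s \<otimes> u \<in> S \<and> s \<otimes> u = s' \<otimes> u'} \<noteq> {} \<and>
       (\<forall>Z\<in>{right_fraction D S (r \<otimes> u \<oplus> r' \<otimes> u') (s \<otimes> u) |u u'. u \<in> carrier D \<and> u' \<in> carrier D \<and> s \<otimes> u \<in> S \<and> s \<otimes> u = s' \<otimes> u'}. Z = cl (v + w))"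
    by blast
qed (use assms cl_nonempty in auto)

lemma zero_R: "\<zero>\<^bsub>R\<^esub> = cl 0" and one_R: "\<one>\<^bsub>R\<^esub> = cl 1"
  using right_fraction_eq[OF zero_closed S_one] right_fraction_eq[OF one_carrier S_one]
  by (simp_all add: right_fractions_def j_zero j_one)

lemma domain_R: "domain R"
proof -
  have "cring R"
  proof (intro cringI abelian_groupI comm_monoidI)
    fix X assume "X \<in> carrier R"
    then obtain v where v: "v \<in> V" "X = cl v" by (auto simp: carrier_R)
    show "\<exists>Y\<in>carrier R. Y \<oplus>\<^bsub>R\<^esub> X = \<zero>\<^bsub>R\<^esub>"
      using v minus_V by (intro bexI[of _ "cl (- v)"]) (auto simp: carrier_R add_R zero_R)
  qed (auto simp: carrier_R zero_R one_R add_R mult_R add_V mult_V zero_V one_V algebra_simps)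
  then show ?thesis
  proof (intro domain.intro domain_axioms.intro)
    show "\<one>\<^bsub>R\<^esub> \<noteq> \<zero>\<^bsub>R\<^esub>" using cl_inj[OF one_V, of 0] by (auto simp: zero_R one_R)
    fix X Y assume "X \<otimes>\<^bsub>R\<^esub> Y = \<zero>\<^bsub>R\<^esub>" "X \<in> carrier R" "Y \<in> carrier R"
    then obtain v w where "X = cl v" "Y = cl w" "v \<in> V" "w \<in> V" "cl (v * w) = cl 0"
      by (auto simp: carrier_R zero_R mult_R)
    then show "X = \<zero>\<^bsub>R\<^esub> \<or> Y = \<zero>\<^bsub>R\<^esub>"
      using cl_inj[OF mult_V, of v w 0] by (auto simp: zero_R)
  qed
qed

lemma minus_R: assumes "v \<in> V" "w \<in> V" shows "cl v \<ominus>\<^bsub>R\<^esub> cl w = cl (v - w)"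
proof -
  interpret R: domain R by (rule domain_R)
  have "cl (- w) \<oplus>\<^bsub>R\<^esub> cl w = \<zero>\<^bsub>R\<^esub>" using assms by (simp add: add_R minus_V zero_R)
  then have "\<ominus>\<^bsub>R\<^esub> cl w = cl (- w)"
    using assms minus_V by (intro R.minus_equality) (auto simp: carrier_R)
  then show ?thesis using assms by (simp add: R.minus_eq add_R minus_V)
qed

end

text \<open>
  The group ring of an abelian group that embeds in a linearly ordered group: the embedding
  turns it into a subring of a ring of finitely supported functions on the ordered group, which
  is an integral domain by comparison of leading terms. The set \<open>H\<close> will be the kernel of the
  linking number, so that \<open>A_H\<close> is the group ring whose nonzero elements are inverted.
\<close>

locale ordered_group_ring = comm_group \<Gamma> for \<Gamma> (structure) +
  fixes \<phi> :: "'a \<Rightarrow> 'c::linordered_ab_group_add" and H :: "'a set"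
  assumes \<phi>_mult: "\<lbrakk>x \<in> carrier \<Gamma>; y \<in> carrier \<Gamma>\<rbrakk> \<Longrightarrow> \<phi> (x \<otimes> y) = \<phi> x + \<phi> y"
    and \<phi>_inj: "inj_on \<phi> (carrier \<Gamma>)"
    and H: "subgroup H \<Gamma>"
begin

abbreviation "A \<equiv> group_ring \<Gamma>"
abbreviation "supp (a :: 'a \<Rightarrow> int) \<equiv> {g. a g \<noteq> 0}"
definition "A_H = {a \<in> carrier A. supp a \<subseteq> H}"
abbreviation "S \<equiv> A_H - {\<zero>\<^bsub>A\<^esub>}"

lemma carrier_A: "carrier A = {a. finite (supp a) \<and> supp a \<subseteq> carrier \<Gamma>}"
  by (simp add: group_ring_def)

definition \<iota> :: "('a \<Rightarrow> int) \<Rightarrow> 'c \<Rightarrow>\<^sub>0 int" where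
  "\<iota> a = (\<Sum>g\<in>supp a. Poly_Mapping.single (\<phi> g) (a g))"

lemma \<iota>_superset: "finite B \<Longrightarrow> supp a \<subseteq> B \<Longrightarrow> \<iota> a = (\<Sum>g\<in>B. Poly_Mapping.single (\<phi> g) (a g))"
  unfolding \<iota>_def by (intro sum.mono_neutral_left) auto

lemma lookup_\<iota>:
  assumes "a \<in> carrier A" "g \<in> carrier \<Gamma>"
  shows "Poly_Mapping.lookup (\<iota> a) (\<phi> g) = a g"
proof -
  have fin: "finite (supp a)" and sub: "supp a \<subseteq> carrier \<Gamma>" using assms by (auto simp: carrier_A)
  have "Poly_Mapping.lookup (\<iota> a) (\<phi> g) = (\<Sum>h\<in>supp a. if h = g then a h else 0)"
    unfolding \<iota>_def lookup_sum using sub assms(2) inj_onD[OF \<phi>_inj]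
    by (intro sum.cong) (auto simp: lookup_single when_def)
  also have "\<dots> = a g" using fin by (simp add: sum.delta)
  finally show ?thesis .
qed

lemma \<iota>_inj: "inj_on \<iota> (carrier A)"
proof (intro inj_onI ext)
  fix a b g assume *: "a \<in> carrier A" "b \<in> carrier A" "\<iota> a = \<iota> b"
  show "a g = b g"
  proof (cases "g \<in> carrier \<Gamma>")
    case True then show ?thesis using lookup_\<iota>[of a g] lookup_\<iota>[of b g] * by simp
  next
    case False
    then have "a g = 0" "b g = 0" using * by (auto simp: carrier_A)
    then show ?thesis by simp
  qed
qed

lemma add_A: "a \<oplus>\<^bsub>A\<^esub> b = (\<lambda>g. a g + b g)" by (simp add: group_ring_def)
lemma zero_A: "\<zero>\<^bsub>A\<^esub> = (\<lambda>g. 0)" by (simp add: group_ring_def)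
lemma one_A: "\<one>\<^bsub>A\<^esub> = (\<lambda>g. of_bool (g = \<one>))" by (simp add: group_ring_def)
lemma mult_A: "a \<otimes>\<^bsub>A\<^esub> b = (\<lambda>g. \<Sum>(h, h') | a h \<noteq> 0 \<and> b h' \<noteq> 0 \<and> h \<otimes> h' = g. a h * b h')"
  by (simp add: group_ring_def)

lemma supp_mult: "supp (a \<otimes>\<^bsub>A\<^esub> b) \<subseteq> (\<lambda>(h, h'). h \<otimes> h') ` (supp a \<times> supp b)"
proof
  fix g assume "g \<in> supp (a \<otimes>\<^bsub>A\<^esub> b)"
  then have "{(h, h'). a h \<noteq> 0 \<and> b h' \<noteq> 0 \<and> h \<otimes> h' = g} \<noteq> {}"
    unfolding mult_A by (metis (mono_tags, lifting) mem_Collect_eq sum.empty)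
  then show "g \<in> (\<lambda>(h, h'). h \<otimes> h') ` (supp a \<times> supp b)" by blast
qed

lemma A_add_closed: "a \<in> carrier A \<Longrightarrow> b \<in> carrier A \<Longrightarrow> a \<oplus>\<^bsub>A\<^esub> b \<in> carrier A"
proof -
  assume *: "a \<in> carrier A" "b \<in> carrier A"
  have "supp (a \<oplus>\<^bsub>A\<^esub> b) \<subseteq> supp a \<union> supp b" by (auto simp: add_A)
  then show ?thesis using * finite_subset unfolding carrier_A by blast
qed

lemma A_mult_closed: "a \<in> carrier A \<Longrightarrow> b \<in> carrier A \<Longrightarrow> a \<otimes>\<^bsub>A\<^esub> b \<in> carrier A"
proof -
  assume *: "a \<in> carrier A" "b \<in> carrier A"
  then have "finite ((\<lambda>(h, h'). h \<otimes> h') ` (supp a \<times> supp b))" by (simp add: carrier_A)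
  moreover have "(\<lambda>(h, h'). h \<otimes> h') ` (supp a \<times> supp b) \<subseteq> carrier \<Gamma>" using * by (auto simp: carrier_A)
  ultimately show ?thesis using finite_subset[OF supp_mult] supp_mult[of a b] unfolding carrier_A by blast
qed

lemma single_sum: "Poly_Mapping.single k (sum f B) = (\<Sum>x\<in>B. Poly_Mapping.single k (f x))"
  by (induction B rule: infinite_finite_induct) (auto simp: single_add)

lemma \<iota>_add: "a \<in> carrier A \<Longrightarrow> b \<in> carrier A \<Longrightarrow> \<iota> (a \<oplus>\<^bsub>A\<^esub> b) = \<iota> a + \<iota> b"
proof -
  assume *: "a \<in> carrier A" "b \<in> carrier A"
  let ?B = "supp a \<union> supp b"
  have fin: "finite ?B" using * by (simp add: carrier_A)
  have "supp (a \<oplus>\<^bsub>A\<^esub> b) \<subseteq> ?B" by (auto simp: add_A)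
  then show ?thesis
    using \<iota>_superset[OF fin, of a] \<iota>_superset[OF fin, of b] \<iota>_superset[OF fin, of "a \<oplus>\<^bsub>A\<^esub> b"]
    by (simp add: add_A single_add sum.distrib)
qed

lemma \<iota>_mult: "a \<in> carrier A \<Longrightarrow> b \<in> carrier A \<Longrightarrow> \<iota> (a \<otimes>\<^bsub>A\<^esub> b) = \<iota> a * \<iota> b"
proof -
  assume *: "a \<in> carrier A" "b \<in> carrier A"
  let ?P = "supp a \<times> supp b" and ?m = "\<lambda>(h, h'). h \<otimes> h'"
  let ?t = "\<lambda>(h, h'). Poly_Mapping.single (\<phi> h) (a h) * Poly_Mapping.single (\<phi> h') (b h')"
  have fin: "finite ?P" and sub: "supp a \<subseteq> carrier \<Gamma>" "supp b \<subseteq> carrier \<Gamma>" using * by (auto simp: carrier_A)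
  have "\<iota> (a \<otimes>\<^bsub>A\<^esub> b) = (\<Sum>g\<in>?m ` ?P. Poly_Mapping.single (\<phi> g) ((a \<otimes>\<^bsub>A\<^esub> b) g))"
    using fin supp_mult by (intro \<iota>_superset) auto
  also have "\<dots> = (\<Sum>g\<in>?m ` ?P. \<Sum>x\<in>{x \<in> ?P. ?m x = g}. ?t x)"
  proof (rule sum.cong[OF HOL.refl])
    fix g
    have "{(h, h'). a h \<noteq> 0 \<and> b h' \<noteq> 0 \<and> h \<otimes> h' = g} = {x \<in> ?P. ?m x = g}" by auto
    then have "Poly_Mapping.single (\<phi> g) ((a \<otimes>\<^bsub>A\<^esub> b) g) =
        (\<Sum>x\<in>{x \<in> ?P. ?m x = g}. Poly_Mapping.single (\<phi> g) (case x of (h, h') \<Rightarrow> a h * b h'))"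
      by (simp add: mult_A single_sum)
    also have "\<dots> = (\<Sum>x\<in>{x \<in> ?P. ?m x = g}. ?t x)"
      using sub by (intro sum.cong) (auto simp: mult_single \<phi>_mult subset_iff)
    finally show "Poly_Mapping.single (\<phi> g) ((a \<otimes>\<^bsub>A\<^esub> b) g) = (\<Sum>x\<in>{x \<in> ?P. ?m x = g}. ?t x)" .
  qed
  also have "\<dots> = (\<Sum>x\<in>?P. ?t x)" using fin by (intro sum.group) auto
  also have "\<dots> = \<iota> a * \<iota> b" by (simp add: \<iota>_def sum_product sum.cartesian_product)
  finally show ?thesis .
qed

definition delta :: "'a \<Rightarrow> 'a \<Rightarrow> int" where "delta g = (\<lambda>h. of_bool (h = g))"

lemma delta_carrier: "g \<in> carrier \<Gamma> \<Longrightarrow> delta g \<in> carrier A" by (simp add: carrier_A delta_def)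

lemma \<iota>_delta: "\<iota> (delta g) = Poly_Mapping.single (\<phi> g) 1" by (simp add: \<iota>_def delta_def)

lemma \<phi>_one: "\<phi> \<one> = 0" using \<phi>_mult[of \<one> \<one>] by simp

definition j :: "('a \<Rightarrow> int) \<Rightarrow> ('c \<Rightarrow>\<^sub>0 int) fract" where "j a = to_fract (\<iota> a)"

sublocale commutative_fractions A S j
proof
  show one_S: "\<one>\<^bsub>A\<^esub> \<in> S"
    using subgroup.one_closed[OF H] by (auto simp: A_H_def carrier_A one_A zero_A fun_eq_iff)
  show S_sub: "S \<subseteq> carrier A" by (auto simp: A_H_def)
  show "j \<zero>\<^bsub>A\<^esub> = 0" by (simp add: j_def \<iota>_def zero_A)
  show "j \<one>\<^bsub>A\<^esub> = 1" using \<iota>_delta[of \<one>] by (simp add: j_def delta_def one_A \<phi>_one)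
  show inj: "inj_on j (carrier A)" using \<iota>_inj by (auto simp: inj_on_def j_def)
  show nz: "j s \<noteq> 0" if "s \<in> S" for s
    using inj_onD[OF inj, of s "\<zero>\<^bsub>A\<^esub>"] that S_sub \<open>j \<zero>\<^bsub>A\<^esub> = 0\<close> by (auto simp: carrier_A zero_A)
  show "s \<otimes>\<^bsub>A\<^esub> t \<in> S" if "s \<in> S" "t \<in> S" for s t
  proof -
    have st: "s \<in> carrier A" "t \<in> carrier A" using that S_sub by auto
    have "supp s \<subseteq> H" "supp t \<subseteq> H" using that by (auto simp only: A_H_def)
    then have "(\<lambda>(h, h'). h \<otimes> h') ` (supp s \<times> supp t) \<subseteq> H"
      using subgroup.m_closed[OF H] by (intro image_subsetI) (clarify, blast)
    then have "supp (s \<otimes>\<^bsub>A\<^esub> t) \<subseteq> H" using supp_mult[of s t] by (rule subset_trans[rotated])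
    moreover have "j (s \<otimes>\<^bsub>A\<^esub> t) \<noteq> 0"
      using nz[OF that(1)] nz[OF that(2)] st by (simp add: j_def \<iota>_mult)
    ultimately show ?thesis
      using A_mult_closed[OF st] \<open>j \<zero>\<^bsub>A\<^esub> = 0\<close> by (auto simp: A_H_def)
  qed
  show "\<exists>b\<in>carrier A. j b = - j a" if "a \<in> carrier A" for a
  proof (intro bexI[of _ "\<lambda>g. - a g"])
    show "j (\<lambda>g. - a g) = - j a" by (simp add: j_def \<iota>_def single_uminus sum_negf)
  qed (use that in \<open>simp add: carrier_A\<close>)
  show "\<zero>\<^bsub>A\<^esub> \<in> carrier A" by (simp add: carrier_A zero_A)
qed (auto simp: A_add_closed A_mult_closed j_def \<iota>_add \<iota>_mult)

definition \<rho> :: "'a \<Rightarrow> (('a \<Rightarrow> int) \<times> ('a \<Rightarrow> int)) set" where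
  "\<rho> g = right_fraction A S (delta g) \<one>\<^bsub>A\<^esub>"

lemma \<rho>_eq: "g \<in> carrier \<Gamma> \<Longrightarrow> \<rho> g = cl (j (delta g))"
  using right_fraction_eq[OF delta_carrier S_one] by (simp add: \<rho>_def j_one)

lemma \<rho>_closed: "g \<in> carrier \<Gamma> \<Longrightarrow> \<rho> g \<in> carrier R"
  by (simp add: \<rho>_eq carrier_R j_V delta_carrier)

lemma \<rho>_one: "\<rho> \<one> = \<one>\<^bsub>R\<^esub>"
  by (simp add: \<rho>_eq one_R j_def \<iota>_delta \<phi>_one)

lemma \<rho>_mult: "g \<in> carrier \<Gamma> \<Longrightarrow> h \<in> carrier \<Gamma> \<Longrightarrow> \<rho> (g \<otimes> h) = \<rho> g \<otimes>\<^bsub>R\<^esub> \<rho> h"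
  by (simp add: \<rho>_eq mult_R j_V delta_carrier) (simp add: j_def \<iota>_delta \<phi>_mult mult_single flip: to_fract_mult)

lemma \<rho>_eq_one_iff: "g \<in> carrier \<Gamma> \<Longrightarrow> \<rho> g = \<one>\<^bsub>R\<^esub> \<longleftrightarrow> g = \<one>"
proof
  assume g: "g \<in> carrier \<Gamma>" and "\<rho> g = \<one>\<^bsub>R\<^esub>"
  then have "j (delta g) = 1" using cl_inj[OF j_V[OF delta_carrier[OF g]]] by (simp add: \<rho>_eq one_R)
  moreover have "delta \<one> = \<one>\<^bsub>A\<^esub>" by (simp add: delta_def one_A)
  ultimately have "j (delta g) = j (delta \<one>)" by (simp only: j_one)
  then have "\<iota> (delta g) = \<iota> (delta \<one>)" by (simp add: j_def)
  then have "delta g = delta \<one>" using inj_onD[OF \<iota>_inj] g delta_carrier by simp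
  then have "delta g g = delta \<one> g" by simp
  then show "g = \<one>" by (simp add: delta_def)
qed (simp add: \<rho>_one)

text \<open>
  The elements that will annihilate homology classes.
\<close>

lemma one_minus_\<rho>_in_K:
  assumes "g \<in> H"
  shows "\<one>\<^bsub>R\<^esub> \<ominus>\<^bsub>R\<^esub> \<rho> g \<in> {right_fraction A S r s | r s. r \<in> A_H \<and> s \<in> S}"
proof -
  have g: "g \<in> carrier \<Gamma>" using subgroup.mem_carrier[OF H assms] .
  define a where "a = (\<lambda>h. of_bool (h = \<one>) - of_bool (h = g) :: int)"
  have sup: "supp a \<subseteq> {\<one>, g}" by (auto simp: a_def)
  then have a: "a \<in> A_H"
    using g assms subgroup.one_closed[OF H] finite_subset[OF sup] by (auto simp: A_H_def carrier_A)
  have ac: "a \<in> carrier A" using a by (simp add: A_H_def)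
  have "a \<oplus>\<^bsub>A\<^esub> delta g = \<one>\<^bsub>A\<^esub>" by (auto simp: add_A a_def delta_def one_A)
  then have "j a + j (delta g) = 1" using j_add[OF ac delta_carrier[OF g]] by (simp add: j_one)
  then have "1 - j (delta g) = j a" by (simp add: algebra_simps)
  then have "\<one>\<^bsub>R\<^esub> \<ominus>\<^bsub>R\<^esub> \<rho> g = cl (j a)"
    using g by (simp add: \<rho>_eq one_R minus_R one_V j_V delta_carrier)
  also have "\<dots> = right_fraction A S a \<one>\<^bsub>A\<^esub>" using right_fraction_eq[OF ac S_one] by (simp add: j_one)
  finally show ?thesis using a S_one by blast
qed

lemma one_in_K: "\<one>\<^bsub>R\<^esub> \<in> {right_fraction A S r s | r s. r \<in> A_H \<and> s \<in> S}"
proof -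
  have "\<one>\<^bsub>R\<^esub> = right_fraction A S \<one>\<^bsub>A\<^esub> \<one>\<^bsub>A\<^esub>" by (simp add: right_fractions_def)
  then show ?thesis using S_one by blast
qed

end

section \<open>Chains with twisted coefficients\<close>

text \<open>
  Over a commutative ring the coefficient map is the same thing as a representation of the
  fundamental group, and the chain groups are modules in which the side of the action is irrelevant.
\<close>

locale twisted_complex = R: cring R for R :: "('r, 'm) ring_scheme" (structure) +
  fixes U :: "'s::real_normed_vector set" and x0 :: 's and \<rho> :: "(real \<Rightarrow> 's) set \<Rightarrow> 'r"
  assumes connected: "path_connected U" and x0: "x0 \<in> U"
    and \<rho>_closed: "g \<in> carrier (fundamental_group U x0) \<Longrightarrow> \<rho> g \<in> carrier R"
    and \<rho>_one: "\<rho> \<one>\<^bsub>fundamental_group U x0\<^esub> = \<one>"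
    and \<rho>_mult: "\<lbrakk>g \<in> carrier (fundamental_group U x0); h \<in> carrier (fundamental_group U x0)\<rbrakk> \<Longrightarrow>
      \<rho> (g \<otimes>\<^bsub>fundamental_group U x0\<^esub> h) = \<rho> g \<otimes> \<rho> h"
begin

abbreviation "\<pi> \<equiv> fundamental_group U x0"

abbreviation "C p \<equiv> twisted_chains U R p"
abbreviation "bd p \<equiv> twisted_boundary U x0 R \<rho> p"
abbreviation "smp p \<sigma> \<equiv> singular_simplex p (top_of_set U) \<sigma>"
abbreviation "supp c \<equiv> {\<sigma>. c \<sigma> \<noteq> \<zero>}"

lemma chain_simps: "\<one>\<^bsub>C p\<^esub> = (\<lambda>\<sigma>. \<zero>)" "c \<otimes>\<^bsub>C p\<^esub> d = (\<lambda>\<sigma>. c \<sigma> \<oplus> d \<sigma>)"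
  by (simp_all add: twisted_chains_def)

lemma chain_iff: "c \<in> carrier (C p) \<longleftrightarrow> (\<forall>\<sigma>. c \<sigma> \<in> carrier R) \<and> finite (supp c) \<and> (\<forall>\<sigma>\<in>supp c. smp p \<sigma>)"
  by (auto simp: twisted_chains_def)

lemma C_closed[simp]: "c \<in> carrier (C p) \<Longrightarrow> c \<sigma> \<in> carrier R"
  by (simp add: chain_iff)

lemma comm_group_C: "comm_group (C p)"
proof (rule comm_groupI)
  fix c d assume c: "c \<in> carrier (C p)" and d: "d \<in> carrier (C p)"
  have "supp (\<lambda>\<sigma>. c \<sigma> \<oplus> d \<sigma>) \<subseteq> supp c \<union> supp d" by auto
  then show "c \<otimes>\<^bsub>C p\<^esub> d \<in> carrier (C p)"
    using c d finite_subset unfolding chain_simps chain_iff by (intro conjI) (blast intro: R.a_closed)+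
  show "c \<otimes>\<^bsub>C p\<^esub> d = d \<otimes>\<^bsub>C p\<^esub> c" using c d by (simp add: chain_simps R.a_comm)
next
  fix c assume c: "c \<in> carrier (C p)"
  have "supp (\<lambda>\<sigma>. \<ominus> c \<sigma>) = supp c" using c by auto
  then show "\<exists>d\<in>carrier (C p). d \<otimes>\<^bsub>C p\<^esub> c = \<one>\<^bsub>C p\<^esub>"
    using c by (intro bexI[of _ "\<lambda>\<sigma>. \<ominus> c \<sigma>"]) (auto simp: chain_simps R.l_neg chain_iff)
qed (auto simp: chain_simps chain_iff R.a_assoc)

definition single :: "((nat \<Rightarrow> real) \<Rightarrow> 's) \<Rightarrow> 'r \<Rightarrow> ((nat \<Rightarrow> real) \<Rightarrow> 's) \<Rightarrow> 'r" where
  "single \<sigma> r = (\<lambda>\<tau>. if \<tau> = \<sigma> then r else \<zero>)"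

lemma single_closed: "smp p \<sigma> \<Longrightarrow> r \<in> carrier R \<Longrightarrow> single \<sigma> r \<in> carrier (C p)"
  unfolding chain_iff single_def by (auto intro: finite_subset[of _ "{\<sigma>}"])

lemma single_add: "r \<in> carrier R \<Longrightarrow> r' \<in> carrier R \<Longrightarrow> single \<sigma> (r \<oplus> r') = single \<sigma> r \<otimes>\<^bsub>C p\<^esub> single \<sigma> r'"
  by (auto simp: single_def chain_simps)

lemma chain_induct[consumes 1, case_names zero add]:
  assumes "c \<in> carrier (C p)"
    and zero: "P \<one>\<^bsub>C p\<^esub>"
    and add: "\<And>c \<sigma> r. c \<in> carrier (C p) \<Longrightarrow> P c \<Longrightarrow> smp p \<sigma> \<Longrightarrow> r \<in> carrier R \<Longrightarrow> P (c \<otimes>\<^bsub>C p\<^esub> single \<sigma> r)"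
  shows "P c"
  using assms(1)
proof (induction "card (supp c)" arbitrary: c)
  case 0
  then have "supp c = {}" by (simp add: chain_iff)
  then have "c = \<one>\<^bsub>C p\<^esub>" by (auto simp: chain_simps)
  then show ?case using zero by simp
next
  case (Suc n)
  then obtain \<sigma> where \<sigma>: "\<sigma> \<in> supp c" by (metis card.empty ex_in_conv old.nat.distinct(1))
  define d where "d = c(\<sigma> := \<zero>)"
  have sd: "supp d = supp c - {\<sigma>}" by (auto simp: d_def)
  have d: "d \<in> carrier (C p)" using Suc.prems unfolding chain_iff sd by (auto simp: d_def)
  have "P d" using Suc.hyps(1)[OF _ d] Suc.hyps(2) Suc.prems \<sigma> unfolding sd by (simp add: chain_iff)
  moreover have "c = d \<otimes>\<^bsub>C p\<^esub> single \<sigma> (c \<sigma>)"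
    using Suc.prems by (auto simp: d_def chain_simps single_def)
  ultimately show ?case using add[OF d, of \<sigma> "c \<sigma>"] Suc.prems \<sigma> by (simp add: chain_iff)
qed

text \<open>
  Chains with one simplex generate, so identities between homomorphisms of chain groups are
  checked on them only.
\<close>

lemma chain_hom_eqI:
  assumes "group A" and h: "h \<in> hom (C p) A" "k \<in> hom (C p) A"
    and eq: "\<And>\<sigma> r. smp p \<sigma> \<Longrightarrow> r \<in> carrier R \<Longrightarrow> h (single \<sigma> r) = k (single \<sigma> r)"
    and c: "c \<in> carrier (C p)"
  shows "h c = k c"
proof -
  interpret C: comm_group "C p" by (rule comm_group_C)
  interpret h: group_hom "C p" A h by (intro group_hom.intro group_hom_axioms.intro C.is_group assms)
  interpret k: group_hom "C p" A k by (intro group_hom.intro group_hom_axioms.intro C.is_group assms)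
  show ?thesis
    using c
  proof (induction rule: chain_induct)
    case zero then show ?case by (simp only: h.hom_one k.hom_one)
  next
    case (add c \<sigma> r)
    then show ?case using eq h.hom_mult[of c "single \<sigma> r"] k.hom_mult[of c "single \<sigma> r"] single_closed by metis
  qed
qed

text \<open>
  The homomorphism from the free module on the simplices that is given by its restriction to
  the chains with one simplex.
\<close>

definition extend :: "('h, 'n) monoid_scheme \<Rightarrow> (((nat \<Rightarrow> real) \<Rightarrow> 's) \<Rightarrow> 'r \<Rightarrow> 'h) \<Rightarrow> (((nat \<Rightarrow> real) \<Rightarrow> 's) \<Rightarrow> 'r) \<Rightarrow> 'h" where
  "extend A f c = finprod A (\<lambda>\<sigma>. f \<sigma> (c \<sigma>)) (supp c)"

lemma
  assumes "comm_group A"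
    and closed: "\<And>\<sigma> r. smp p \<sigma> \<Longrightarrow> r \<in> carrier R \<Longrightarrow> f \<sigma> r \<in> carrier A"
    and add: "\<And>\<sigma> r r'. smp p \<sigma> \<Longrightarrow> r \<in> carrier R \<Longrightarrow> r' \<in> carrier R \<Longrightarrow> f \<sigma> (r \<oplus> r') = f \<sigma> r \<otimes>\<^bsub>A\<^esub> f \<sigma> r'"
  shows extend_hom: "extend A f \<in> hom (C p) A"
    and extend_single: "smp p \<sigma> \<Longrightarrow> r \<in> carrier R \<Longrightarrow> extend A f (single \<sigma> r) = f \<sigma> r"
proof -
  interpret A: comm_group A by fact
  have zero: "f \<sigma> \<zero> = \<one>\<^bsub>A\<^esub>" if "smp p \<sigma>" for \<sigma>
    using add[OF that, of \<zero> \<zero>] closed[OF that, of \<zero>] by simp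
  have superset: "extend A f c = finprod A (\<lambda>\<sigma>. f \<sigma> (c \<sigma>)) F"
    if "c \<in> carrier (C p)" "finite F" "supp c \<subseteq> F" "\<forall>\<sigma>\<in>F. smp p \<sigma>" for c F
    unfolding extend_def using that closed zero
    by (intro A.finprod_mono_neutral_cong_left) auto
  show "extend A f \<in> hom (C p) A"
  proof (rule homI)
    interpret C: comm_group "C p" by (rule comm_group_C)
    fix c d assume c: "c \<in> carrier (C p)" and d: "d \<in> carrier (C p)"
    show "extend A f c \<in> carrier A" using c closed unfolding extend_def chain_iff
      by (intro A.finprod_closed) auto
    have cd: "c \<otimes>\<^bsub>C p\<^esub> d \<in> carrier (C p)" using c d by simp
    let ?F = "supp c \<union> supp d"
    have F: "finite ?F" "\<forall>\<sigma>\<in>?F. smp p \<sigma>" using c d by (auto simp: chain_iff)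
    have "supp (c \<otimes>\<^bsub>C p\<^esub> d) \<subseteq> ?F" by (auto simp: chain_simps)
    then have "extend A f (c \<otimes>\<^bsub>C p\<^esub> d) = finprod A (\<lambda>\<sigma>. f \<sigma> (c \<sigma> \<oplus> d \<sigma>)) ?F"
      using superset[OF cd F(1) _ F(2)] by (simp add: chain_simps)
    also have "\<dots> = finprod A (\<lambda>\<sigma>. f \<sigma> (c \<sigma>) \<otimes>\<^bsub>A\<^esub> f \<sigma> (d \<sigma>)) ?F"
      using c d F closed add by (intro A.finprod_cong') auto
    also have "\<dots> = finprod A (\<lambda>\<sigma>. f \<sigma> (c \<sigma>)) ?F \<otimes>\<^bsub>A\<^esub> finprod A (\<lambda>\<sigma>. f \<sigma> (d \<sigma>)) ?F"
      using c d F closed by (intro A.finprod_multf) auto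
    also have "\<dots> = extend A f c \<otimes>\<^bsub>A\<^esub> extend A f d"
      using superset[OF c F(1) _ F(2)] superset[OF d F(1) _ F(2)] by simp
    finally show "extend A f (c \<otimes>\<^bsub>C p\<^esub> d) = extend A f c \<otimes>\<^bsub>A\<^esub> extend A f d" .
  qed
  show "extend A f (single \<sigma> r) = f \<sigma> r" if "smp p \<sigma>" "r \<in> carrier R"
  proof -
    have "extend A f (single \<sigma> r) = finprod A (\<lambda>\<tau>. f \<tau> (single \<sigma> r \<tau>)) {\<sigma>}"
      using that by (intro superset single_closed) (auto simp: single_def)
    then show ?thesis using closed[OF that] by (simp add: single_def)
  qed
qed

lemma base_path:
  assumes "x \<in> U"
  shows "path_from_to U x0 x (base_path U x0 x)"
proof -
  have "\<exists>p. path p \<and> path_image p \<subseteq> U \<and> pathstart p = x0 \<and> pathfinish p = x"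
    using connected x0 assms unfolding path_connected_def by blast
  then show ?thesis unfolding path_from_to_def base_path_def by (rule someI_ex)
qed

text \<open>
  The coefficient that a chain picks up when it is moved along a path. It is defined for paths
  and not only for edges of simplices because the latter are used up to homotopy.
\<close>

definition holonomy :: "(real \<Rightarrow> 's) \<Rightarrow> 'r" where
  "holonomy p = \<rho> (path_class U (base_path U x0 (pathfinish p) +++ reversepath p +++
     reversepath (base_path U x0 (pathstart p))))"

lemma base_loop: "path_from_to U x y p \<Longrightarrow>
    path_from_to U x0 x0 (base_path U x0 y +++ reversepath p +++ reversepath (base_path U x0 x))"
  using path_from_to_ends[of U x y p] base_path path_from_to_reverse path_from_to_join by metis

lemma holonomy_closed: "path_from_to U x y p \<Longrightarrow> holonomy p \<in> carrier R"
  unfolding holonomy_def using base_loop[of x y p]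
  by (intro \<rho>_closed) (auto simp: carrier_fundamental_group path_from_to_def)

lemma twist_eq_holonomy: "twist U x0 \<rho> \<sigma> = holonomy (first_edge \<sigma>)"
  by (simp add: twist_def holonomy_def)

lemma smp_compose:
  assumes \<sigma>: "smp p \<sigma>" and g: "continuous_on S (\<lambda>x i. g x i :: real)" "\<And>x. x \<in> S \<Longrightarrow> g x \<in> standard_simplex p"
  shows "continuous_on S (\<lambda>x. \<sigma> (g x))" "x \<in> S \<Longrightarrow> \<sigma> (g x) \<in> U"
proof -
  have "continuous_map (top_of_set S) (subtopology (powertop_real UNIV) (standard_simplex p)) g"
    using g by (simp add: continuous_map_in_subtopology euclidean_product_topology image_subset_iff Pi_iff)
  moreover have "continuous_map (subtopology (powertop_real UNIV) (standard_simplex p)) (top_of_set U) \<sigma>"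
    using \<sigma> by (simp add: singular_simplex_def)
  ultimately have "continuous_map (top_of_set S) (top_of_set U) (\<sigma> \<circ> g)"
    by (rule continuous_map_compose)
  then show "continuous_on S (\<lambda>x. \<sigma> (g x))" "x \<in> S \<Longrightarrow> \<sigma> (g x) \<in> U"
    by (auto simp: continuous_map_in_subtopology o_def image_subset_iff Pi_iff)
qed

lemma path_from_to_first_edge:
  assumes "smp p \<sigma>" "1 \<le> p"
  shows "path_from_to U (first_edge \<sigma> 0) (first_edge \<sigma> 1) (first_edge \<sigma>)"
proof -
  let ?g = "\<lambda>t (i::nat). if i = 0 then 1 - t else if i = 1 then t else (0::real)"
  have c: "continuous_on {0..1} (\<lambda>t. ?g t)"
  proof (rule continuous_on_coordinatewise_then_product)
    show "continuous_on {0..1} (\<lambda>t. ?g t i)" for i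
      by (cases "i = 0"; cases "i = 1") (auto intro!: continuous_intros)
  qed
  have s: "?g t \<in> standard_simplex p" if "t \<in> {0..1}" for t
  proof -
    have "(\<Sum>i\<le>p. ?g t i) = (\<Sum>i\<in>{0,1}. ?g t i)"
      using assms(2) by (intro sum.mono_neutral_right) auto
    then show ?thesis using that assms(2) by (auto simp: standard_simplex_def)
  qed
  show ?thesis
    using smp_compose[OF assms(1) c s]
    by (auto simp: path_from_to_def path_def path_image_def first_edge_def pathstart_def pathfinish_def)
qed

definition face_term :: "nat \<Rightarrow> ((nat \<Rightarrow> real) \<Rightarrow> 's) \<Rightarrow> 'r \<Rightarrow> 'r" where
  "face_term i \<sigma> r = (let a = (if i = 0 then holonomy (first_edge \<sigma>) \<otimes> r else r)
    in if even i then a else \<ominus> a)"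

lemma face_term:
  assumes "smp p \<sigma>" "1 \<le> p" "r \<in> carrier R"
  shows "face_term i \<sigma> r \<in> carrier R" "face_term i \<sigma> \<zero> = \<zero>"
    "r' \<in> carrier R \<Longrightarrow> face_term i \<sigma> (r \<oplus> r') = face_term i \<sigma> r \<oplus> face_term i \<sigma> r'"
    "r' \<in> carrier R \<Longrightarrow> face_term i \<sigma> (r \<otimes> r') = face_term i \<sigma> r \<otimes> r'"
  using holonomy_closed[OF path_from_to_first_edge[OF assms(1,2)]] assms(3)
  by (auto simp: face_term_def Let_def R.r_distr R.minus_add R.l_minus R.m_assoc)

lemma bd_superset:
  assumes c: "c \<in> carrier (C p)" and p: "1 \<le> p" and F: "finite F" "supp c \<subseteq> F" "\<forall>\<sigma>\<in>F. smp p \<sigma>"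
  shows "bd p c \<tau> = finsum R (\<lambda>(\<sigma>, i). face_term i \<sigma> (c \<sigma>)) {(\<sigma>, i). \<sigma> \<in> F \<and> i \<le> p \<and> singular_face p i \<sigma> = \<tau>}"
proof -
  have "bd p c \<tau> = finsum R (\<lambda>(\<sigma>, i). face_term i \<sigma> (c \<sigma>)) {(\<sigma>, i). c \<sigma> \<noteq> \<zero> \<and> i \<le> p \<and> singular_face p i \<sigma> = \<tau>}"
    using p unfolding twisted_boundary_def face_term_def twist_eq_holonomy by simp
  also have "\<dots> = finsum R (\<lambda>(\<sigma>, i). face_term i \<sigma> (c \<sigma>)) {(\<sigma>, i). \<sigma> \<in> F \<and> i \<le> p \<and> singular_face p i \<sigma> = \<tau>}"
  proof (rule R.add.finprod_mono_neutral_cong_left)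
    show "finite {(\<sigma>, i). \<sigma> \<in> F \<and> i \<le> p \<and> singular_face p i \<sigma> = \<tau>}"
      by (rule finite_subset[of _ "F \<times> {..p}"]) (use F in auto)
  qed (use F c p face_term in \<open>fastforce+\<close>)
  finally show ?thesis .
qed

lemma finite_faces: "finite F \<Longrightarrow> finite {(\<sigma>, i). \<sigma> \<in> F \<and> i \<le> p \<and> singular_face p i \<sigma> = \<tau>}"
  by (rule finite_subset[of _ "F \<times> {..p}"]) auto

lemma bd_closed:
  assumes c: "c \<in> carrier (C p)" and p: "1 \<le> p"
  shows "bd p c \<in> carrier (C (p - 1))"
  unfolding chain_iff
proof (intro conjI allI)
  have F: "finite (supp c)" "\<forall>\<sigma>\<in>supp c. smp p \<sigma>" using c by (auto simp: chain_iff)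
  note s = bd_superset[OF c p F(1) subset_refl F(2)]
  show "bd p c \<tau> \<in> carrier R" for \<tau>
    unfolding s using F c p face_term by (intro R.finsum_closed) auto
  have sub: "supp (bd p c) \<subseteq> (\<lambda>(\<sigma>, i). singular_face p i \<sigma>) ` (supp c \<times> {..p})"
  proof
    fix \<tau> assume "\<tau> \<in> supp (bd p c)"
    then have "{(\<sigma>, i). \<sigma> \<in> supp c \<and> i \<le> p \<and> singular_face p i \<sigma> = \<tau>} \<noteq> {}"
      unfolding mem_Collect_eq s by (metis (no_types, lifting) R.finsum_empty)
    then show "\<tau> \<in> (\<lambda>(\<sigma>, i). singular_face p i \<sigma>) ` (supp c \<times> {..p})" by force
  qed
  show "finite (supp (bd p c))" by (rule finite_subset[OF sub]) (use F in auto)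
  have "smp (p - 1) \<tau>" if "\<tau> \<in> (\<lambda>(\<sigma>, i). singular_face p i \<sigma>) ` (supp c \<times> {..p})" for \<tau>
    using that F p singular_simplex_singular_face by fastforce
  then show "\<forall>\<sigma>\<in>supp (bd p c). smp (p - 1) \<sigma>" using sub by blast
qed

lemma bd_mult:
  assumes c: "c \<in> carrier (C p)" and d: "d \<in> carrier (C p)" and p: "1 \<le> p"
  shows "bd p (c \<otimes>\<^bsub>C p\<^esub> d) = bd p c \<otimes>\<^bsub>C (p - 1)\<^esub> bd p d"
proof
  fix \<tau>
  interpret C: comm_group "C p" by (rule comm_group_C)
  let ?F = "supp c \<union> supp d"
  have F: "finite ?F" "\<forall>\<sigma>\<in>?F. smp p \<sigma>" using c d by (auto simp: chain_iff)
  define I where "I = {(\<sigma>, i). \<sigma> \<in> ?F \<and> i \<le> p \<and> singular_face p i \<sigma> = \<tau>}"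
  have I: "smp p (fst x)" if "x \<in> I" for x using that F(2) unfolding I_def by auto
  note ft = face_term[OF I p]
  have cd: "c \<otimes>\<^bsub>C p\<^esub> d \<in> carrier (C p)" using c d by simp
  have "supp (c \<otimes>\<^bsub>C p\<^esub> d) \<subseteq> ?F" by (auto simp: chain_simps)
  then have "bd p (c \<otimes>\<^bsub>C p\<^esub> d) \<tau> = finsum R (\<lambda>(\<sigma>, i). face_term i \<sigma> (c \<sigma> \<oplus> d \<sigma>)) I"
    using bd_superset[OF cd p F(1) _ F(2)] by (simp add: chain_simps I_def)
  also have "\<dots> = finsum R (\<lambda>x. (case x of (\<sigma>, i) \<Rightarrow> face_term i \<sigma> (c \<sigma>)) \<oplus> (case x of (\<sigma>, i) \<Rightarrow> face_term i \<sigma> (d \<sigma>))) I"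
    using c d ft by (intro R.finsum_cong') (auto simp: split_def)
  also have "\<dots> = finsum R (\<lambda>(\<sigma>, i). face_term i \<sigma> (c \<sigma>)) I \<oplus> finsum R (\<lambda>(\<sigma>, i). face_term i \<sigma> (d \<sigma>)) I"
    using c d ft by (intro R.finsum_addf) (auto simp: split_def)
  also have "\<dots> = bd p c \<tau> \<oplus> bd p d \<tau>"
    using bd_superset[OF c p F(1) _ F(2)] bd_superset[OF d p F(1) _ F(2)] by (simp add: I_def)
  finally show "bd p (c \<otimes>\<^bsub>C p\<^esub> d) \<tau> = (bd p c \<otimes>\<^bsub>C (p - 1)\<^esub> bd p d) \<tau>" by (simp add: chain_simps)
qed

definition scale :: "(((nat \<Rightarrow> real) \<Rightarrow> 's) \<Rightarrow> 'r) \<Rightarrow> 'r \<Rightarrow> ((nat \<Rightarrow> real) \<Rightarrow> 's) \<Rightarrow> 'r" where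
  "scale c a = (\<lambda>\<sigma>. c \<sigma> \<otimes> a)"

lemma scale_closed: "c \<in> carrier (C p) \<Longrightarrow> a \<in> carrier R \<Longrightarrow> scale c a \<in> carrier (C p)"
proof -
  assume c: "c \<in> carrier (C p)" and a: "a \<in> carrier R"
  have "supp (scale c a) \<subseteq> supp c" using a by (auto simp: scale_def)
  then show ?thesis using c a finite_subset unfolding chain_iff by (auto simp: scale_def)
qed

lemma bd_scale:
  assumes c: "c \<in> carrier (C p)" and a: "a \<in> carrier R" and p: "1 \<le> p"
  shows "bd p (scale c a) = scale (bd p c) a"
proof
  fix \<tau>
  let ?F = "supp c"
  let ?I = "{(\<sigma>, i). \<sigma> \<in> ?F \<and> i \<le> p \<and> singular_face p i \<sigma> = \<tau>}"
  have F: "finite ?F" "\<forall>\<sigma>\<in>?F. smp p \<sigma>" using c by (auto simp: chain_iff)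
  have "supp (scale c a) \<subseteq> ?F" using a by (auto simp: scale_def)
  then have "bd p (scale c a) \<tau> = finsum R (\<lambda>(\<sigma>, i). face_term i \<sigma> (c \<sigma> \<otimes> a)) ?I"
    using bd_superset[OF scale_closed[OF c a] p F(1) _ F(2)] by (simp add: scale_def)
  also have "\<dots> = finsum R (\<lambda>x. (case x of (\<sigma>, i) \<Rightarrow> face_term i \<sigma> (c \<sigma>)) \<otimes> a) ?I"
    using F c a p face_term by (intro R.finsum_cong') auto
  also have "\<dots> = finsum R (\<lambda>(\<sigma>, i). face_term i \<sigma> (c \<sigma>)) ?I \<otimes> a"
    using finite_faces[OF F(1)] F c a p face_term by (intro R.finsum_ldistr[symmetric]) auto
  also have "\<dots> = bd p c \<tau> \<otimes> a"
    using bd_superset[OF c p F(1) _ F(2)] by simp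
  finally show "bd p (scale c a) \<tau> = scale (bd p c) a \<tau>" by (simp add: scale_def)
qed

lemma bd_hom: "1 \<le> p \<Longrightarrow> bd p \<in> hom (C p) (C (p - 1))"
  by (intro homI bd_closed bd_mult)

lemma bd1_single:
  assumes "smp 1 \<sigma>" "r \<in> carrier R"
  shows "bd 1 (single \<sigma> r) = single (singular_face 1 0 \<sigma>) (holonomy (first_edge \<sigma>) \<otimes> r) \<otimes>\<^bsub>C 0\<^esub>
    single (singular_face 1 1 \<sigma>) (\<ominus> r)"
proof
  fix \<tau>
  note ft = face_term[OF assms(1) order_refl assms(2)]
  have h: "holonomy (first_edge \<sigma>) \<in> carrier R" by (rule holonomy_closed[OF path_from_to_first_edge[OF assms(1) order_refl]])
  let ?J = "{i. i \<le> 1 \<and> singular_face 1 i \<sigma> = \<tau>}"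
  have "bd 1 (single \<sigma> r) \<tau> = finsum R (\<lambda>(\<sigma>', i). face_term i \<sigma>' (single \<sigma> r \<sigma>')) {(\<sigma>', i). \<sigma>' \<in> {\<sigma>} \<and> i \<le> 1 \<and> singular_face 1 i \<sigma>' = \<tau>}"
    using assms by (intro bd_superset single_closed) (auto simp: single_def)
  also have "{(\<sigma>', i). \<sigma>' \<in> {\<sigma>} \<and> i \<le> 1 \<and> singular_face 1 i \<sigma>' = \<tau>} = Pair \<sigma> ` ?J" by auto
  also have "finsum R (\<lambda>(\<sigma>', i). face_term i \<sigma>' (single \<sigma> r \<sigma>')) (Pair \<sigma> ` ?J) = finsum R (\<lambda>i. face_term i \<sigma> r) ?J"
    using ft by (subst R.finsum_reindex) (auto simp: inj_on_def single_def)
  also have "\<dots> = finsum R (\<lambda>i. if singular_face 1 i \<sigma> = \<tau> then face_term i \<sigma> r else \<zero>) {..1}"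
    by (rule R.add.finprod_mono_neutral_cong_left) (use ft in auto)
  also have "\<dots> = (single (singular_face 1 0 \<sigma>) (holonomy (first_edge \<sigma>) \<otimes> r) \<otimes>\<^bsub>C 0\<^esub>
    single (singular_face 1 1 \<sigma>) (\<ominus> r)) \<tau>"
    using ft assms h by (auto simp: chain_simps single_def atMost_Suc face_term_def R.a_comm)
  finally show "bd 1 (single \<sigma> r) \<tau> = \<dots>" .
qed

lemma bd2_single:
  assumes "smp 2 \<sigma>" "r \<in> carrier R"
  shows "bd 2 (single \<sigma> r) = single (singular_face 2 0 \<sigma>) (holonomy (first_edge \<sigma>) \<otimes> r) \<otimes>\<^bsub>C 1\<^esub>
    (single (singular_face 2 1 \<sigma>) (\<ominus> r) \<otimes>\<^bsub>C 1\<^esub> single (singular_face 2 2 \<sigma>) r)"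
proof
  fix \<tau>
  have 12: "1 \<le> (2::nat)" by simp
  note ft = face_term[OF assms(1) 12 assms(2)]
  have h: "holonomy (first_edge \<sigma>) \<in> carrier R" by (rule holonomy_closed[OF path_from_to_first_edge[OF assms(1) 12]])
  let ?J = "{i. i \<le> 2 \<and> singular_face 2 i \<sigma> = \<tau>}"
  have "bd 2 (single \<sigma> r) \<tau> = finsum R (\<lambda>(\<sigma>', i). face_term i \<sigma>' (single \<sigma> r \<sigma>')) {(\<sigma>', i). \<sigma>' \<in> {\<sigma>} \<and> i \<le> 2 \<and> singular_face 2 i \<sigma>' = \<tau>}"
    using assms by (intro bd_superset single_closed) (auto simp: single_def)
  also have "{(\<sigma>', i). \<sigma>' \<in> {\<sigma>} \<and> i \<le> 2 \<and> singular_face 2 i \<sigma>' = \<tau>} = Pair \<sigma> ` ?J" by auto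
  also have "finsum R (\<lambda>(\<sigma>', i). face_term i \<sigma>' (single \<sigma> r \<sigma>')) (Pair \<sigma> ` ?J) = finsum R (\<lambda>i. face_term i \<sigma> r) ?J"
    using ft by (subst R.finsum_reindex) (auto simp: inj_on_def single_def)
  also have "\<dots> = finsum R (\<lambda>i. if singular_face 2 i \<sigma> = \<tau> then face_term i \<sigma> r else \<zero>) {..2}"
    by (rule R.add.finprod_mono_neutral_cong_left) (use ft in auto)
  also have "\<dots> = (single (singular_face 2 0 \<sigma>) (holonomy (first_edge \<sigma>) \<otimes> r) \<otimes>\<^bsub>C 1\<^esub>
    (single (singular_face 2 1 \<sigma>) (\<ominus> r) \<otimes>\<^bsub>C 1\<^esub> single (singular_face 2 2 \<sigma>) r)) \<tau>"
    using ft assms h by (auto simp: chain_simps single_def numeral_2_eq_2 atMost_Suc face_term_def R.a_ac)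
  finally show "bd 2 (single \<sigma> r) \<tau> = \<dots>" .
qed

abbreviation "B \<equiv> twisted_boundaries U x0 R \<rho> 1"

lemma B_def': "B = bd 2 ` carrier (C 2)"
  by (simp add: twisted_boundaries_def numeral_2_eq_2)

lemma B_subgroup: "subgroup B (C 1)"
proof -
  have "bd 2 \<in> hom (C 2) (C 1)" using bd_hom[of 2] by simp
  then interpret group_hom "C 2" "C 1" "bd 2"
    by (intro group_hom.intro group_hom_axioms.intro comm_group.axioms(2)[OF comm_group_C])
  show ?thesis unfolding B_def' by (rule subgroup_img_is_subgroup[OF G.subgroup_self])
qed

lemma B_scale: "b \<in> B \<Longrightarrow> a \<in> carrier R \<Longrightarrow> scale b a \<in> B"
  unfolding B_def' using bd_scale scale_closed by (auto simp flip: bd_scale)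

end

section \<open>Classes of paths modulo boundaries\<close>

context twisted_complex
begin

definition path_simplex :: "(real \<Rightarrow> 's) \<Rightarrow> (nat \<Rightarrow> real) \<Rightarrow> 's" where
  "path_simplex p = restrict (\<lambda>x. p (x 1)) (standard_simplex 1)"

lemma continuous_on_coordinate: "continuous_on S (\<lambda>x::nat \<Rightarrow> real. x i)"
  by (rule continuous_on_product_then_coordinatewise) (rule continuous_on_id)

lemma smp_iff: "smp p \<sigma> \<longleftrightarrow>
    continuous_on (standard_simplex p) \<sigma> \<and> \<sigma> ` standard_simplex p \<subseteq> U \<and> \<sigma> \<in> extensional (standard_simplex p)"
  by (auto simp: singular_simplex_def euclidean_product_topology continuous_map_in_subtopology)

lemma smp_path_simplex:
  assumes "path_from_to U x y p"
  shows "smp 1 (path_simplex p)"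
proof -
  have 01: "x 1 \<in> {0..1}" if "x \<in> standard_simplex 1" for x
    using that by (auto simp: standard_simplex_def)
  have "continuous_on (standard_simplex 1) (\<lambda>x. p (x 1))"
    by (rule continuous_on_compose2[of "{0..1}" p, OF _ continuous_on_coordinate])
      (use assms 01 in \<open>auto simp: path_from_to_def path_def\<close>)
  then have "continuous_on (standard_simplex 1) (path_simplex p)"
    by (rule continuous_on_eq) (simp add: path_simplex_def)
  moreover have "path_simplex p ` standard_simplex 1 \<subseteq> U"
  proof (rule image_subsetI)
    fix x :: "nat \<Rightarrow> real" assume x: "x \<in> standard_simplex 1"
    then have "path_simplex p x \<in> path_image p" using 01[OF x] by (simp add: path_simplex_def path_image_def)
    then show "path_simplex p x \<in> U" using assms by (auto simp: path_from_to_def)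
  qed
  ultimately show ?thesis by (simp add: smp_iff path_simplex_def)
qed

lemma path_simplex_first_edge:
  assumes "smp 1 \<sigma>"
  shows "path_simplex (first_edge \<sigma>) = \<sigma>"
proof (rule extensionalityI)
  show "path_simplex (first_edge \<sigma>) \<in> extensional (standard_simplex 1)" by (simp add: path_simplex_def)
  show "\<sigma> \<in> extensional (standard_simplex 1)" using assms by (simp add: smp_iff)
  fix x assume x: "x \<in> standard_simplex 1"
  have "(\<lambda>i. if i = 0 then 1 - x 1 else if i = 1 then x 1 else 0) = x"
    using x by (auto simp: standard_simplex_def fun_eq_iff atMost_Suc)
  then show "path_simplex (first_edge \<sigma>) x = \<sigma> x" using x by (simp add: path_simplex_def first_edge_def del: One_nat_def)
qed

lemma holonomy_homotopic:
  assumes p: "path_from_to U x y p" and h: "homotopic_paths U p q"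
  shows "holonomy p = holonomy q"
proof -
  note q = path_from_to_homotopic[OF p h]
  have xy: "x \<in> U" "y \<in> U" using path_from_to_ends[OF p] by auto
  have ends: "pathstart p = x" "pathfinish p = y" "pathstart q = x" "pathfinish q = y"
    using p q by (auto simp: path_from_to_def)
  have c: "path_class U (reversepath p) = path_class U (reversepath q)"
    using h by (intro path_class_eqI) (simp add: homotopic_paths_reversepath)
  note rx = path_from_to_reverse[OF base_path[OF xy(1)]]
  note rp = path_from_to_reverse[OF p] and rq = path_from_to_reverse[OF q]
  show ?thesis unfolding holonomy_def ends
    by (intro arg_cong[of _ _ \<rho>] path_class_join_cong[OF base_path[OF xy(2)] path_from_to_join[OF rp rx]]
       path_class_join_cong[OF rp rx] c HOL.refl base_path xy rx rq path_from_to_join[OF rq rx])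
qed

lemma holonomy_cong:
  assumes "path_from_to U x y p" "\<And>t. t \<in> {0..1} \<Longrightarrow> p t = q t"
  shows "holonomy p = holonomy q"
  using assms by (intro holonomy_homotopic[OF assms(1)] homotopic_paths_eq) (auto simp: path_from_to_def)

definition "Q1 = C 1 Mod B"

lemma comm_group_Q1: "comm_group Q1"
  unfolding Q1_def by (rule comm_group.abelian_FactGroup[OF comm_group_C B_subgroup])

sublocale Q1: comm_group Q1 by (rule comm_group_Q1)

sublocale C1: comm_group "C 1" by (rule comm_group_C)

text \<open>
  The class, modulo boundaries, of a path with coefficient \<open>r\<close>. It behaves as a crossed
  homomorphism on the fundamental groupoid.
\<close>

definition E :: "(real \<Rightarrow> 's) \<Rightarrow> 'r \<Rightarrow> (((nat \<Rightarrow> real) \<Rightarrow> 's) \<Rightarrow> 'r) set" where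
  "E p r = B #>\<^bsub>C 1\<^esub> single (path_simplex p) r"

lemma B_normal: "B \<lhd> C 1" by (rule C1.subgroup_imp_normal[OF B_subgroup])

lemma quotient_hom: "(\<lambda>c. B #>\<^bsub>C 1\<^esub> c) \<in> hom (C 1) Q1"
  unfolding Q1_def by (rule normal.r_coset_hom_Mod[OF B_normal])

lemma E_closed: "path_from_to U x y p \<Longrightarrow> r \<in> carrier R \<Longrightarrow> E p r \<in> carrier Q1"
  unfolding E_def using single_closed smp_path_simplex by (auto simp: carrier_FactGroup Q1_def)

lemma E_add: "path_from_to U x y p \<Longrightarrow> r \<in> carrier R \<Longrightarrow> r' \<in> carrier R \<Longrightarrow>
    E p (r \<oplus> r') = E p r \<otimes>\<^bsub>Q1\<^esub> E p r'"
  unfolding E_def single_add[of r r' _ 1]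
  by (intro hom_mult[OF quotient_hom] single_closed smp_path_simplex)

lemma E_zero: "path_from_to U x y p \<Longrightarrow> E p \<zero> = \<one>\<^bsub>Q1\<^esub>"
  using E_add[of x y p \<zero> \<zero>] E_closed[of x y p \<zero>] by simp

lemma E_minus: "path_from_to U x y p \<Longrightarrow> r \<in> carrier R \<Longrightarrow> E p (\<ominus> r) = inv\<^bsub>Q1\<^esub> E p r"
  using E_add[of x y p "\<ominus> r" r] E_closed[of x y p] E_zero[of x y p]
  by (intro Q1.inv_equality[symmetric]) (auto simp: R.l_neg)

definition triangle :: "(real \<times> real) set" where
  "triangle = {(a, b). 0 \<le> a \<and> 0 \<le> b \<and> a + b \<le> 1}"

text \<open>
  The boundary of a singular triangle given in affine coordinates \<open>(a, b)\<close>, its vertices being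
  \<open>(0, 0)\<close>, \<open>(1, 0)\<close> and \<open>(0, 1)\<close>. All relations between classes of paths come from this one.
\<close>

lemma triangle_relation:
  assumes F: "continuous_on triangle (\<lambda>(a, b). F a b)" and U: "\<And>a b. (a, b) \<in> triangle \<Longrightarrow> F a b \<in> U"
    and p: "\<And>t. t \<in> {0..1} \<Longrightarrow> F t 0 = p t" and q: "\<And>t. t \<in> {0..1} \<Longrightarrow> F (1 - t) t = q t"
    and w: "\<And>t. t \<in> {0..1} \<Longrightarrow> F 0 t = w t"
    and pp: "path_from_to U x y p" and qq: "path_from_to U y z q" and ww: "path_from_to U x z w"
    and r: "r \<in> carrier R"
  shows "E w r = E p r \<otimes>\<^bsub>Q1\<^esub> E q (holonomy p \<otimes> r)"
proof -
  define \<sigma> where "\<sigma> = restrict (\<lambda>x. F (x 1) (x 2)) (standard_simplex 2)"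
  have tri: "(x 1, x 2) \<in> triangle" if "x \<in> standard_simplex 2" for x
    using that by (auto simp: standard_simplex_def triangle_def numeral_2_eq_2 atMost_Suc add_ac)
       (metis add.commute add.left_commute le_add_same_cancel1)
  have "continuous_on (standard_simplex 2) (\<lambda>x. (\<lambda>(a, b). F a b) (x 1, x 2))"
    using tri by (intro continuous_on_compose2[OF F] continuous_on_Pair continuous_on_coordinate) auto
  then have "continuous_on (standard_simplex 2) \<sigma>"
    by (rule continuous_on_eq) (simp add: \<sigma>_def)
  then have \<sigma>: "smp 2 \<sigma>" using tri U by (auto simp: smp_iff \<sigma>_def)
  have face_in: "simplical_face k x \<in> standard_simplex 2" if "x \<in> standard_simplex 1" "k \<le> 2" for k x
    using simplical_face_in_standard_simplex[of 2 k x] that by (simp add: numeral_2_eq_2)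
  have x0: "x 0 = 1 - x 1" "x 1 \<in> {0..1}" if "x \<in> standard_simplex 1" for x
    using that by (auto simp: standard_simplex_def atMost_Suc)
  have 21: "2 - Suc 0 = 1" by simp
  have f0: "singular_face 2 0 \<sigma> = path_simplex q"
    unfolding singular_face_def path_simplex_def 21
  proof (rule restrict_ext)
    fix x :: "nat \<Rightarrow> real" assume x: "x \<in> standard_simplex 1"
    show "(\<sigma> \<circ> simplical_face 0) x = q (x 1)"
      using q[OF x0(2)[OF x]] x0(1)[OF x] face_in[OF x, of 0] by (simp add: \<sigma>_def simplical_face_def)
  qed
  have f1: "singular_face 2 1 \<sigma> = path_simplex w"
    unfolding singular_face_def path_simplex_def 21
    by (rule restrict_ext) (use face_in[of _ 1] x0 w in \<open>simp_all add: \<sigma>_def simplical_face_def\<close>)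
  have f2: "singular_face 2 2 \<sigma> = path_simplex p"
    unfolding singular_face_def path_simplex_def 21
    by (rule restrict_ext) (use face_in[of _ 2] x0 p in \<open>simp_all add: \<sigma>_def simplical_face_def\<close>)
  have fe: "first_edge \<sigma> t = p t" if "t \<in> {0..1}" for t
  proof -
    have "(\<lambda>i::nat. if i = 0 then 1 - t else if i = 1 then t else 0) \<in> standard_simplex 2"
      using that by (auto simp: standard_simplex_def numeral_2_eq_2 atMost_Suc)
    then show ?thesis using p[OF that] by (simp add: first_edge_def \<sigma>_def)
  qed
  have h: "holonomy (first_edge \<sigma>) = holonomy p"
    by (rule holonomy_cong[OF pp, symmetric]) (simp add: fe)
  have hc: "holonomy p \<otimes> r \<in> carrier R" using holonomy_closed[OF pp] r by simp
  have e: "bd 2 (single \<sigma> r) = single (path_simplex q) (holonomy p \<otimes> r) \<otimes>\<^bsub>C 1\<^esub>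
      (single (path_simplex w) (\<ominus> r) \<otimes>\<^bsub>C 1\<^esub> single (path_simplex p) r)"
    using bd2_single[OF \<sigma> r] by (simp only: f0 f1 f2 h)
  have mr: "\<ominus> r \<in> carrier R" using r by simp
  note sc = single_closed[OF smp_path_simplex[OF pp] r] single_closed[OF smp_path_simplex[OF ww] mr]
    single_closed[OF smp_path_simplex[OF qq] hc]
  have "bd 2 (single \<sigma> r) \<in> B" unfolding B_def' using single_closed[OF \<sigma> r] by blast
  then have "B #>\<^bsub>C 1\<^esub> bd 2 (single \<sigma> r) = \<one>\<^bsub>Q1\<^esub>"
    using B_subgroup C1.coset_join2[of "bd 2 (single \<sigma> r)" B] subgroup.mem_carrier[OF B_subgroup]
    by (simp add: Q1_def)
  then have "E q (holonomy p \<otimes> r) \<otimes>\<^bsub>Q1\<^esub> (E w (\<ominus> r) \<otimes>\<^bsub>Q1\<^esub> E p r) = \<one>\<^bsub>Q1\<^esub>"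
    unfolding e E_def using sc
    by (simp only: hom_mult[OF quotient_hom, symmetric] C1.m_closed)
  then have "E w (\<ominus> r) \<otimes>\<^bsub>Q1\<^esub> (E p r \<otimes>\<^bsub>Q1\<^esub> E q (holonomy p \<otimes> r)) = \<one>\<^bsub>Q1\<^esub>"
    using E_closed[OF pp r] E_closed[OF qq hc] E_closed[OF ww mr]
    by (simp only: Q1.m_ac Q1.m_closed)
  then have "inv\<^bsub>Q1\<^esub> (E w r) \<otimes>\<^bsub>Q1\<^esub> (E p r \<otimes>\<^bsub>Q1\<^esub> E q (holonomy p \<otimes> r)) = \<one>\<^bsub>Q1\<^esub>"
    by (simp only: E_minus[OF ww r])
  then have "inv\<^bsub>Q1\<^esub> (inv\<^bsub>Q1\<^esub> (E w r)) = E p r \<otimes>\<^bsub>Q1\<^esub> E q (holonomy p \<otimes> r)"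
    using E_closed[OF pp r] E_closed[OF qq hc] E_closed[OF ww r]
    by (intro Q1.inv_equality[OF _ Q1.inv_closed]) (simp_all only: Q1.m_comm Q1.m_closed Q1.inv_closed)
  then show ?thesis using Q1.inv_inv[OF E_closed[OF ww r]] by simp
qed

lemma holonomy_const: "x \<in> U \<Longrightarrow> holonomy (\<lambda>_. x) = \<one>"
proof -
  assume x: "x \<in> U"
  have b: "path_from_to U x0 x (base_path U x0 x)" using base_path[OF x] .
  have "path_class U (base_path U x0 x +++ (\<lambda>_. x) +++ reversepath (base_path U x0 x)) = path_class U (\<lambda>_. x0)"
    using path_class_join_cong[OF b path_from_to_join[OF path_from_to_const[OF x] path_from_to_reverse[OF b]] HOL.refl
        path_class_lid[OF path_from_to_reverse[OF b]] b path_from_to_reverse[OF b]] path_class_rinv[OF b] by simp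
  moreover have "reversepath (\<lambda>_. x) = (\<lambda>_. x)" by (auto simp: reversepath_def)
  ultimately show ?thesis using \<rho>_one
    by (simp add: holonomy_def pathstart_def pathfinish_def one_fundamental_group)
qed

lemma E_const:
  assumes x: "x \<in> U" and r: "r \<in> carrier R"
  shows "E (\<lambda>_. x) r = \<one>\<^bsub>Q1\<^esub>"
proof -
  note c = path_from_to_const[OF x]
  have "E (\<lambda>_. x) r = E (\<lambda>_. x) r \<otimes>\<^bsub>Q1\<^esub> E (\<lambda>_. x) (holonomy (\<lambda>_. x) \<otimes> r)"
    by (rule triangle_relation[where F = "\<lambda>_ _. x", OF _ _ _ _ _ c c c r]) (auto simp: x case_prod_unfold)
  then show ?thesis
    using E_closed[OF c r] r holonomy_const[OF x] by simp
qed

text \<open>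
  The square of a homotopy is cut along its diagonal into two triangles, each with one constant edge.
\<close>

lemma E_homotopic:
  assumes p: "path_from_to U x y p" and h: "homotopic_paths U p q" and r: "r \<in> carrier R"
  shows "E p r = E q r"
proof -
  note q = path_from_to_homotopic[OF p h]
  have xy: "x \<in> U" "y \<in> U" using path_from_to_ends[OF p] by auto
  obtain k :: "real \<times> real \<Rightarrow> 's" where k: "continuous_on ({0..1} \<times> {0..1}) k" "k \<in> {0..1} \<times> {0..1} \<rightarrow> U"
    and k01: "\<forall>t\<in>{0..1}. k (0, t) = p t" "\<forall>t\<in>{0..1}. k (1, t) = q t"
    and ends: "\<forall>s\<in>{0..1}. pathstart (k \<circ> Pair s) = pathstart p \<and> pathfinish (k \<circ> Pair s) = pathfinish p"
    using h unfolding homotopic_paths by (elim exE conjE) (rule that, assumption+)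
  have k': "k (s, 0) = x" "k (s, 1) = y" if "s \<in> {0..1}" for s
    using bspec[OF ends that] p by (auto simp: pathstart_def pathfinish_def path_from_to_def)
  note k = k k' bspec[OF k01(1)] bspec[OF k01(2)]
  define d where "d = (\<lambda>t. k (t, t))"
  have d: "path_from_to U x y d"
  proof -
    have "continuous_on {0..1} d" unfolding d_def
      by (rule continuous_on_compose2[OF k(1)]) (auto intro!: continuous_intros)
    then show ?thesis using k
      by (auto simp: path_from_to_def path_def path_image_def pathstart_def pathfinish_def d_def)
  qed
  \<comment> \<open>The triangle above the diagonal has the edges \<open>p\<close>, constant and \<open>d\<close>.\<close>
  have "E d r = E p r \<otimes>\<^bsub>Q1\<^esub> E (\<lambda>_. y) (holonomy p \<otimes> r)"
  proof (rule triangle_relation[where F = "\<lambda>a b. k (b, a + b)", OF _ _ _ _ _ p path_from_to_const[OF xy(2)] d r])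
    have "continuous_on triangle (\<lambda>x. k (snd x, fst x + snd x))"
      by (rule continuous_on_compose2[OF k(1)]) (auto intro!: continuous_intros simp: triangle_def)
    then show "continuous_on triangle (\<lambda>(a, b). k (b, a + b))" by (simp add: case_prod_unfold)
  qed (use k in \<open>auto simp: triangle_def d_def\<close>)
  \<comment> \<open>The triangle below the diagonal has the edges constant, \<open>q\<close> and \<open>d\<close>.\<close>
  moreover have "E d r = E (\<lambda>_. x) r \<otimes>\<^bsub>Q1\<^esub> E q (holonomy (\<lambda>_. x) \<otimes> r)"
  proof (rule triangle_relation[where F = "\<lambda>a b. k (a + b, b)", OF _ _ _ _ _ path_from_to_const[OF xy(1)] q d r])
    have "continuous_on triangle (\<lambda>x. k (fst x + snd x, snd x))"
      by (rule continuous_on_compose2[OF k(1)]) (auto intro!: continuous_intros simp: triangle_def)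
    then show "continuous_on triangle (\<lambda>(a, b). k (a + b, b))" by (simp add: case_prod_unfold)
  qed (use k in \<open>auto simp: triangle_def d_def\<close>)
  ultimately show ?thesis
    using E_const xy r holonomy_closed[OF p] E_closed[OF p r] E_closed[OF q r] holonomy_const[OF xy(1)]
    by simp
qed

text \<open>
  The triangle is mapped to the joined path by a projection that sends its vertices to the
  parameters \<open>0\<close>, \<open>1/2\<close> and \<open>1\<close>.
\<close>

lemma E_join:
  assumes p: "path_from_to U x y p" and q: "path_from_to U y z q" and r: "r \<in> carrier R"
  shows "E (p +++ q) r = E p r \<otimes>\<^bsub>Q1\<^esub> E q (holonomy p \<otimes> r)"
proof (rule triangle_relation[where F = "\<lambda>a b. (p +++ q) (b + a / 2)", OF _ _ _ _ _ p q path_from_to_join[OF p q] r])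
  have "continuous_on {0..1} (p +++ q)" "(p +++ q) ` {0..1} \<subseteq> U"
    using path_from_to_join[OF p q] by (auto simp: path_from_to_def path_def path_image_def)
  moreover have tri: "b + a / 2 \<in> {0..1}" if "(a, b) \<in> triangle" for a b
    using that by (auto simp: triangle_def)
  ultimately show "(p +++ q) (b + a / 2) \<in> U" if "(a, b) \<in> triangle" for a b
    using that by blast
  have "continuous_on triangle (\<lambda>x. (p +++ q) (snd x + fst x / 2))"
    using tri by (intro continuous_on_compose2[OF \<open>continuous_on {0..1} (p +++ q)\<close>] continuous_intros) auto
  then show "continuous_on triangle (\<lambda>(a, b). (p +++ q) (b + a / 2))" by (simp add: case_prod_unfold)
  show "(p +++ q) (0 + t / 2) = p t" if "t \<in> {0..1}" for t
    using that by (simp add: joinpaths_def)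
  show "(p +++ q) (t + (1 - t) / 2) = q t" if "t \<in> {0..1}" for t
  proof (cases "t = 0")
    case True then show ?thesis using p q by (simp add: joinpaths_def path_from_to_def pathstart_def pathfinish_def)
  next
    case False then show ?thesis using that by (simp add: joinpaths_def field_simps)
  qed
qed simp

end

section \<open>Cycles and perfect commutator subgroups\<close>

lemma (in twisted_complex) scale_hom: "a \<in> carrier R \<Longrightarrow> (\<lambda>c. scale c a) \<in> hom (C p) (C p)"
  by (intro homI scale_closed) (auto simp: scale_def chain_simps R.l_distr)

text \<open>
  If the commutator subgroup is perfect, a crossed homomorphism on the fundamental group is a
  homomorphism on the commutator subgroup, where the action is trivial, and hence vanishes there.
  So everything is controlled by the abelianization.
\<close>

locale perfect_twisted_complex = twisted_complex R U x0 \<rho>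
  for R :: "('r, 'm) ring_scheme" (structure) and U :: "'s::real_normed_vector set" and x0 \<rho> +
  assumes perfect: "derived \<pi> (derived \<pi> (carrier \<pi>)) = derived \<pi> (carrier \<pi>)"
begin

sublocale \<pi>: group \<pi> by (rule group_fundamental_group[OF x0])

abbreviation "N \<equiv> derived \<pi> (carrier \<pi>)"

lemma N_carrier: "n \<in> N \<Longrightarrow> n \<in> carrier \<pi>"
  using \<pi>.derived_in_carrier[OF subset_refl] by blast

definition \<tau> :: "(real \<Rightarrow> 's) set \<Rightarrow> 'r" where "\<tau> g = \<rho> (inv\<^bsub>\<pi>\<^esub> g)"

lemma \<tau>_closed[simp]: "g \<in> carrier \<pi> \<Longrightarrow> \<tau> g \<in> carrier R"
  by (simp add: \<tau>_def \<rho>_closed)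

lemma \<tau>_mult: "g \<in> carrier \<pi> \<Longrightarrow> h \<in> carrier \<pi> \<Longrightarrow> \<tau> (g \<otimes>\<^bsub>\<pi>\<^esub> h) = \<tau> g \<otimes> \<tau> h"
  by (simp add: \<tau>_def \<pi>.inv_mult_group \<rho>_mult \<rho>_closed R.m_comm)

lemma \<tau>_one: "\<tau> \<one>\<^bsub>\<pi>\<^esub> = \<one>" by (simp add: \<tau>_def \<rho>_one)

lemma \<tau>_inv: "g \<in> carrier \<pi> \<Longrightarrow> \<tau> (inv\<^bsub>\<pi>\<^esub> g) \<otimes> \<tau> g = \<one>"
  using \<tau>_mult[of "inv\<^bsub>\<pi>\<^esub> g" g] by (simp add: \<tau>_one)

lemma \<tau>_N: "n \<in> N \<Longrightarrow> \<tau> n = \<one>"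
  unfolding derived_def
proof (induction rule: generate.induct)
  case (incl h)
  then obtain x y where xy: "x \<in> carrier \<pi>" "y \<in> carrier \<pi>"
    "h = x \<otimes>\<^bsub>\<pi>\<^esub> y \<otimes>\<^bsub>\<pi>\<^esub> inv\<^bsub>\<pi>\<^esub> x \<otimes>\<^bsub>\<pi>\<^esub> inv\<^bsub>\<pi>\<^esub> y" by auto
  then have "\<tau> h = (\<tau> (inv\<^bsub>\<pi>\<^esub> x) \<otimes> \<tau> x) \<otimes> (\<tau> (inv\<^bsub>\<pi>\<^esub> y) \<otimes> \<tau> y)"
    by (simp add: \<tau>_mult R.m_ac)
  then show ?case using xy by (simp add: \<tau>_inv)
next
  case (inv h)
  then obtain x y where xy: "x \<in> carrier \<pi>" "y \<in> carrier \<pi>"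
    "h = x \<otimes>\<^bsub>\<pi>\<^esub> y \<otimes>\<^bsub>\<pi>\<^esub> inv\<^bsub>\<pi>\<^esub> x \<otimes>\<^bsub>\<pi>\<^esub> inv\<^bsub>\<pi>\<^esub> y" by auto
  then have "\<tau> (inv\<^bsub>\<pi>\<^esub> h) = (\<tau> (inv\<^bsub>\<pi>\<^esub> x) \<otimes> \<tau> x) \<otimes> (\<tau> (inv\<^bsub>\<pi>\<^esub> y) \<otimes> \<tau> y)"
    by (simp add: \<tau>_mult R.m_ac \<pi>.inv_mult_group)
  then show ?case using xy by (simp add: \<tau>_inv)
next
  case (eng h1 h2)
  moreover have "h1 \<in> carrier \<pi>" "h2 \<in> carrier \<pi>"
    using N_carrier[unfolded derived_def] eng.hyps by blast+
  ultimately show ?case by (simp add: \<tau>_mult)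
qed (simp add: \<tau>_one)

text \<open>
  The crossed homomorphism \<open>E\<close> on the elements of the fundamental group.
\<close>

definition EG :: "(real \<Rightarrow> 's) set \<Rightarrow> 'r \<Rightarrow> (((nat \<Rightarrow> real) \<Rightarrow> 's) \<Rightarrow> 'r) set" where
  "EG g r = E (SOME p. path_from_to U x0 x0 p \<and> path_class U p = g) r"

lemma EG_path_class:
  assumes p: "path_from_to U x0 x0 p" and r: "r \<in> carrier R"
  shows "EG (path_class U p) r = E p r"
proof -
  define q where "q = (SOME q. path_from_to U x0 x0 q \<and> path_class U q = path_class U p)"
  have q: "path_from_to U x0 x0 q \<and> path_class U q = path_class U p"
    unfolding q_def by (rule someI[of _ p]) (simp add: p)
  then have "homotopic_paths U q p" using path_class_eqD[OF p] by auto
  then have "E q r = E p r" using q r by (intro E_homotopic) auto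
  then show ?thesis by (simp add: EG_def q_def)
qed

lemma loop_representative:
  assumes "g \<in> carrier \<pi>"
  obtains p where "path_from_to U x0 x0 p" "g = path_class U p"
  using assms by (auto simp: carrier_fundamental_group)

lemma EG_closed[simp]: "g \<in> carrier \<pi> \<Longrightarrow> r \<in> carrier R \<Longrightarrow> EG g r \<in> carrier Q1"
  by (elim loop_representative) (simp add: EG_path_class E_closed)

lemma EG_add: "g \<in> carrier \<pi> \<Longrightarrow> r \<in> carrier R \<Longrightarrow> r' \<in> carrier R \<Longrightarrow>
    EG g (r \<oplus> r') = EG g r \<otimes>\<^bsub>Q1\<^esub> EG g r'"
  by (elim loop_representative) (simp add: EG_path_class E_add)

lemma EG_zero: "g \<in> carrier \<pi> \<Longrightarrow> EG g \<zero> = \<one>\<^bsub>Q1\<^esub>"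
  by (elim loop_representative) (simp add: EG_path_class E_zero)

lemma EG_minus: "g \<in> carrier \<pi> \<Longrightarrow> r \<in> carrier R \<Longrightarrow> EG g (\<ominus> r) = inv\<^bsub>Q1\<^esub> EG g r"
  by (elim loop_representative) (simp add: EG_path_class E_minus)

abbreviation "b0 \<equiv> base_path U x0 x0"
text \<open>
  The chosen path from \<open>x0\<close> to itself may be any loop. The factor \<open>\<beta>\<close> accounts for it.
\<close>

definition "\<beta> = \<rho> (path_class U b0)"

lemma b0: "path_from_to U x0 x0 b0" using base_path[OF x0] .

lemma b0_class: "path_class U b0 \<in> carrier \<pi>" using b0 by (auto simp: carrier_fundamental_group)

lemma \<beta>_closed[simp]: "\<beta> \<in> carrier R" using b0_class by (simp add: \<beta>_def \<rho>_closed)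

lemma holonomy_loop:
  assumes p: "path_from_to U x0 x0 p"
  shows "holonomy p = \<tau> (path_class U p)"
proof -
  note rp = path_from_to_reverse[OF p] and rb = path_from_to_reverse[OF b0]
  have pc: "path_class U p \<in> carrier \<pi>" using p by (auto simp: carrier_fundamental_group)
  have "holonomy p = \<rho> (path_class U (b0 +++ reversepath p +++ reversepath b0))"
    using p by (simp add: holonomy_def path_from_to_def)
  also have "path_class U (b0 +++ reversepath p +++ reversepath b0) =
      path_class U b0 \<otimes>\<^bsub>\<pi>\<^esub> (inv\<^bsub>\<pi>\<^esub> path_class U p \<otimes>\<^bsub>\<pi>\<^esub> inv\<^bsub>\<pi>\<^esub> path_class U b0)"
    by (simp add: inv_path_class[OF p] inv_path_class[OF b0] path_class_mult[OF rp rb]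
        path_class_mult[OF b0 path_from_to_join[OF rp rb]])
  also have "\<rho> \<dots> = \<rho> (path_class U b0 \<otimes>\<^bsub>\<pi>\<^esub> inv\<^bsub>\<pi>\<^esub> path_class U b0) \<otimes> \<tau> (path_class U p)"
    unfolding \<rho>_mult[OF b0_class \<pi>.inv_closed[OF b0_class]]
    using pc b0_class by (simp add: \<rho>_mult \<rho>_closed \<tau>_def R.m_ac)
  finally show ?thesis using pc b0_class by (simp add: \<rho>_one)
qed

lemma EG_mult:
  assumes g: "g \<in> carrier \<pi>" and h: "h \<in> carrier \<pi>" and r: "r \<in> carrier R"
  shows "EG (g \<otimes>\<^bsub>\<pi>\<^esub> h) r = EG g r \<otimes>\<^bsub>Q1\<^esub> EG h (\<tau> g \<otimes> r)"
proof -
  obtain p q where p: "path_from_to U x0 x0 p" "g = path_class U p"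
    and q: "path_from_to U x0 x0 q" "h = path_class U q" using g h loop_representative by metis
  show ?thesis
    using g r p q \<tau>_closed[OF g]
    by (simp add: path_class_mult EG_path_class[OF path_from_to_join] EG_path_class E_join holonomy_loop)
qed

lemma EG_one: "r \<in> carrier R \<Longrightarrow> EG \<one>\<^bsub>\<pi>\<^esub> r = \<one>\<^bsub>Q1\<^esub>"
  using EG_mult[of "\<one>\<^bsub>\<pi>\<^esub>" "\<one>\<^bsub>\<pi>\<^esub>" r] by (simp add: \<tau>_one)

lemma EG_inv_N: "n \<in> N \<Longrightarrow> r \<in> carrier R \<Longrightarrow> EG (inv\<^bsub>\<pi>\<^esub> n) r = inv\<^bsub>Q1\<^esub> EG n r"
proof -
  assume n: "n \<in> N" and r: "r \<in> carrier R"
  have nc: "n \<in> carrier \<pi>" using N_carrier[OF n] .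
  have "inv\<^bsub>\<pi>\<^esub> n \<in> N" by (rule subgroup.m_inv_closed[OF \<pi>.derived_is_subgroup[OF subset_refl] n])
  then have "EG (inv\<^bsub>\<pi>\<^esub> n) r \<otimes>\<^bsub>Q1\<^esub> EG n r = \<one>\<^bsub>Q1\<^esub>"
    using EG_mult[of "inv\<^bsub>\<pi>\<^esub> n" n r] nc r by (simp add: EG_one \<tau>_N)
  then show ?thesis using nc r by (intro Q1.inv_equality[symmetric]) auto
qed

lemma EG_N:
  assumes "n \<in> N" "r \<in> carrier R"
  shows "EG n r = \<one>\<^bsub>Q1\<^esub>"
proof -
  have sub: "subgroup N \<pi>" by (rule \<pi>.derived_is_subgroup[OF subset_refl])
  have comm: "EG (x \<otimes>\<^bsub>\<pi>\<^esub> y \<otimes>\<^bsub>\<pi>\<^esub> inv\<^bsub>\<pi>\<^esub> x \<otimes>\<^bsub>\<pi>\<^esub> inv\<^bsub>\<pi>\<^esub> y) r = \<one>\<^bsub>Q1\<^esub>"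
    if xy: "x \<in> N" "y \<in> N" for x y
  proof -
    have xy': "x \<in> carrier \<pi>" "y \<in> carrier \<pi>" using xy N_carrier by auto
    have "EG (x \<otimes>\<^bsub>\<pi>\<^esub> y \<otimes>\<^bsub>\<pi>\<^esub> inv\<^bsub>\<pi>\<^esub> x \<otimes>\<^bsub>\<pi>\<^esub> inv\<^bsub>\<pi>\<^esub> y) r =
        EG x r \<otimes>\<^bsub>Q1\<^esub> EG y r \<otimes>\<^bsub>Q1\<^esub> inv\<^bsub>Q1\<^esub> EG x r \<otimes>\<^bsub>Q1\<^esub> inv\<^bsub>Q1\<^esub> EG y r"
      using xy xy' assms(2) subgroup.m_inv_closed[OF sub]
      by (simp add: EG_mult \<tau>_mult \<tau>_N EG_inv_N)
    also have "\<dots> = (EG x r \<otimes>\<^bsub>Q1\<^esub> EG y r) \<otimes>\<^bsub>Q1\<^esub> inv\<^bsub>Q1\<^esub> (EG x r \<otimes>\<^bsub>Q1\<^esub> EG y r)"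
      using xy' assms(2) by (simp only: Q1.inv_mult Q1.m_assoc EG_closed Q1.inv_closed Q1.m_closed)
    finally show ?thesis using xy' assms(2) by simp
  qed
  have "n \<in> generate \<pi> (derived_set \<pi> N)" using assms(1) perfect unfolding derived_def[of \<pi> N] by simp
  then have "n \<in> N \<and> EG n r = \<one>\<^bsub>Q1\<^esub>"
  proof (induction rule: generate.induct)
    case one then show ?case using assms(2) subgroup.one_closed[OF sub] by (simp add: EG_one)
  next
    case (incl h) then show ?case using comm sub by (auto simp: subgroup.m_closed subgroup.m_inv_closed)
  next
    case (inv h)
    then have "h \<in> N" "EG h r = \<one>\<^bsub>Q1\<^esub>"
      using comm sub by (auto simp: subgroup.m_closed subgroup.m_inv_closed)
    then show ?case using EG_inv_N[of h r] assms(2) sub by (simp add: subgroup.m_inv_closed)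
  next
    case (eng h1 h2)
    then show ?case
      using sub N_carrier assms(2) by (simp add: EG_mult \<tau>_N subgroup.m_closed)
  qed
  then show ?thesis by simp
qed

lemma EG_N_mult: "n \<in> N \<Longrightarrow> g \<in> carrier \<pi> \<Longrightarrow> r \<in> carrier R \<Longrightarrow> EG (n \<otimes>\<^bsub>\<pi>\<^esub> g) r = EG g r"
  using N_carrier by (simp add: EG_mult EG_N \<tau>_N)

text \<open>
  Since \<open>EG\<close> depends only on the class in the abelianization, \<open>EG (g h) = EG (h g)\<close>; expanding both
  sides by the product rule gives this identity, which says that over the fraction field \<open>EG\<close>
  is a principal crossed homomorphism.
\<close>

lemma EG_commute:
  assumes g: "g \<in> carrier \<pi>" and h: "h \<in> carrier \<pi>" and r: "r \<in> carrier R"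
  shows "EG g ((\<one> \<ominus> \<tau> h) \<otimes> r) = EG h ((\<one> \<ominus> \<tau> g) \<otimes> r)"
proof -
  have "g \<otimes>\<^bsub>\<pi>\<^esub> h \<otimes>\<^bsub>\<pi>\<^esub> inv\<^bsub>\<pi>\<^esub> g \<otimes>\<^bsub>\<pi>\<^esub> inv\<^bsub>\<pi>\<^esub> h \<in> N"
    using g h unfolding derived_def by (intro generate.incl UN_I[of g] UN_I[of h]) simp_all
  then have "EG (g \<otimes>\<^bsub>\<pi>\<^esub> h \<otimes>\<^bsub>\<pi>\<^esub> inv\<^bsub>\<pi>\<^esub> g \<otimes>\<^bsub>\<pi>\<^esub> inv\<^bsub>\<pi>\<^esub> h \<otimes>\<^bsub>\<pi>\<^esub> (h \<otimes>\<^bsub>\<pi>\<^esub> g)) r = EG (h \<otimes>\<^bsub>\<pi>\<^esub> g) r"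
    using g h r by (intro EG_N_mult) auto
  also have "g \<otimes>\<^bsub>\<pi>\<^esub> h \<otimes>\<^bsub>\<pi>\<^esub> inv\<^bsub>\<pi>\<^esub> g \<otimes>\<^bsub>\<pi>\<^esub> inv\<^bsub>\<pi>\<^esub> h \<otimes>\<^bsub>\<pi>\<^esub> (h \<otimes>\<^bsub>\<pi>\<^esub> g) = g \<otimes>\<^bsub>\<pi>\<^esub> h"
    using g h by (simp add: \<pi>.m_assoc) (simp flip: \<pi>.m_assoc)
  finally have e: "EG g r \<otimes>\<^bsub>Q1\<^esub> EG h (\<tau> g \<otimes> r) = EG h r \<otimes>\<^bsub>Q1\<^esub> EG g (\<tau> h \<otimes> r)"
    using g h r by (simp add: EG_mult)
  have x: "EG a ((\<one> \<ominus> \<tau> b) \<otimes> r) = EG a r \<otimes>\<^bsub>Q1\<^esub> inv\<^bsub>Q1\<^esub> EG a (\<tau> b \<otimes> r)"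
    if "a \<in> carrier \<pi>" "b \<in> carrier \<pi>" for a b
  proof -
    have "(\<one> \<ominus> \<tau> b) \<otimes> r = r \<oplus> \<ominus> (\<tau> b \<otimes> r)"
      using that r by (simp add: R.minus_eq R.l_distr R.l_minus)
    then show ?thesis using that r by (simp add: EG_add EG_minus)
  qed
  have cl: "EG g r \<in> carrier Q1" "EG h r \<in> carrier Q1" "EG h (\<tau> g \<otimes> r) \<in> carrier Q1" "EG g (\<tau> h \<otimes> r) \<in> carrier Q1"
    using g h r by simp_all
  have "EG g r \<otimes>\<^bsub>Q1\<^esub> inv\<^bsub>Q1\<^esub> EG g (\<tau> h \<otimes> r) =
      (EG g r \<otimes>\<^bsub>Q1\<^esub> EG h (\<tau> g \<otimes> r)) \<otimes>\<^bsub>Q1\<^esub> (inv\<^bsub>Q1\<^esub> EG g (\<tau> h \<otimes> r) \<otimes>\<^bsub>Q1\<^esub> inv\<^bsub>Q1\<^esub> EG h (\<tau> g \<otimes> r))"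
    using cl by (simp add: Q1.m_ac)
  also have "\<dots> = (EG h r \<otimes>\<^bsub>Q1\<^esub> EG g (\<tau> h \<otimes> r)) \<otimes>\<^bsub>Q1\<^esub> (inv\<^bsub>Q1\<^esub> EG g (\<tau> h \<otimes> r) \<otimes>\<^bsub>Q1\<^esub> inv\<^bsub>Q1\<^esub> EG h (\<tau> g \<otimes> r))"
    by (simp only: e)
  also have "\<dots> = EG h r \<otimes>\<^bsub>Q1\<^esub> inv\<^bsub>Q1\<^esub> EG h (\<tau> g \<otimes> r)"
    using cl by (simp add: Q1.m_assoc) (simp flip: Q1.m_assoc)
  finally show ?thesis using x[OF g h] x[OF h g] by simp
qed

text \<open>
  A path closed up by the chosen paths from the base point to its ends.
\<close>

definition loop_of :: "(real \<Rightarrow> 's) \<Rightarrow> (real \<Rightarrow> 's) set" where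
  "loop_of p = path_class U (base_path U x0 (pathstart p) +++ p +++ reversepath (base_path U x0 (pathfinish p)))"

lemma
  assumes p: "path_from_to U x y p"
  shows loop_of_closed: "loop_of p \<in> carrier \<pi>"
    and holonomy_eq_\<tau>: "holonomy p = \<tau> (loop_of p)"
    and E_decomposition: "r \<in> carrier R \<Longrightarrow> E p r \<otimes>\<^bsub>Q1\<^esub> E (base_path U x0 x) (\<beta> \<otimes> r) =
      EG (loop_of p) (\<beta> \<otimes> r) \<otimes>\<^bsub>Q1\<^esub> E (base_path U x0 y) (\<beta> \<otimes> (holonomy p \<otimes> r))"
proof -
  let ?bx = "base_path U x0 x" and ?by = "base_path U x0 y"
  have xy: "x \<in> U" "y \<in> U" using path_from_to_ends[OF p] by auto
  note bx = base_path[OF xy(1)] and b_y = base_path[OF xy(2)]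
  note rby = path_from_to_reverse[OF b_y] and rbx = path_from_to_reverse[OF bx] and rp = path_from_to_reverse[OF p]
  note j1 = path_from_to_join[OF p rby] note l = path_from_to_join[OF bx j1]
  have ends: "pathstart p = x" "pathfinish p = y" using p by (auto simp: path_from_to_def)
  have lo: "loop_of p = path_class U (?bx +++ p +++ reversepath ?by)" by (simp add: loop_of_def ends)
  show lc: "loop_of p \<in> carrier \<pi>" unfolding lo using l by (auto simp: carrier_fundamental_group)
  have "reversepath (?bx +++ p +++ reversepath ?by) = (?by +++ reversepath p) +++ reversepath ?bx"
    using j1 bx p rby by (simp add: reversepath_joinpaths path_from_to_def)
  then have "inv\<^bsub>\<pi>\<^esub> loop_of p = path_class U ((?by +++ reversepath p) +++ reversepath ?bx)"
    unfolding lo by (simp add: inv_path_class[OF l])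
  also have "\<dots> = path_class U (?by +++ reversepath p +++ reversepath ?bx)"
    by (rule path_class_assoc[OF b_y rp rbx])
  finally show h: "holonomy p = \<tau> (loop_of p)" by (simp add: holonomy_def ends \<tau>_def)
  assume r: "r \<in> carrier R"
  have hc: "holonomy p \<in> carrier R" by (rule holonomy_closed[OF p])
  define \<beta>' where "\<beta>' = \<rho> (inv\<^bsub>\<pi>\<^esub> path_class U b0)"
  have \<beta>'[simp]: "\<beta>' \<in> carrier R" using b0_class by (simp add: \<beta>'_def \<rho>_closed)
  have bb: "\<beta>' \<otimes> \<beta> = \<one>"
    using b0_class \<rho>_mult[of "inv\<^bsub>\<pi>\<^esub> path_class U b0" "path_class U b0"] by (simp add: \<beta>'_def \<beta>_def \<rho>_one)
  have hb: "holonomy (base_path U x0 z) = \<beta>'" if "z \<in> U" for z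
  proof -
    note bz = base_path[OF that] and rb0 = path_from_to_reverse[OF b0]
    note rbz = path_from_to_reverse[OF bz]
    have "path_class U (base_path U x0 z +++ reversepath (base_path U x0 z) +++ reversepath b0) =
        path_class U ((base_path U x0 z +++ reversepath (base_path U x0 z)) +++ reversepath b0)"
      by (rule path_class_assoc[OF bz rbz rb0, symmetric])
    also have "\<dots> = path_class U ((\<lambda>_. x0) +++ reversepath b0)"
      using path_class_rinv[OF bz] by (rule path_class_join_cong[OF path_from_to_join[OF bz rbz] rb0 _
          HOL.refl path_from_to_const[OF x0] rb0])
    also have "\<dots> = inv\<^bsub>\<pi>\<^esub> path_class U b0"
      using path_class_lid[OF rb0] inv_path_class[OF b0] by simp
    finally show ?thesis using bz by (simp add: holonomy_def \<beta>'_def path_from_to_def)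
  qed
  have cancel: "\<beta>' \<otimes> (\<beta> \<otimes> a) = a" if "a \<in> carrier R" for a
    using that bb by (simp flip: R.m_assoc)
  let ?s = "\<beta> \<otimes> r" and ?h = "holonomy p \<otimes> r"
  have hr: "?h \<in> carrier R" "?s \<in> carrier R" "\<beta> \<otimes> ?h \<in> carrier R" using hc r by simp_all
  have 1: "EG (loop_of p) ?s = E ?bx ?s \<otimes>\<^bsub>Q1\<^esub> (E p r \<otimes>\<^bsub>Q1\<^esub> E (reversepath ?by) ?h)"
    unfolding lo EG_path_class[OF l hr(2)] E_join[OF bx j1 hr(2)] hb[OF xy(1)] cancel[OF r]
      E_join[OF p rby r] ..
  have "E ?by (\<beta> \<otimes> ?h) \<otimes>\<^bsub>Q1\<^esub> E (reversepath ?by) ?h = E (?by +++ reversepath ?by) (\<beta> \<otimes> ?h)"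
    unfolding E_join[OF b_y rby hr(3)] hb[OF xy(2)] cancel[OF hr(1)] ..
  also have "\<dots> = E (\<lambda>_. x0) (\<beta> \<otimes> ?h)"
    by (rule E_homotopic[OF path_from_to_join[OF b_y rby] _ hr(3)],
        rule path_class_eqD[OF path_from_to_const[OF x0] path_class_rinv[OF b_y]])
  also have "\<dots> = \<one>\<^bsub>Q1\<^esub>" by (rule E_const[OF x0 hr(3)])
  finally have 2: "E ?by (\<beta> \<otimes> ?h) \<otimes>\<^bsub>Q1\<^esub> E (reversepath ?by) ?h = \<one>\<^bsub>Q1\<^esub>" .
  have cl: "E ?bx ?s \<in> carrier Q1" "E p r \<in> carrier Q1" "E ?by (\<beta> \<otimes> ?h) \<in> carrier Q1"
    "E (reversepath ?by) ?h \<in> carrier Q1"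
    using E_closed[OF bx hr(2)] E_closed[OF p r] E_closed[OF b_y hr(3)] E_closed[OF rby hr(1)] by simp_all
  have "EG (loop_of p) ?s \<otimes>\<^bsub>Q1\<^esub> E ?by (\<beta> \<otimes> ?h) =
      (E p r \<otimes>\<^bsub>Q1\<^esub> E ?bx ?s) \<otimes>\<^bsub>Q1\<^esub> (E ?by (\<beta> \<otimes> ?h) \<otimes>\<^bsub>Q1\<^esub> E (reversepath ?by) ?h)"
    unfolding 1 using cl by (simp add: Q1.m_ac)
  then show "E p r \<otimes>\<^bsub>Q1\<^esub> E ?bx ?s = EG (loop_of p) ?s \<otimes>\<^bsub>Q1\<^esub> E ?by (\<beta> \<otimes> ?h)"
    unfolding 2 using cl by simp
qed

abbreviation "vertex0 \<equiv> \<lambda>i::nat. if i = 0 then 1 else (0::real)"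

lemma face_vertex:
  "singular_face 1 0 \<sigma> vertex0 = pathfinish (first_edge \<sigma>)"
  "singular_face 1 1 \<sigma> vertex0 = pathstart (first_edge \<sigma>)"
proof -
  have v: "vertex0 \<in> standard_simplex (1 - Suc 0)" by (simp add: standard_simplex_0)
  have "simplical_face 0 vertex0 = (\<lambda>i. if i = 0 then 1 - 1 else if i = 1 then 1 else 0)"
    "simplical_face 1 vertex0 = (\<lambda>i. if i = 0 then 1 - 0 else if i = 1 then 0 else 0)"
    by (auto simp: simplical_face_def fun_eq_iff)
  then show "singular_face 1 0 \<sigma> vertex0 = pathfinish (first_edge \<sigma>)"
    "singular_face 1 1 \<sigma> vertex0 = pathstart (first_edge \<sigma>)"
    using v by (simp_all add: singular_face_def pathstart_def pathfinish_def first_edge_def del: One_nat_def)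
qed

text \<open>
  By the decomposition of the class of a path, the class of a chain is a sum of values of \<open>EG\<close> on
  loops and of a term \<open>\<Psi>\<close> that depends only on its boundary. The former are values of \<open>EG\<close> on the single
  element \<open>t\<close> after multiplication by \<open>\<kappa>\<close>, so that the class of \<open>\<kappa> c\<close> becomes \<open>EG t (Q c)\<close> plus a
  boundary term. The element \<open>Q c\<close> satisfies \<open>(1 - \<tau> t) Q c = - \<epsilon> (\<partial> c)\<close>, where \<open>\<epsilon>\<close> is \<open>\<kappa> \<beta>\<close> times
  the augmentation, hence it vanishes if \<open>c\<close> is a cycle.
\<close>

lemma cycle_killed:
  assumes t: "t \<in> carrier \<pi>" and \<kappa>: "\<kappa> \<in> carrier R"
    and q: "\<And>g. g \<in> carrier \<pi> \<Longrightarrow> q g \<in> carrier R"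
    and EG_q: "\<And>g r. g \<in> carrier \<pi> \<Longrightarrow> r \<in> carrier R \<Longrightarrow> EG g (\<kappa> \<otimes> r) = EG t (q g \<otimes> r)"
    and q_eq: "\<And>g. g \<in> carrier \<pi> \<Longrightarrow> (\<one> \<ominus> \<tau> t) \<otimes> q g = \<kappa> \<otimes> (\<one> \<ominus> \<tau> g)"
    and regular: "\<And>a. a \<in> carrier R \<Longrightarrow> (\<one> \<ominus> \<tau> t) \<otimes> a = \<zero> \<Longrightarrow> a = \<zero>"
    and c: "c \<in> carrier (C 1)" "bd 1 c = \<one>\<^bsub>C 0\<^esub>"
  shows "scale c \<kappa> \<in> B"
proof -
  let ?b = "\<lambda>x. base_path U x0 x"
  let ?A = "add_monoid R"
  let ?\<psi> = "\<lambda>\<nu> r. E (?b (\<nu> vertex0)) (\<kappa> \<otimes> (\<beta> \<otimes> r))"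
  let ?e = "\<lambda>\<nu>::(nat \<Rightarrow> real) \<Rightarrow> 's. \<lambda>r. \<kappa> \<otimes> (\<beta> \<otimes> r)"
  let ?m = "\<lambda>\<sigma> r. q (loop_of (first_edge \<sigma>)) \<otimes> (\<beta> \<otimes> r)"
  define \<Psi> where "\<Psi> = extend Q1 ?\<psi>"
  define \<epsilon> where "\<epsilon> = extend ?A ?e"
  define Q where "Q = extend ?A ?m"
  have A: "comm_group ?A" by (rule R.add.comm_group_axioms)
  interpret C0: comm_group "C 0" by (rule comm_group_C)
  have smp0: "\<nu> vertex0 \<in> U" if "smp 0 \<nu>" for \<nu>
    using that by (auto simp: smp_iff standard_simplex_0)
  have pf: "path_from_to U (first_edge \<sigma> 0) (first_edge \<sigma> 1) (first_edge \<sigma>)" if "smp 1 \<sigma>" for \<sigma>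
    by (rule path_from_to_first_edge[OF that order_refl])
  have \<psi>: "?\<psi> \<nu> r \<in> carrier Q1" "r' \<in> carrier R \<Longrightarrow> ?\<psi> \<nu> (r \<oplus> r') = ?\<psi> \<nu> r \<otimes>\<^bsub>Q1\<^esub> ?\<psi> \<nu> r'"
    if "smp 0 \<nu>" "r \<in> carrier R" for \<nu> r r'
    using E_closed[OF base_path[OF smp0[OF that(1)]]] E_add[OF base_path[OF smp0[OF that(1)]]] \<kappa> that(2)
    by (simp_all add: R.r_distr)
  have m: "?m \<sigma> r \<in> carrier R" "r' \<in> carrier R \<Longrightarrow> ?m \<sigma> (r \<oplus> r') = ?m \<sigma> r \<oplus> ?m \<sigma> r'"
    if "smp 1 \<sigma>" "r \<in> carrier R" for \<sigma> r r'
    using q[OF loop_of_closed[OF pf[OF that(1)]]] that(2) by (simp_all add: R.r_distr)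
  have \<Psi>_hom: "\<Psi> \<in> hom (C 0) Q1"
    unfolding \<Psi>_def by (rule extend_hom[OF comm_group_Q1]) (use \<psi> in auto)
  have \<Psi>_single: "\<Psi> (single \<nu> r) = ?\<psi> \<nu> r" if "smp 0 \<nu>" "r \<in> carrier R" for \<nu> r
    unfolding \<Psi>_def by (rule extend_single[OF comm_group_Q1, of 0]) (use \<psi> that in auto)
  have \<epsilon>_hom: "\<epsilon> \<in> hom (C 0) ?A"
    unfolding \<epsilon>_def by (rule extend_hom[OF A]) (use \<kappa> in \<open>auto simp: R.r_distr\<close>)
  have \<epsilon>_single: "\<epsilon> (single \<nu> r) = \<kappa> \<otimes> (\<beta> \<otimes> r)" if "smp 0 \<nu>" "r \<in> carrier R" for \<nu> r
    unfolding \<epsilon>_def by (rule extend_single[OF A, of 0]) (use \<kappa> that in \<open>auto simp: R.r_distr\<close>)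
  have Q_hom: "Q \<in> hom (C 1) ?A"
    unfolding Q_def by (rule extend_hom[OF A]) (use m in auto)
  have Q_single: "Q (single \<sigma> r) = ?m \<sigma> r" if "smp 1 \<sigma>" "r \<in> carrier R" for \<sigma> r
    unfolding Q_def by (rule extend_single[OF A, of 1]) (use m that in auto)
  have bd1: "bd 1 \<in> hom (C 1) (C 0)" using bd_hom[of 1] by simp
  have bd_cl: "bd 1 d \<in> carrier (C 0)" if "d \<in> carrier (C 1)" for d using hom_in_carrier[OF bd1 that] .
  have Q_cl: "Q d \<in> carrier R" if "d \<in> carrier (C 1)" for d using hom_in_carrier[OF Q_hom that] by simp
  have \<epsilon>_cl: "\<epsilon> d \<in> carrier R" if "d \<in> carrier (C 0)" for d using hom_in_carrier[OF \<epsilon>_hom that] by simp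
  have Q_mult: "Q (d \<otimes>\<^bsub>C 1\<^esub> d') = Q d \<oplus> Q d'" if "d \<in> carrier (C 1)" "d' \<in> carrier (C 1)" for d d'
    using hom_mult[OF Q_hom that] by simp
  have \<epsilon>_mult: "\<epsilon> (d \<otimes>\<^bsub>C 0\<^esub> d') = \<epsilon> d \<oplus> \<epsilon> d'" if "d \<in> carrier (C 0)" "d' \<in> carrier (C 0)" for d d'
    using hom_mult[OF \<epsilon>_hom that] by simp
  have 1: "\<one> \<ominus> \<tau> t \<in> carrier R" using t by simp
  have face: "smp 0 (singular_face 1 0 \<sigma>)" "smp 0 (singular_face 1 1 \<sigma>)" if "smp 1 \<sigma>" for \<sigma>
    using singular_simplex_singular_face[OF that, of 0] singular_simplex_singular_face[OF that, of 1] by simp_all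
  have single_bd: "single (singular_face 1 0 \<sigma>) (holonomy (first_edge \<sigma>) \<otimes> r) \<in> carrier (C 0)"
    "single (singular_face 1 1 \<sigma>) (\<ominus> r) \<in> carrier (C 0)" if "smp 1 \<sigma>" "r \<in> carrier R" for \<sigma> r
    using that face[OF that(1)] holonomy_closed[OF pf[OF that(1)]] by (auto intro!: single_closed)

  have "(\<one> \<ominus> \<tau> t) \<otimes> Q c \<oplus> \<epsilon> (bd 1 c) = \<zero>"
  proof (rule chain_hom_eqI[where A = ?A and k = "\<lambda>_. \<zero>" and h = "\<lambda>c. (\<one> \<ominus> \<tau> t) \<otimes> Q c \<oplus> \<epsilon> (bd 1 c)", OF R.add.is_group _ _ _ c(1)])
    show "(\<lambda>c. (\<one> \<ominus> \<tau> t) \<otimes> Q c \<oplus> \<epsilon> (bd 1 c)) \<in> hom (C 1) ?A"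
    proof (rule homI)
      fix d d' assume d: "d \<in> carrier (C 1)" and d': "d' \<in> carrier (C 1)"
      note cl = 1 Q_cl[OF d] Q_cl[OF d'] \<epsilon>_cl[OF bd_cl[OF d]] \<epsilon>_cl[OF bd_cl[OF d']]
      show "(\<one> \<ominus> \<tau> t) \<otimes> Q d \<oplus> \<epsilon> (bd 1 d) \<in> carrier ?A" using cl by simp
      show "(\<one> \<ominus> \<tau> t) \<otimes> Q (d \<otimes>\<^bsub>C 1\<^esub> d') \<oplus> \<epsilon> (bd 1 (d \<otimes>\<^bsub>C 1\<^esub> d')) =
        ((\<one> \<ominus> \<tau> t) \<otimes> Q d \<oplus> \<epsilon> (bd 1 d)) \<otimes>\<^bsub>?A\<^esub> ((\<one> \<ominus> \<tau> t) \<otimes> Q d' \<oplus> \<epsilon> (bd 1 d'))"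
        unfolding hom_mult[OF bd1 d d'] Q_mult[OF d d'] \<epsilon>_mult[OF bd_cl[OF d] bd_cl[OF d']]
        using cl by (simp add: R.r_distr R.a_ac)
    qed
    show "(\<lambda>_. \<zero>) \<in> hom (C 1) ?A" by (intro homI) auto
    fix \<sigma> r assume \<sigma>: "smp 1 \<sigma>" and r: "r \<in> carrier R"
    let ?p = "first_edge \<sigma>"
    have h: "holonomy ?p \<in> carrier R" and l: "loop_of ?p \<in> carrier \<pi>"
      using holonomy_closed[OF pf[OF \<sigma>]] loop_of_closed[OF pf[OF \<sigma>]] by auto
    have hr: "holonomy ?p \<otimes> r \<in> carrier R" "\<ominus> r \<in> carrier R" using h r by simp_all
    have "(\<one> \<ominus> \<tau> t) \<otimes> (q (loop_of ?p) \<otimes> (\<beta> \<otimes> r)) = ((\<one> \<ominus> \<tau> t) \<otimes> q (loop_of ?p)) \<otimes> (\<beta> \<otimes> r)"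
      using 1 q[OF l] r by (simp add: R.m_assoc)
    also have "\<dots> = \<kappa> \<otimes> (\<one> \<ominus> holonomy ?p) \<otimes> (\<beta> \<otimes> r)"
      by (simp only: q_eq[OF l] holonomy_eq_\<tau>[OF pf[OF \<sigma>]])
    finally have "(\<one> \<ominus> \<tau> t) \<otimes> Q (single \<sigma> r) = \<kappa> \<otimes> (\<one> \<ominus> holonomy ?p) \<otimes> (\<beta> \<otimes> r)"
      by (simp only: Q_single[OF \<sigma> r])
    moreover have "\<epsilon> (bd 1 (single \<sigma> r)) = \<kappa> \<otimes> (\<beta> \<otimes> (holonomy ?p \<otimes> r)) \<oplus> \<kappa> \<otimes> (\<beta> \<otimes> (\<ominus> r))"
      by (simp only: bd1_single[OF \<sigma> r] \<epsilon>_mult[OF single_bd[OF \<sigma> r]] \<epsilon>_single[OF face(1)[OF \<sigma>] hr(1)]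
          \<epsilon>_single[OF face(2)[OF \<sigma>] hr(2)])
    moreover have "\<kappa> \<otimes> (\<one> \<ominus> holonomy ?p) \<otimes> (\<beta> \<otimes> r) \<oplus> (\<kappa> \<otimes> (\<beta> \<otimes> (holonomy ?p \<otimes> r)) \<oplus> \<kappa> \<otimes> (\<beta> \<otimes> (\<ominus> r))) = \<zero>"
      using \<kappa> h r \<beta>_closed by algebra
    ultimately show "(\<one> \<ominus> \<tau> t) \<otimes> Q (single \<sigma> r) \<oplus> \<epsilon> (bd 1 (single \<sigma> r)) = \<zero>" by simp
  qed
  moreover have "\<epsilon> (bd 1 c) = \<zero>"
    using \<epsilon>_mult[of "\<one>\<^bsub>C 0\<^esub>" "\<one>\<^bsub>C 0\<^esub>"] \<epsilon>_cl[of "\<one>\<^bsub>C 0\<^esub>"] c(2) by simp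
  ultimately have "Q c = \<zero>" using regular[OF Q_cl[OF c(1)]] 1 Q_cl[OF c(1)] by simp

  have "B #>\<^bsub>C 1\<^esub> scale c \<kappa> = EG t (Q c) \<otimes>\<^bsub>Q1\<^esub> \<Psi> (bd 1 c)"
  proof (rule chain_hom_eqI[where h = "\<lambda>c. B #>\<^bsub>C 1\<^esub> scale c \<kappa>" and k = "\<lambda>c. EG t (Q c) \<otimes>\<^bsub>Q1\<^esub> \<Psi> (bd 1 c)", OF Q1.is_group _ _ _ c(1)])
    show "(\<lambda>c. B #>\<^bsub>C 1\<^esub> scale c \<kappa>) \<in> hom (C 1) Q1"
      using hom_compose[OF scale_hom[OF \<kappa>] quotient_hom] by (simp add: o_def)
    show "(\<lambda>c. EG t (Q c) \<otimes>\<^bsub>Q1\<^esub> \<Psi> (bd 1 c)) \<in> hom (C 1) Q1"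
    proof (rule homI)
      fix d d' assume d: "d \<in> carrier (C 1)" and d': "d' \<in> carrier (C 1)"
      note cl = EG_closed[OF t Q_cl[OF d]] EG_closed[OF t Q_cl[OF d']]
        hom_in_carrier[OF \<Psi>_hom bd_cl[OF d]] hom_in_carrier[OF \<Psi>_hom bd_cl[OF d']]
      show "EG t (Q d) \<otimes>\<^bsub>Q1\<^esub> \<Psi> (bd 1 d) \<in> carrier Q1" using cl by (intro Q1.m_closed)
      show "EG t (Q (d \<otimes>\<^bsub>C 1\<^esub> d')) \<otimes>\<^bsub>Q1\<^esub> \<Psi> (bd 1 (d \<otimes>\<^bsub>C 1\<^esub> d')) =
        (EG t (Q d) \<otimes>\<^bsub>Q1\<^esub> \<Psi> (bd 1 d)) \<otimes>\<^bsub>Q1\<^esub> (EG t (Q d') \<otimes>\<^bsub>Q1\<^esub> \<Psi> (bd 1 d'))"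
        unfolding hom_mult[OF bd1 d d'] Q_mult[OF d d'] hom_mult[OF \<Psi>_hom bd_cl[OF d] bd_cl[OF d']]
          EG_add[OF t Q_cl[OF d] Q_cl[OF d']]
        using cl by (simp only: Q1.m_ac Q1.m_closed)
    qed
    fix \<sigma> r assume \<sigma>: "smp 1 \<sigma>" and r: "r \<in> carrier R"
    let ?p = "first_edge \<sigma>"
    have h: "holonomy ?p \<in> carrier R" and l: "loop_of ?p \<in> carrier \<pi>"
      using holonomy_closed[OF pf[OF \<sigma>]] loop_of_closed[OF pf[OF \<sigma>]] by auto
    have hr: "holonomy ?p \<otimes> r \<in> carrier R" "\<ominus> r \<in> carrier R" using h r by simp_all
    have kr: "\<kappa> \<otimes> r \<in> carrier R" using \<kappa> r by simp
    let ?x = "?b (?p 0)" and ?y = "?b (?p 1)"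
    have xy: "?p 0 \<in> U" "?p 1 \<in> U" using path_from_to_ends[OF pf[OF \<sigma>]] by auto
    note bx = base_path[OF xy(1)] and b_y = base_path[OF xy(2)]
    have "scale (single \<sigma> r) \<kappa> = single \<sigma> (\<kappa> \<otimes> r)"
      using \<kappa> r by (auto simp: scale_def single_def R.m_comm)
    then have L: "B #>\<^bsub>C 1\<^esub> scale (single \<sigma> r) \<kappa> = E ?p (\<kappa> \<otimes> r)"
      by (simp only: E_def path_simplex_first_edge[OF \<sigma>])
    have ac: "\<beta> \<otimes> (\<kappa> \<otimes> r) = \<kappa> \<otimes> (\<beta> \<otimes> r)"
      "\<beta> \<otimes> (holonomy ?p \<otimes> (\<kappa> \<otimes> r)) = \<kappa> \<otimes> (\<beta> \<otimes> (holonomy ?p \<otimes> r))"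
      "\<kappa> \<otimes> (\<beta> \<otimes> (\<ominus> r)) = \<ominus> (\<kappa> \<otimes> (\<beta> \<otimes> r))"
      using \<kappa> r h \<beta>_closed by algebra+
    have dec: "E ?p (\<kappa> \<otimes> r) \<otimes>\<^bsub>Q1\<^esub> E ?x (\<kappa> \<otimes> (\<beta> \<otimes> r)) =
      EG (loop_of ?p) (\<kappa> \<otimes> (\<beta> \<otimes> r)) \<otimes>\<^bsub>Q1\<^esub> E ?y (\<kappa> \<otimes> (\<beta> \<otimes> (holonomy ?p \<otimes> r)))"
      using E_decomposition[OF pf[OF \<sigma>] kr] by (simp only: ac)
    have br: "\<beta> \<otimes> r \<in> carrier R" "\<kappa> \<otimes> (\<beta> \<otimes> r) \<in> carrier R" "\<kappa> \<otimes> (\<beta> \<otimes> (holonomy ?p \<otimes> r)) \<in> carrier R"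
      using r h \<kappa> by simp_all
    have cl: "E ?p (\<kappa> \<otimes> r) \<in> carrier Q1" "E ?x (\<kappa> \<otimes> (\<beta> \<otimes> r)) \<in> carrier Q1"
      "E ?y (\<kappa> \<otimes> (\<beta> \<otimes> (holonomy ?p \<otimes> r))) \<in> carrier Q1" "EG (loop_of ?p) (\<kappa> \<otimes> (\<beta> \<otimes> r)) \<in> carrier Q1"
      using E_closed[OF pf[OF \<sigma>] kr] E_closed[OF bx br(2)] E_closed[OF b_y br(3)] EG_closed[OF l br(2)] by simp_all
    have "\<Psi> (bd 1 (single \<sigma> r)) = E ?y (\<kappa> \<otimes> (\<beta> \<otimes> (holonomy ?p \<otimes> r))) \<otimes>\<^bsub>Q1\<^esub> E ?x (\<kappa> \<otimes> (\<beta> \<otimes> (\<ominus> r)))"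
      by (simp only: bd1_single[OF \<sigma> r] hom_mult[OF \<Psi>_hom single_bd[OF \<sigma> r]] \<Psi>_single[OF face(1)[OF \<sigma>] hr(1)]
          \<Psi>_single[OF face(2)[OF \<sigma>] hr(2)] face_vertex pathstart_def pathfinish_def)
    also have "E ?x (\<kappa> \<otimes> (\<beta> \<otimes> (\<ominus> r))) = inv\<^bsub>Q1\<^esub> E ?x (\<kappa> \<otimes> (\<beta> \<otimes> r))"
      by (simp only: ac E_minus[OF bx br(2)])
    finally have "EG t (Q (single \<sigma> r)) \<otimes>\<^bsub>Q1\<^esub> \<Psi> (bd 1 (single \<sigma> r)) =
      (EG (loop_of ?p) (\<kappa> \<otimes> (\<beta> \<otimes> r)) \<otimes>\<^bsub>Q1\<^esub> E ?y (\<kappa> \<otimes> (\<beta> \<otimes> (holonomy ?p \<otimes> r)))) \<otimes>\<^bsub>Q1\<^esub> inv\<^bsub>Q1\<^esub> E ?x (\<kappa> \<otimes> (\<beta> \<otimes> r))"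
      using cl by (simp only: Q_single[OF \<sigma> r] EG_q[OF l br(1), symmetric] Q1.m_assoc Q1.inv_closed)
    also have "\<dots> = E ?p (\<kappa> \<otimes> r)"
      unfolding dec[symmetric] using cl by (simp only: Q1.m_assoc Q1.inv_closed Q1.r_inv Q1.r_one)
    finally show "B #>\<^bsub>C 1\<^esub> scale (single \<sigma> r) \<kappa> = EG t (Q (single \<sigma> r)) \<otimes>\<^bsub>Q1\<^esub> \<Psi> (bd 1 (single \<sigma> r))"
      by (simp only: L)
  qed
  also have "\<dots> = \<one>\<^bsub>Q1\<^esub>"
  proof -
    interpret \<Psi>: group_hom "C 0" Q1 \<Psi> by (intro group_hom.intro group_hom_axioms.intro C0.is_group Q1.is_group \<Psi>_hom)
    show ?thesis using \<open>Q c = \<zero>\<close> c(2) \<Psi>.hom_one by (simp add: EG_zero[OF t])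
  qed
  finally have "B #>\<^bsub>C 1\<^esub> scale c \<kappa> = B" by (simp add: Q1_def)
  then show ?thesis
    using C1.coset_join1[OF _ scale_closed[OF c(1) \<kappa>] B_subgroup] by blast
qed

text \<open>
  Here \<open>EG_commute\<close> provides the coefficients \<open>q g = 1 - \<tau> g\<close>.
\<close>

lemma cycle_killed_by_difference:
  assumes t: "t \<in> carrier \<pi>"
    and regular: "\<And>a. a \<in> carrier R \<Longrightarrow> (\<one> \<ominus> \<tau> t) \<otimes> a = \<zero> \<Longrightarrow> a = \<zero>"
    and c: "c \<in> carrier (C 1)" "bd 1 c = \<one>\<^bsub>C 0\<^esub>"
  shows "scale c (\<one> \<ominus> \<tau> t) \<in> B"
  by (rule cycle_killed[where t = t and q = "\<lambda>g. \<one> \<ominus> \<tau> g", OF t _ _ _ _ regular c])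
     (use t EG_commute in auto)

text \<open>
  If the abelianization is generated by \<open>t\<close>, then \<open>1 - \<tau> g\<close> is a multiple of \<open>1 - \<tau> t\<close> for every \<open>g\<close>, the
  factor for \<open>g = t\<^sup>n\<close> being \<open>1 + \<tau> t + \<dots> + (\<tau> t)\<^sup>n\<^sup>-\<^sup>1\<close> if \<open>n > 0\<close>, and \<open>EG g\<close> is obtained from \<open>EG t\<close>
  by the same factor.
\<close>

lemma cycle_is_boundary:
  assumes t: "t \<in> carrier \<pi>"
    and gen: "\<And>g. g \<in> carrier \<pi> \<Longrightarrow> \<exists>n\<in>N. \<exists>m::int. g = n \<otimes>\<^bsub>\<pi>\<^esub> t [^]\<^bsub>\<pi>\<^esub> m"
    and regular: "\<And>a. a \<in> carrier R \<Longrightarrow> (\<one> \<ominus> \<tau> t) \<otimes> a = \<zero> \<Longrightarrow> a = \<zero>"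
    and c: "c \<in> carrier (C 1)" "bd 1 c = \<one>\<^bsub>C 0\<^esub>"
  shows "scale c \<one> \<in> B"
proof -
  define P where "P = (\<lambda>g q. q \<in> carrier R \<and> (\<forall>r\<in>carrier R. EG g r = EG t (q \<otimes> r)) \<and>
    (\<one> \<ominus> \<tau> t) \<otimes> q = \<one> \<ominus> \<tau> g)"
  have t1: "\<one> \<ominus> \<tau> t \<in> carrier R" using t by simp
  have "subgroup {g \<in> carrier \<pi>. \<exists>q. P g q} \<pi>"
  proof (rule \<pi>.subgroupI)
    have "P \<one>\<^bsub>\<pi>\<^esub> \<zero>"
      using t t1 by (auto simp: P_def EG_one EG_zero \<tau>_one R.minus_eq R.r_neg)
    then show "{g \<in> carrier \<pi>. \<exists>q. P g q} \<noteq> {}" by blast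
    fix g assume "g \<in> {g \<in> carrier \<pi>. \<exists>q. P g q}"
    then obtain q where g: "g \<in> carrier \<pi>" and q: "q \<in> carrier R"
      and Eq: "\<And>r. r \<in> carrier R \<Longrightarrow> EG g r = EG t (q \<otimes> r)" and qe: "(\<one> \<ominus> \<tau> t) \<otimes> q = \<one> \<ominus> \<tau> g"
      by (auto simp: P_def)
    define u where "u = \<tau> (inv\<^bsub>\<pi>\<^esub> g)"
    have u: "u \<in> carrier R" "u \<otimes> \<tau> g = \<one>" using g by (simp_all add: u_def \<tau>_inv)
    have "P (inv\<^bsub>\<pi>\<^esub> g) (\<ominus> (u \<otimes> q))"
      unfolding P_def
    proof (intro conjI ballI)
      show "\<ominus> (u \<otimes> q) \<in> carrier R" using u q by simp
      fix r assume r: "r \<in> carrier R"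
      have "EG (inv\<^bsub>\<pi>\<^esub> g) r \<otimes>\<^bsub>Q1\<^esub> EG g (u \<otimes> r) = \<one>\<^bsub>Q1\<^esub>"
        using EG_mult[of "inv\<^bsub>\<pi>\<^esub> g" g r] g r by (simp add: EG_one u_def)
      then have "EG (inv\<^bsub>\<pi>\<^esub> g) r = inv\<^bsub>Q1\<^esub> EG g (u \<otimes> r)"
        using g r u by (intro Q1.inv_equality[symmetric]) auto
      also have "\<dots> = EG t (\<ominus> (q \<otimes> (u \<otimes> r)))"
        using t q u r by (simp add: Eq EG_minus)
      also have "\<ominus> (q \<otimes> (u \<otimes> r)) = \<ominus> (u \<otimes> q) \<otimes> r" using q u r by algebra
      finally show "EG (inv\<^bsub>\<pi>\<^esub> g) r = EG t (\<ominus> (u \<otimes> q) \<otimes> r)" .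
    next
      have "(\<one> \<ominus> \<tau> t) \<otimes> \<ominus> (u \<otimes> q) = \<ominus> (u \<otimes> ((\<one> \<ominus> \<tau> t) \<otimes> q))"
        using \<tau>_closed[OF t] u q by algebra
      also have "\<dots> = \<ominus> (u \<ominus> u \<otimes> \<tau> g)"
        unfolding qe using u g by (simp add: R.minus_eq R.r_distr R.r_minus)
      also have "\<dots> = \<one> \<ominus> u" unfolding u(2) using u by (simp add: R.minus_eq R.minus_add R.a_comm)
      finally show "(\<one> \<ominus> \<tau> t) \<otimes> \<ominus> (u \<otimes> q) = \<one> \<ominus> \<tau> (inv\<^bsub>\<pi>\<^esub> g)" by (simp add: u_def)
    qed
    then show "inv\<^bsub>\<pi>\<^esub> g \<in> {g \<in> carrier \<pi>. \<exists>q. P g q}" using g by blast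
    fix h assume "h \<in> {g \<in> carrier \<pi>. \<exists>q. P g q}"
    then obtain q' where h: "h \<in> carrier \<pi>" and q': "q' \<in> carrier R"
      and Eq': "\<And>r. r \<in> carrier R \<Longrightarrow> EG h r = EG t (q' \<otimes> r)" and qe': "(\<one> \<ominus> \<tau> t) \<otimes> q' = \<one> \<ominus> \<tau> h"
      by (auto simp: P_def)
    have "P (g \<otimes>\<^bsub>\<pi>\<^esub> h) (q \<oplus> \<tau> g \<otimes> q')"
      unfolding P_def
    proof (intro conjI ballI)
      show "q \<oplus> \<tau> g \<otimes> q' \<in> carrier R" using g q q' by simp
      fix r assume r: "r \<in> carrier R"
      have "EG (g \<otimes>\<^bsub>\<pi>\<^esub> h) r = EG t (q \<otimes> r) \<otimes>\<^bsub>Q1\<^esub> EG t (q' \<otimes> (\<tau> g \<otimes> r))"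
        using g h r by (simp add: EG_mult Eq Eq')
      also have "\<dots> = EG t (q \<otimes> r \<oplus> q' \<otimes> (\<tau> g \<otimes> r))" using t q q' g r by (simp add: EG_add)
      also have "q \<otimes> r \<oplus> q' \<otimes> (\<tau> g \<otimes> r) = (q \<oplus> \<tau> g \<otimes> q') \<otimes> r"
        using q q' \<tau>_closed[OF g] r by algebra
      finally show "EG (g \<otimes>\<^bsub>\<pi>\<^esub> h) r = EG t ((q \<oplus> \<tau> g \<otimes> q') \<otimes> r)" .
    next
      have "(\<one> \<ominus> \<tau> t) \<otimes> (q \<oplus> \<tau> g \<otimes> q') = (\<one> \<ominus> \<tau> t) \<otimes> q \<oplus> \<tau> g \<otimes> ((\<one> \<ominus> \<tau> t) \<otimes> q')"
        using t1 g q q' by (simp add: R.r_distr R.m_ac)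
      also have "\<dots> = \<one> \<ominus> \<tau> g \<otimes> \<tau> h"
        unfolding qe qe' using \<tau>_closed[OF g] \<tau>_closed[OF h] by algebra
      finally show "(\<one> \<ominus> \<tau> t) \<otimes> (q \<oplus> \<tau> g \<otimes> q') = \<one> \<ominus> \<tau> (g \<otimes>\<^bsub>\<pi>\<^esub> h)"
        using g h by (simp add: \<tau>_mult)
    qed
    then show "g \<otimes>\<^bsub>\<pi>\<^esub> h \<in> {g \<in> carrier \<pi>. \<exists>q. P g q}" using g h by blast
  qed auto
  moreover have "P t \<one>" using t t1 by (simp add: P_def)
  moreover have "P n \<zero>" if "n \<in> N" for n
    using that t t1 by (auto simp: P_def EG_N EG_zero \<tau>_N R.minus_eq R.r_neg)
  ultimately have "\<exists>q. P g q" if "g \<in> carrier \<pi>" for g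
    using gen[OF that] t N_carrier \<pi>.subgroup_int_pow_closed[of "{g \<in> carrier \<pi>. \<exists>q. P g q}" t]
      subgroup.m_closed[of "{g \<in> carrier \<pi>. \<exists>q. P g q}" \<pi>] by blast
  then obtain q where q: "\<And>g. g \<in> carrier \<pi> \<Longrightarrow> P g (q g)" by metis
  show ?thesis
    by (rule cycle_killed[where t = t and q = q, OF t _ _ _ _ regular c]) (use q in \<open>auto simp: P_def\<close>)
qed

end

text \<open>
  Only the unit enters, so that the product is computed without any group laws.
\<close>

lemma finprod_ones:
  assumes "\<one>\<^bsub>G\<^esub> \<in> carrier G" "\<one>\<^bsub>G\<^esub> \<otimes>\<^bsub>G\<^esub> \<one>\<^bsub>G\<^esub> = \<one>\<^bsub>G\<^esub>" "\<And>x. x \<in> X \<Longrightarrow> f x = \<one>\<^bsub>G\<^esub>"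
  shows "finprod G f X = \<one>\<^bsub>G\<^esub>"
proof (cases "finite X")
  case True
  let ?f = "\<lambda>x. (\<otimes>\<^bsub>G\<^esub>) (f x)"
  have uniq: "z = \<one>\<^bsub>G\<^esub>" if "(Y, z) \<in> foldSetD (carrier G) ?f \<one>\<^bsub>G\<^esub>" "Y \<subseteq> X" for Y z
    using that by (induction rule: foldSetD.induct) (auto simp: assms)
  have ex: "(X, \<one>\<^bsub>G\<^esub>) \<in> foldSetD (carrier G) ?f \<one>\<^bsub>G\<^esub>"
    using True assms(3)
  proof (induction X rule: finite_induct)
    case (insert x F)
    then have "(insert x F, ?f x \<one>\<^bsub>G\<^esub>) \<in> foldSetD (carrier G) ?f \<one>\<^bsub>G\<^esub>"
      using assms(1,2) by (intro foldSetD.insertI) auto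
    then show ?case using insert.prems assms(2) by simp
  qed (simp add: foldSetD.emptyI assms)
  have "(THE z. (X, z) \<in> foldSetD (carrier G) ?f \<one>\<^bsub>G\<^esub>) = \<one>\<^bsub>G\<^esub>"
    using ex uniq by blast
  then show ?thesis using True by (simp add: finprod_def foldD_def o_def)
qed (simp add: finprod_def)

context twisted_complex
begin

text \<open>
  A single homology class that is annihilated by a nonzero element is already dependent.
\<close>

lemma right_rank_zero:
  assumes K: "carrier K \<subseteq> carrier R" "\<zero> \<in> carrier K" "\<zero>\<^bsub>K\<^esub> = \<zero>"
    and killed: "\<And>c. c \<in> carrier (C 1) \<Longrightarrow> bd 1 c = \<one>\<^bsub>C 0\<^esub> \<Longrightarrow>
      \<exists>\<kappa>\<in>carrier K. \<kappa> \<noteq> \<zero> \<and> scale c \<kappa> \<in> B"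
  shows "right_rank K (twisted_homology U x0 R \<rho> 1) (twisted_scale U x0 R \<rho> 1) = 0"
proof -
  note One_nat_def[simp del]
  let ?H = "twisted_homology U x0 R \<rho> 1" and ?act = "twisted_scale U x0 R \<rho> 1"
  let ?Z = "twisted_cycles U x0 R \<rho> 1"
  have Z: "?Z = {c \<in> carrier (C 1). bd 1 c = \<one>\<^bsub>C 0\<^esub>}"
    by (simp add: twisted_cycles_def kernel_def)
  have H: "\<one>\<^bsub>?H\<^esub> = B" "X \<otimes>\<^bsub>?H\<^esub> Y = X <#>\<^bsub>C 1\<^esub> Y" "carrier ?H = (\<lambda>c. B #>\<^bsub>C 1\<^esub> c) ` ?Z" for X Y
    by (auto simp: twisted_homology_def FactGroup_def RCOSETS_def r_coset_def set_mult_def)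
  have BB: "B <#>\<^bsub>C 1\<^esub> B = B" using C1.subgroup_mult_id[OF B_subgroup] .
  have "bd 1 \<one>\<^bsub>C 1\<^esub> = \<one>\<^bsub>C 0\<^esub>"
    using hom_one[OF bd_hom[of 1] C1.is_group] comm_group.axioms(2)[OF comm_group_C] by simp
  then have one: "\<one>\<^bsub>?H\<^esub> \<in> carrier ?H"
    unfolding H Z using C1.coset_join2[OF C1.one_closed B_subgroup subgroup.one_closed[OF B_subgroup]]
    by (intro image_eqI[of _ _ "\<one>\<^bsub>C 1\<^esub>"]) auto
  have Bc: "B #>\<^bsub>C 1\<^esub> b = B" if "b \<in> B" for b
    using C1.coset_join2[OF subgroup.mem_carrier[OF B_subgroup that] B_subgroup that] .
  have act: "?act X a = B" if "c \<in> carrier (C 1)" "X = B #>\<^bsub>C 1\<^esub> c" "a \<in> carrier R" "scale c a \<in> B" for X c a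
  proof -
    have "scale d a \<in> B" if "d \<in> X" for d
    proof -
      obtain b where b: "b \<in> B" "d = b \<otimes>\<^bsub>C 1\<^esub> c" using \<open>X = _\<close> \<open>d \<in> X\<close> by (auto simp: r_coset_def)
      have "scale d a = scale b a \<otimes>\<^bsub>C 1\<^esub> scale c a"
        using hom_mult[OF scale_hom, of a b 1 c] b \<open>a \<in> _\<close> \<open>c \<in> _\<close> subgroup.mem_carrier[OF B_subgroup] by simp
      then show ?thesis using B_scale[OF b(1) \<open>a \<in> _\<close>] \<open>scale c a \<in> B\<close> subgroup.m_closed[OF B_subgroup] by simp
    qed
    moreover have "c \<in> X" using C1.rcos_self[OF \<open>c \<in> _\<close> B_subgroup] \<open>X = _\<close> by simp
    ultimately show ?thesis using Bc unfolding twisted_scale_def scale_def by auto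
  qed
  have "X = {}" if X: "finite X" "X \<subseteq> carrier ?H" "right_independent K ?H ?act X" for X
  proof (rule ccontr)
    assume "X \<noteq> {}"
    then obtain x where x: "x \<in> X" by blast
    then obtain c where c: "c \<in> ?Z" "x = B #>\<^bsub>C 1\<^esub> c" using X(2) unfolding H by blast
    then obtain \<kappa> where \<kappa>: "\<kappa> \<in> carrier K" "\<kappa> \<noteq> \<zero>" "scale c \<kappa> \<in> B" using killed[of c] unfolding Z by blast
    define a where "a = (\<lambda>y. if y = x then \<kappa> else \<zero>)"
    have "?act y (a y) = \<one>\<^bsub>?H\<^esub>" if y: "y \<in> X" for y
    proof (cases "y = x")
      case True
      then show ?thesis using act[of c x \<kappa>] c \<kappa> K(1) by (auto simp: Z H a_def)
    next
      case False
      obtain d where d: "d \<in> ?Z" "y = B #>\<^bsub>C 1\<^esub> d" using X(2) y unfolding H by blast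
      have "scale d \<zero> = \<one>\<^bsub>C 1\<^esub>" using d by (auto simp: Z scale_def chain_simps)
      then show ?thesis using act[of d y \<zero>] d False subgroup.one_closed[OF B_subgroup] by (auto simp: Z H a_def)
    qed
    then have "finprod ?H (\<lambda>y. ?act y (a y)) X = \<one>\<^bsub>?H\<^esub>"
      using one BB by (intro finprod_ones) (auto simp: H)
    moreover have "a \<in> X \<rightarrow> carrier K" using \<kappa> K by (auto simp: a_def)
    ultimately have "a x = \<zero>" using X(3) x K(3) unfolding right_independent_def by simp
    then show False using \<kappa> by (simp add: a_def)
  qed
  then have "{X. finite X \<and> X \<subseteq> carrier ?H \<and> right_independent K ?H ?act X} \<subseteq> {{}}" by blast
  then have "right_rank K ?H ?act \<le> (SUP X\<in>{{}::(((nat \<Rightarrow> real) \<Rightarrow> 's) \<Rightarrow> 'r) set set}. enat (card X))"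
    unfolding right_rank_def by (rule SUP_subset_mono) simp
  then show ?thesis by (simp add: enat_0)
qed

end

section \<open>Vanishing of the higher-order degrees\<close>

lemma (in group) derived_quotient_comm_group: "comm_group (G Mod derived G (carrier G))"
proof -
  interpret D: normal "derived G (carrier G)" G by (rule derived_self_is_normal)
  show ?thesis
  proof (rule group.group_comm_groupI[OF D.factorgroup_is_group])
    show "X \<otimes>\<^bsub>G Mod derived G (carrier G)\<^esub> Y = Y \<otimes>\<^bsub>G Mod derived G (carrier G)\<^esub> X"
      if "X \<in> carrier (G Mod derived G (carrier G))" "Y \<in> carrier (G Mod derived G (carrier G))" for X Y
      using that D.coset_commute_iff commutator_mem_derived by (auto simp: carrier_FactGroup)
  qed
qed

text \<open>
  The homomorphism \<open>\<psi>\<close> stands for the total linking number.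
\<close>

locale degree_setting = perfect_artin G T W + \<psi>: additive_map G \<psi>
  for G :: "('a, 'b) monoid_scheme" (structure) and T W and \<psi> :: "'a \<Rightarrow> int" +
  fixes k :: nat
begin

abbreviation "N \<equiv> derived G (carrier G)"
abbreviation "\<Gamma> \<equiv> Gamma G k"

lemma \<Gamma>_eq: "\<Gamma> = G Mod N" by (simp only: Gamma_def rational_derived_Suc)

sublocale N: normal N G by (rule derived_self_is_normal)

sublocale \<Gamma>: comm_group \<Gamma> unfolding \<Gamma>_eq by (rule derived_quotient_comm_group)

lemma coset_hom: "(\<lambda>g. N #> g) \<in> hom G \<Gamma>" unfolding \<Gamma>_eq by (rule N.r_coset_hom_Mod)

lemma carrier_\<Gamma>: "carrier \<Gamma> = (\<lambda>g. N #> g) ` carrier G" by (simp add: \<Gamma>_eq carrier_FactGroup)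

lemma coset_eq_one_iff: "g \<in> carrier G \<Longrightarrow> N #> g = \<one>\<^bsub>\<Gamma>\<^esub> \<longleftrightarrow> g \<in> N"
  unfolding \<Gamma>_eq one_FactGroup using coset_join1 coset_join2 N.subgroup_axioms by metis

definition \<phi>' :: "'a set \<Rightarrow> int poly" where "\<phi>' X = the_elem (\<phi> ` X)"

abbreviation "\<Gamma>' \<equiv> Gamma_bar G \<psi> k"

lemma \<Gamma>'_iff: "g \<in> carrier G \<Longrightarrow> N #> g \<in> \<Gamma>' \<longleftrightarrow> \<psi> g = 0"
  by (auto simp: Gamma_bar_def kernel_def \<psi>.the_elem_coset carrier_\<Gamma>)

lemma \<Gamma>'_subset: "\<Gamma>' \<subseteq> carrier \<Gamma>" by (auto simp: Gamma_bar_def kernel_def)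

sublocale O: ordered_group_ring \<Gamma> \<phi>' \<Gamma>'
proof (intro ordered_group_ring.intro ordered_group_ring_axioms.intro \<Gamma>.comm_group_axioms)
  show "\<phi>' (X \<otimes>\<^bsub>\<Gamma>\<^esub> Y) = \<phi>' X + \<phi>' Y" if "X \<in> carrier \<Gamma>" "Y \<in> carrier \<Gamma>" for X Y
  proof -
    obtain x y where xy: "x \<in> carrier G" "X = N #> x" "y \<in> carrier G" "Y = N #> y"
      using \<open>X \<in> _\<close> \<open>Y \<in> _\<close> unfolding carrier_\<Gamma> by blast
    have "X \<otimes>\<^bsub>\<Gamma>\<^esub> Y = N #> (x \<otimes> y)" using hom_mult[OF coset_hom] xy by simp
    then show ?thesis using xy by (simp add: \<phi>'_def \<phi>.the_elem_coset \<phi>_mult)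
  qed
  show "inj_on \<phi>' (carrier \<Gamma>)"
  proof (rule inj_onI)
    fix X Y assume "X \<in> carrier \<Gamma>" "Y \<in> carrier \<Gamma>" and e: "\<phi>' X = \<phi>' Y"
    then obtain x y where xy: "x \<in> carrier G" "X = N #> x" "y \<in> carrier G" "Y = N #> y"
      unfolding carrier_\<Gamma> by blast
    then have "\<phi> (x \<otimes> inv y) = 0"
      using e by (simp add: \<phi>'_def \<phi>.the_elem_coset \<phi>_mult \<phi>.f_inv)
    then have "x \<otimes> inv y \<in> N" using xy \<phi>_eq_zero_iff by simp
    then have "N #> (x \<otimes> inv y) = N" using xy coset_join2[OF _ N.subgroup_axioms] by simp
    then show "X = Y" using coset_mult_inv1[of N x y] xy N.subset by simp
  qed
  show "subgroup \<Gamma>' \<Gamma>"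
  proof (rule \<Gamma>.subgroupI)
    have "N #> \<one> \<in> \<Gamma>'" by (simp only: \<Gamma>'_iff[OF one_closed] \<psi>.f_one)
    then show "\<Gamma>' \<noteq> {}" by blast
    fix X assume X: "X \<in> \<Gamma>'"
    then obtain x where x: "x \<in> carrier G" "X = N #> x" using \<Gamma>'_subset unfolding carrier_\<Gamma> by blast
    interpret h: group_hom G \<Gamma> "\<lambda>g. N #> g"
      by (intro group_hom.intro group_hom_axioms.intro coset_hom is_group \<Gamma>.is_group)
    show "inv\<^bsub>\<Gamma>\<^esub> X \<in> \<Gamma>'"
      using X x \<Gamma>'_iff[of "inv x"] \<Gamma>'_iff[of x] h.hom_inv[of x] by (simp add: \<psi>.f_inv)
    fix Y assume Y: "Y \<in> \<Gamma>'"
    then obtain y where y: "y \<in> carrier G" "Y = N #> y" using \<Gamma>'_subset unfolding carrier_\<Gamma> by blast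
    show "X \<otimes>\<^bsub>\<Gamma>\<^esub> Y \<in> \<Gamma>'"
      using X Y x y \<Gamma>'_iff[of "x \<otimes> y"] \<Gamma>'_iff[of x] \<Gamma>'_iff[of y] h.hom_mult[of x y] by (simp add: \<psi>.f_mult)
  qed (fact \<Gamma>'_subset)
qed

lemma group_ring_bar_eq: "group_ring_bar G \<psi> k = O.A_H"
  by (simp add: group_ring_bar_def O.A_H_def)

lemma S_set_eq: "S_set G \<psi> k = O.S" by (simp add: S_set_def group_ring_bar_eq)

lemma R_ring_eq: "R_ring G \<psi> k = O.R" by (simp add: R_ring_def S_set_eq)

lemma K_field_simps:
  "carrier (K_field G \<psi> k) = {right_fraction O.A O.S r s | r s. r \<in> O.A_H \<and> s \<in> O.S}"
  "\<zero>\<^bsub>K_field G \<psi> k\<^esub> = \<zero>\<^bsub>O.R\<^esub>"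
  by (simp_all add: K_field_def R_ring_eq S_set_eq group_ring_bar_eq)

lemma coefficient_map_eq: "g \<in> carrier G \<Longrightarrow> coefficient_map G \<psi> k g = O.\<rho> (N #> g)"
  by (simp only: coefficient_map_def S_set_eq O.\<rho>_def O.delta_def rational_derived_Suc)

lemma coset_carrier: "g \<in> carrier G \<Longrightarrow> N #> g \<in> carrier \<Gamma>" by (auto simp: carrier_\<Gamma>)

text \<open>
  If the linking number is injective on the abelianization, the latter is isomorphic to a
  subgroup of \<open>\<int>\<close>, and an element with the least positive value generates it.
\<close>

lemma cyclic_mod_N:
  assumes inj: "\<And>g. g \<in> carrier G \<Longrightarrow> \<psi> g = 0 \<Longrightarrow> g \<in> N"
  obtains t where "t \<in> carrier G" "t \<notin> N"
    "\<And>g. g \<in> carrier G \<Longrightarrow> \<exists>n\<in>N. \<exists>m::int. g = n \<otimes> t [^] m"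
proof -
  have g1: "gen 1 \<in> carrier G" "gen 1 \<notin> N" using \<phi>_gen1 \<phi>.f_derived by fastforce+
  then have "\<psi> (gen 1) \<noteq> 0" using inj by blast
  then have "\<exists>g\<in>carrier G. 0 < \<psi> g"
    using g1(1) \<psi>.f_inv[OF g1(1)] inv_closed[OF g1(1)] by (metis linorder_neqE neg_0_less_iff_less)
  then have ex: "\<exists>n. 0 < n \<and> (\<exists>g\<in>carrier G. \<psi> g = int n)"
    by (metis zero_less_imp_eq_int of_nat_0_less_iff)
  define n where "n = (LEAST n. 0 < n \<and> (\<exists>g\<in>carrier G. \<psi> g = int n))"
  have n: "0 < n" "\<exists>g\<in>carrier G. \<psi> g = int n" using LeastI_ex[OF ex] by (auto simp: n_def)
  then obtain t where t: "t \<in> carrier G" "\<psi> t = int n" by blast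
  have "t \<notin> N" using \<psi>.f_derived t n by fastforce
  moreover have "\<exists>n\<in>N. \<exists>m::int. g = n \<otimes> t [^] m" if g: "g \<in> carrier G" for g
  proof -
    define m where "m = \<psi> g div int n"
    define h where "h = g \<otimes> inv (t [^] m)"
    have h: "h \<in> carrier G" using g t by (simp add: h_def)
    have "\<psi> h = \<psi> g mod int n"
      using g t by (simp add: h_def \<psi>.f_mult \<psi>.f_inv \<psi>.f_int_pow m_def minus_div_mult_eq_mod algebra_simps)
    then have r: "0 \<le> \<psi> h" "\<psi> h < int n" using n by simp_all
    have "\<psi> h = 0"
    proof (rule ccontr)
      assume "\<psi> h \<noteq> 0"
      then have "0 < nat (\<psi> h) \<and> (\<exists>g\<in>carrier G. \<psi> g = int (nat (\<psi> h)))" using r h by auto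
      then have "n \<le> nat (\<psi> h)" unfolding n_def by (rule Least_le)
      then show False using r by linarith
    qed
    then have "h \<in> N" using inj h by blast
    moreover have "g = h \<otimes> t [^] m" using g t by (simp add: h_def m_assoc)
    ultimately show ?thesis by blast
  qed
  ultimately show thesis using that t by blast
qed

lemma zero_in_K: "\<zero>\<^bsub>O.R\<^esub> \<in> {right_fraction O.A O.S r s | r s. r \<in> O.A_H \<and> s \<in> O.S}"
proof -
  have "\<zero>\<^bsub>O.A\<^esub> \<in> O.A_H" using O.zero_closed by (simp add: O.A_H_def O.zero_A)
  moreover have "\<zero>\<^bsub>O.R\<^esub> = right_fraction O.A O.S \<zero>\<^bsub>O.A\<^esub> \<one>\<^bsub>O.A\<^esub>" by (simp add: right_fractions_def)
  ultimately show ?thesis using O.S_one by blast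
qed

lemma K_subset: "{right_fraction O.A O.S r s | r s. r \<in> O.A_H \<and> s \<in> O.S} \<subseteq> carrier O.R"
  by (auto simp: right_fractions_def O.A_H_def)

end

text \<open>
  Either some nontrivial element \<open>t\<close> of \<open>\<Gamma>\<^sub>k\<close> has linking number \<open>0\<close>, and then the nonzero element
  \<open>1 - \<tau> t\<close> of the skew field annihilates the homology; or \<open>\<Gamma>\<^sub>k\<close> is infinite cyclic and every cycle is
  a boundary.
\<close>

theorem higher_order_rank_zero:
  fixes G (structure)
  assumes "degree_setting G T W \<psi>" and G: "G = fundamental_group U x0" and U: "path_connected U" and x0: "x0 \<in> U"
  shows "right_rank (K_field G \<psi> k)
    (twisted_homology U x0 (R_ring G \<psi> k) (coefficient_map G \<psi> k) 1)
    (twisted_scale U x0 (R_ring G \<psi> k) (coefficient_map G \<psi> k) 1) = 0"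
proof -
  interpret degree_setting G T W \<psi> k by fact
  interpret R: domain O.R by (rule O.domain_R)
  interpret P: perfect_twisted_complex O.R U x0 "coefficient_map G \<psi> k"
  proof (intro perfect_twisted_complex.intro twisted_complex.intro twisted_complex_axioms.intro
      perfect_twisted_complex_axioms.intro R.is_cring U x0; unfold G[symmetric])
    show "coefficient_map G \<psi> k g \<in> carrier O.R" if "g \<in> carrier G" for g
      using that by (simp add: coefficient_map_eq O.\<rho>_closed coset_carrier)
    show "coefficient_map G \<psi> k \<one> = \<one>\<^bsub>O.R\<^esub>"
      using coset_eq_one_iff[OF one_closed] N.one_closed by (simp add: coefficient_map_eq O.\<rho>_one)
    show "coefficient_map G \<psi> k (g \<otimes> h) = coefficient_map G \<psi> k g \<otimes>\<^bsub>O.R\<^esub> coefficient_map G \<psi> k h"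
      if "g \<in> carrier G" "h \<in> carrier G" for g h
      using that hom_mult[OF coset_hom that] by (simp add: coefficient_map_eq O.\<rho>_mult coset_carrier)
    show "derived G N = N" by (rule perfect)
  qed
  have \<tau>: "P.\<tau> t = O.\<rho> (N #> inv t)" if "t \<in> carrier G" for t
    using that by (simp add: P.\<tau>_def G[symmetric] coefficient_map_eq)
  have \<tau>_ne: "\<one>\<^bsub>O.R\<^esub> \<ominus>\<^bsub>O.R\<^esub> P.\<tau> t \<noteq> \<zero>\<^bsub>O.R\<^esub>" if t: "t \<in> carrier G" "t \<notin> N" for t
  proof
    assume "\<one>\<^bsub>O.R\<^esub> \<ominus>\<^bsub>O.R\<^esub> P.\<tau> t = \<zero>\<^bsub>O.R\<^esub>"
    then have "O.\<rho> (N #> inv t) = \<one>\<^bsub>O.R\<^esub>"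
      using t O.\<rho>_closed[OF coset_carrier[of "inv t"]] by (simp add: \<tau>)
    then have "inv t \<in> N"
      using t coset_eq_one_iff[of "inv t"] O.\<rho>_eq_one_iff[OF coset_carrier[of "inv t"]] by simp
    then show False using N.m_inv_closed t by fastforce
  qed
  have \<tau>_cl: "P.\<tau> t \<in> carrier O.R" if "t \<in> carrier G" for t
    by (rule P.\<tau>_closed[unfolded G[symmetric], OF that])
  have regular: "a = \<zero>\<^bsub>O.R\<^esub>" if "t \<in> carrier G" "t \<notin> N" "a \<in> carrier O.R"
      "(\<one>\<^bsub>O.R\<^esub> \<ominus>\<^bsub>O.R\<^esub> P.\<tau> t) \<otimes>\<^bsub>O.R\<^esub> a = \<zero>\<^bsub>O.R\<^esub>" for a t
    using R.integral[OF that(4)] \<tau>_ne[OF that(1,2)] that(3) \<tau>_cl[OF that(1)] by auto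
  show ?thesis
    unfolding R_ring_eq
  proof (rule P.right_rank_zero)
    show "carrier (K_field G \<psi> k) \<subseteq> carrier O.R" "\<zero>\<^bsub>O.R\<^esub> \<in> carrier (K_field G \<psi> k)"
      "\<zero>\<^bsub>K_field G \<psi> k\<^esub> = \<zero>\<^bsub>O.R\<^esub>"
      using K_subset zero_in_K by (simp_all only: K_field_simps)
    fix c assume c: "c \<in> carrier (P.C 1)" "P.bd 1 c = \<one>\<^bsub>P.C 0\<^esub>"
    show "\<exists>\<kappa>\<in>carrier (K_field G \<psi> k). \<kappa> \<noteq> \<zero>\<^bsub>O.R\<^esub> \<and> P.scale c \<kappa> \<in> P.B"
    proof (cases "\<exists>t\<in>carrier G. t \<notin> N \<and> \<psi> t = 0")
      case True
      then obtain t where t: "t \<in> carrier G" "t \<notin> N" "\<psi> t = 0" by blast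
      have "N #> inv t \<in> \<Gamma>'" using t \<Gamma>'_iff[of "inv t"] by (simp add: \<psi>.f_inv)
      then have "\<one>\<^bsub>O.R\<^esub> \<ominus>\<^bsub>O.R\<^esub> P.\<tau> t \<in> carrier (K_field G \<psi> k)"
        unfolding \<tau>[OF t(1)] K_field_simps by (rule O.one_minus_\<rho>_in_K)
      moreover have "P.scale c (\<one>\<^bsub>O.R\<^esub> \<ominus>\<^bsub>O.R\<^esub> P.\<tau> t) \<in> P.B"
        by (rule P.cycle_killed_by_difference[OF _ _ c, unfolded G[symmetric], OF t(1) regular[OF t(1,2)]])
      ultimately show ?thesis using \<tau>_ne[OF t(1,2)] by blast
    next
      case False
      then obtain t where t: "t \<in> carrier G" "t \<notin> N"
        and gen: "\<And>g. g \<in> carrier G \<Longrightarrow> \<exists>n\<in>N. \<exists>m::int. g = n \<otimes> t [^] m"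
        using cyclic_mod_N by metis
      have "P.scale c \<one>\<^bsub>O.R\<^esub> \<in> P.B"
        by (rule P.cycle_is_boundary[OF _ _ _ c, unfolded G[symmetric], OF t(1) gen regular[OF t]])
      moreover have "\<one>\<^bsub>O.R\<^esub> \<in> carrier (K_field G \<psi> k)" unfolding K_field_simps by (rule O.one_in_K)
      ultimately show ?thesis using R.one_not_zero by blast
    qed
  qed
qed

theorem mainTheorem3:
  fixes f :: "complex poly poly" and x0 :: "complex \<times> complex"
    and T :: coxeter_type and k :: nat
  assumes "reduced_plane_curve f"
    and "general_position_at_infinity f"
    and "x0 \<in> curve_complement f"
    and "T \<in> TypeA ` {4..} \<union> TypeB ` {5..} \<union> TypeD ` {5..} \<union> TypeE ` {6, 7, 8} \<union> TypeH ` {3, 4}"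
    and "fundamental_group (curve_complement f) x0 \<cong>
           artin_group (coxeter_rank T) (coxeter_matrix T)"
  shows "higher_order_degree f x0 k = 0"
proof -
  let ?U = "curve_complement f"
  let ?G = "fundamental_group ?U x0"
  interpret group ?G by (rule group_fundamental_group[OF assms(3)])
  obtain W where "artin_presented ?G (coxeter_rank T) (coxeter_matrix T) W"
    using iso_artin_group_presented[OF assms(5)] by blast
  then have "degree_setting ?G T W (total_linking f)"
    using assms(4) total_linking_mult[of _ f x0]
    by (intro degree_setting.intro perfect_artin.intro additive_map.intro additive_map_axioms.intro
        perfect_artin_axioms.intro is_group) (simp_all add: perfect_types_def)
  from higher_order_rank_zero[OF this HOL.refl path_connected_curve_complement assms(3)]
  show ?thesis by (simp add: higher_order_degree_def Let_def)
qed

end
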